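(* Let $\lambda\in(0,\infty]$ and let $\zeta_{out}=\zeta_{out}(\mathbb Z,\lambda)$ and $\zeta_{in}=\zeta_{in}(\mathbb Z,\lambda)$ be the outer and inner densities of Activated Random Walk on $\mathbb Z$ with sleep rate $\lambda$. Assume $\zeta_{out}>0$. Then for all $\varepsilon>0$, $$\mathbb P\left(\#A_n\ \ge\ \frac{n}{\zeta_{in}+\varepsilon}\ \text{ and }\ A_n\subseteq B_{\frac{n}{2\zeta_{out}}(1+\varepsilon)}\ \text{ for all sufficiently large } n\right)=1,$$ where $A_n$ is the random set of sites that fire at least once during the stabilization of $n$ active particles at $0$.
   Context: **Activated Random Walk (ARW) on $\mathbb Z$ with sleep rate $\lambda\in(0,\infty]$.** $\mathbb N=\{0,1,2,\dots\}$, $\mathbb N_s=\mathbb N\cup\{s\}$, ordered $0<s<1<2<\cdots$. A configuration is a map $\eta:\mathbb Z\to\mathbb N_s$: $\eta(x)=k\ge1$ means $k$ active particles at $x$, $\eta(x)=s$ one sleeping particle, $\eta(x)=0$ no particle. Put $|s|=1$, $|k|=k$. Each site $x$ carries a stack $(\rho_x(k))_{k\ge1}$ of instructions; all instructions are independent, and $\rho_x(k)=s$ with probability $\frac{\lambda}{1+\lambda}$, $\rho_x(k)=x-1$ or $x+1$ with probability $\frac1{2(1+\lambda)}$ each. Firing $x$ means using the first unused instruction at $x$: instruction $x\pm1$ moves one particle from $x$ to that site (a sleeping particle there becomes active); instruction $s$ makes the particle at $x$ fall asleep if it is alone at $x$ and has no effect otherwise. Firing $x$ is legal if $\eta(x)\ge1$.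 A configuration is stable if it takes values in $\{0,s\}$. Stabilizing a configuration with finitely many particles means performing legal firings until it is stable; the number of firings at each site (counting $s$ instructions) and the final configuration do not depend on the order of legal firings (Abelian property). For $\lambda=\infty$ (Internal DLA): the stacks contain only the instructions $x\pm1$, each with probability $1/2$, and an active particle alone at its site becomes asleep instantly without firing, so that only sites with at least two particles fire. $A_n\subset\mathbb Z$ is the set of sites that fire at least once in the stabilization of $n\delta_0$ ($n$ active particles at $0$), the same stacks being used for all $n$. $B_r=[-r,r]\cap\mathbb Z$. $\#$ denotes cardinality. **Outer density.** For $\zeta\in(0,1)$ let $(\eta(x))_{x\in\mathbb Z}$ be i.i.d. Bernoulli($\zeta$), independent of the stacks, viewed as a configuration with one active particle at each $x$ with $\eta(x)=1$. Let $\mathbf E_\zeta$ be expectation with respect to the joint law of $\eta$ and the stacks. Let $w(x)\in\mathbb N\cup\{\infty\}$ be the number of firings needed at $x$ to stabilize $\eta$, i.e. the supremum, over finite legal firing sequences for $\eta$, of the number of firings at $x$. Define $\zeta_{out}=\sup\{\zeta>0:\mathbf E_\zeta(w(0)^3)<\infty\}$ (with $\sup\emptyset=0$). **Inner density.** For a finite interval $I\subset\mathbb Z$ let $\mathbf 1_I$ be the configuration with one active particle at each site of $I$ and none elsewhere. Let $\mathcal S_I(\mathbf 1_I)$ be its stabilization when particles stepping outside $I$ are immediately removed, and $|\mathcal S_I(\mathbf 1_I)|$ the number of (sleeping) particles in the final configuration. Define $\zeta_{in,I}=\inf\{\zeta>0:\mathbb P(|\mathcal S_I(\mathbf 1_I)|>\zeta\,\#I)\le(\#I)^{-20}\}$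 and $\zeta_{in}=\limsup_{\#I\to\infty}\zeta_{in,I}$. *)

theory Defs
  imports "HOL-Probability.Probability"
begin

section \<open>Configurations and instructions\<close>

text \<open>
  \<open>Num 0\<close> is an empty site, \<open>Num k\<close> with \<open>k \<ge> 1\<close> stands for \<open>k\<close> active particles, and
  \<open>Asleep\<close> is the state \<open>s\<close>, that is, a single sleeping particle.
\<close>

datatype site_state = Num nat | Asleep

type_synonym config = "int \<Rightarrow> site_state"

fun mass :: "site_state \<Rightarrow> nat" where
  "mass (Num k) = k"
| "mass Asleep = 1"

definition active :: "site_state \<Rightarrow> bool" where
  "active a \<longleftrightarrow> (\<exists>k\<ge>1. a = Num k)"

definition stable :: "config \<Rightarrow> bool" where
  "stable \<eta> \<longleftrightarrow> (\<forall>x. \<eta> x \<in> {Num 0, Asleep})"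

fun add_particle :: "site_state \<Rightarrow> site_state" where
  "add_particle (Num k) = Num (k + 1)"
| "add_particle Asleep = Num 2"

text \<open>Only applied to active sites; the second equation is there for totality.\<close>

fun remove_particle :: "site_state \<Rightarrow> site_state" where
  "remove_particle (Num k) = Num (k - 1)"
| "remove_particle Asleep = Asleep"

datatype instr = GoLeft | GoRight | Sleep

text \<open>
  The set \<open>D\<close> is the region in which the particles live: a particle stepping outside \<open>D\<close> is
  removed at once. The dynamics on all of the integers is the case \<open>D = UNIV\<close>.
\<close>

definition move_particle :: "int set \<Rightarrow> int \<Rightarrow> int \<Rightarrow> config \<Rightarrow> config" where
  "move_particle D x y \<eta> =
     (let \<eta>' = \<eta>(x := remove_particle (\<eta> x))
      in if y \<in> D then \<eta>'(y := add_particle (\<eta>' y)) else \<eta>')"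

fun execute :: "int set \<Rightarrow> int \<Rightarrow> instr \<Rightarrow> config \<Rightarrow> config" where
  "execute D x GoLeft \<eta> = move_particle D x (x - 1) \<eta>"
| "execute D x GoRight \<eta> = move_particle D x (x + 1) \<eta>"
| "execute D x Sleep \<eta> = (if \<eta> x = Num 1 then \<eta>(x := Asleep) else \<eta>)"


section \<open>Legal firings and stabilization\<close>

text \<open>
  For \<open>lam = \<infinity>\<close>, lone active particles become asleep instantly and without firing. This is done by
  \<open>settle\<close>, which is applied to the initial configuration and after every firing; no site then
  ever carries exactly one active particle, so that only sites with at least two particles fire.
\<close>

definition settle :: "ennreal \<Rightarrow> config \<Rightarrow> config" where
  "settle lam \<eta> = (if lam = \<infinity> then (\<lambda>x. if \<eta> x = Num 1 then Asleep else \<eta> x) else \<eta>)"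

text \<open>\<open>\<rho> (x, k)\<close> is the \<open>(k + 1)\<close>-st instruction of the stack at the site \<open>x\<close>.\<close>

type_synonym stacks = "int \<times> nat \<Rightarrow> instr"

text \<open>A configuration together with the number of instructions already used at each site.\<close>

type_synonym state = "config \<times> (int \<Rightarrow> nat)"

definition initial :: "ennreal \<Rightarrow> config \<Rightarrow> state" where
  "initial lam \<eta> = (settle lam \<eta>, \<lambda>x. 0)"

fun fire :: "ennreal \<Rightarrow> stacks \<Rightarrow> int set \<Rightarrow> int \<Rightarrow> state \<Rightarrow> state" where
  "fire lam \<rho> D x (\<eta>, u) = (settle lam (execute D x (\<rho> (x, u x)) \<eta>), u(x := u x + 1))"

fun legal_from :: "ennreal \<Rightarrow> stacks \<Rightarrow> int set \<Rightarrow> state \<Rightarrow> int list \<Rightarrow> bool" where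
  "legal_from lam \<rho> D S [] \<longleftrightarrow> True"
| "legal_from lam \<rho> D S (x # xs) \<longleftrightarrow> active (fst S x) \<and> legal_from lam \<rho> D (fire lam \<rho> D x S) xs"

definition legal :: "ennreal \<Rightarrow> stacks \<Rightarrow> int set \<Rightarrow> config \<Rightarrow> int list \<Rightarrow> bool" where
  "legal lam \<rho> D \<eta> xs \<longleftrightarrow> legal_from lam \<rho> D (initial lam \<eta>) xs"

definition result :: "ennreal \<Rightarrow> stacks \<Rightarrow> int set \<Rightarrow> config \<Rightarrow> int list \<Rightarrow> config" where
  "result lam \<rho> D \<eta> xs = fst (fold (fire lam \<rho> D) xs (initial lam \<eta>))"

definition stabilizing :: "ennreal \<Rightarrow> stacks \<Rightarrow> int set \<Rightarrow> config \<Rightarrow> int list \<Rightarrow> bool" where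
  "stabilizing lam \<rho> D \<eta> xs \<longleftrightarrow> legal lam \<rho> D \<eta> xs \<and> stable (result lam \<rho> D \<eta> xs)"

text \<open>
  By the Abelian property all stabilizing sequences have the same result and the same firing counts.
  If there is no stabilizing sequence, which has probability 0 for finitely many particles,
  \<open>stabilization\<close> is unspecified and \<open>fired_set\<close> below is empty.
\<close>

definition stabilization :: "ennreal \<Rightarrow> stacks \<Rightarrow> int set \<Rightarrow> config \<Rightarrow> config" where
  "stabilization lam \<rho> D \<eta> = (THE \<eta>'. \<exists>xs. stabilizing lam \<rho> D \<eta> xs \<and> \<eta>' = result lam \<rho> D \<eta> xs)"

definition fired_set :: "ennreal \<Rightarrow> stacks \<Rightarrow> nat \<Rightarrow> int set" where
  "fired_set lam \<rho> n =
     {x. \<exists>xs. stabilizing lam \<rho> UNIV (\<lambda>y. if y = 0 then Num n else Num 0) xs \<and> x \<in> set xs}"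

definition odometer :: "ennreal \<Rightarrow> stacks \<Rightarrow> config \<Rightarrow> int \<Rightarrow> enat" where
  "odometer lam \<rho> \<eta> x = (SUP xs \<in> {xs. legal lam \<rho> UNIV \<eta> xs}. enat (count_list xs x))"

definition one_on :: "int set \<Rightarrow> config" where
  "one_on A = (\<lambda>x. if x \<in> A then Num 1 else Num 0)"

definition lattice_ball :: "real \<Rightarrow> int set" where
  "lattice_ball r = {x. - r \<le> of_int x \<and> of_int x \<le> r}"


section \<open>Random stacks and random configurations\<close>

definition instr_pmf :: "ennreal \<Rightarrow> instr pmf" where
  "instr_pmf lam =
     (if lam = \<infinity> then pmf_of_set {GoLeft, GoRight}
      else let l = enn2real lam in
        pmf_of_list [(Sleep, l / (1 + l)), (GoLeft, 1 / (2 * (1 + l))), (GoRight, 1 / (2 * (1 + l)))])"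

lemma instr_pmf_wf:
  fixes l :: real
  assumes "0 \<le> l"
  shows "pmf_of_list_wf
    [(Sleep, l / (1 + l)), (GoLeft, 1 / (2 * (1 + l))), (GoRight, 1 / (2 * (1 + l)))]"
proof (rule pmf_of_list_wfI)
  show "sum_list (map snd
    [(Sleep, l / (1 + l)), (GoLeft, 1 / (2 * (1 + l))), (GoRight, 1 / (2 * (1 + l)))]) = 1"
  proof -
    have "1 + l \<noteq> 0" using assms by linarith
    then have "l / (1 + l) + 1 / (2 * (1 + l)) + 1 / (2 * (1 + l)) = 1"
      by (simp add: divide_simps) (simp add: algebra_simps)
    then show ?thesis by simp
  qed
qed (use assms in auto)

definition stack_measure :: "ennreal \<Rightarrow> stacks measure" where
  "stack_measure lam = (\<Pi>\<^sub>M i\<in>UNIV. measure_pmf (instr_pmf lam))"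

definition bernoulli_field :: "real \<Rightarrow> (int \<Rightarrow> bool) measure" where
  "bernoulli_field \<zeta> = (\<Pi>\<^sub>M x\<in>UNIV. measure_pmf (bernoulli_pmf \<zeta>))"


section \<open>Outer and inner densities\<close>

definition outer_moment :: "ennreal \<Rightarrow> real \<Rightarrow> ennreal" where
  "outer_moment lam \<zeta> =
     (\<integral>\<^sup>+ (\<rho>, \<sigma>). ennreal_of_enat (odometer lam \<rho> (one_on {x. \<sigma> x}) 0) ^ 3
        \<partial>(stack_measure lam \<Otimes>\<^sub>M bernoulli_field \<zeta>))"

definition zeta_out :: "ennreal \<Rightarrow> real" where
  "zeta_out lam =
     (let Z = {\<zeta>. 0 < \<zeta> \<and> \<zeta> < 1 \<and> outer_moment lam \<zeta> < \<infinity>} in if Z = {} then 0 else Sup Z)"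

definition particles_left :: "ennreal \<Rightarrow> stacks \<Rightarrow> int set \<Rightarrow> nat" where
  "particles_left lam \<rho> I = (\<Sum>x\<in>I. mass (stabilization lam \<rho> I (one_on I) x))"

definition zeta_in_interval :: "ennreal \<Rightarrow> int set \<Rightarrow> real" where
  "zeta_in_interval lam I =
     Inf {\<zeta>. 0 < \<zeta> \<and>
       \<P>(\<rho> in stack_measure lam. real (particles_left lam \<rho> I) > \<zeta> * real (card I))
         \<le> 1 / real (card I) ^ 20}"

definition large_intervals :: "int set filter" where
  "large_intervals = inf (filtercomap card at_top) (principal {{a..b} | a b. a \<le> b})"

text \<open>
  For nonempty \<open>I\<close> the density \<open>zeta_in_interval lam I\<close> lies between 0 and 1, so that the upper limit,
  taken in the extended reals, is finite.
\<close>

definition zeta_in :: "ennreal \<Rightarrow> real" where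
  "zeta_in lam = real_of_ereal (Limsup large_intervals (\<lambda>I. ereal (zeta_in_interval lam I)))"

end

theory Submission
  imports Defs "HOL-Real_Asymp.Real_Asymp"
begin

text \<open>
  An odometer \<open>u\<close> gives the number of instructions used at each site. The stabilizing odometer is
  the least stable one, and any stable function bounds it, whether or not it comes from legal
  firings. Firing according to an adaptive strategy leaves fresh stacks behind, so strategies can be
  concatenated, and their probabilities are estimated by supermartingales.

  Outer bound: \<open>n\<close> particles at the origin first walk until they occupy distinct sites of a Bernoulli
  configuration of density slightly below the outer density. The sum of the positions is a
  martingale, so they need only a little more than \<open>n / (2 * zeta_out)\<close> sites on each side. By the
  moment assumption few particles then leave this interval, and those are gambler's ruin walkers
  which do not get far.

  Inner bound: the configuration left in a tile of the line depends, besides the stacks of the tile,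
  only on the numbers of particles that entered it through its two ends. If one of them is large,
  the tile was full at some time, and what is left has the law of the stabilization of a full tile,
  so its density is at most \<open>zeta_in + \<epsilon>\<close>. A union bound over all tiles and entrance numbers
  applies; tiles entered by few particles have little mass beyond them.

  Since the fired set increases with \<open>n\<close>, the subsequence \<open>n = k ^ 20\<close> suffices.
\<close>

section \<open>Odometers\<close>

text \<open>The sleep state is what makes restarts delicate: fresh stacks do not remember it, so
  minimality of an odometer passes to them only where no lone particle sleeps. Hence the filling
  runs fire only sites with two or more particles, and restart from full tiles. The outer bound
  needs mere stability, which survives every restart.

  The Bernoulli targets are fixed by a probabilistic existence argument, so that only the stacks
  stay random.

  The numbers entering a tile depend on the stacks of the tile itself, because particles leave and
  come back. Conditioning on them is therefore impossible, and all their values are treated at once.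

  Exponents: filling a tile of length \<open>m\<close> takes of order \<open>m ^ 2\<close>
  entrances, to be negligible against \<open>n\<close>, so \<open>m\<close> is a little below the
  square root of \<open>n\<close>, namely \<open>n\<close> to the power 9/20. A tile fails with
  probability of order \<open>m ^ (-20)\<close>, that is \<open>n ^ (-9)\<close>, against about
  \<open>n ^ 8\<close> choices of tile and entrance numbers. This bound and the Chebyshev bound for
  the centre of mass are only of order \<open>1 / n\<close>, not summable over all \<open>n\<close>;
  this forces the sparse subsequence.\<close>

definition cnt :: "instr \<Rightarrow> stacks \<Rightarrow> int \<Rightarrow> nat \<Rightarrow> nat" where
  "cnt i \<rho> x k = (\<Sum>j<k. if \<rho> (x, j) = i then 1 else 0)"

lemma cnt_0 [simp]: "cnt i \<rho> x 0 = 0"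
  by (simp add: cnt_def)

lemma cnt_Suc [simp]: "cnt i \<rho> x (Suc k) = cnt i \<rho> x k + (if \<rho> (x, k) = i then 1 else 0)"
  by (simp add: cnt_def)

lemma cnt_mono: "k \<le> l \<Longrightarrow> cnt i \<rho> x k \<le> cnt i \<rho> x l"
  unfolding cnt_def by (rule sum_mono2) auto

lemma cnt_le: "cnt i \<rho> x k \<le> k"
  by (induction k) auto

text \<open>Integer valued, since an arbitrary \<open>u\<close> may prescribe more departures than
  there are particles; it is a particle count once \<open>u\<close> comes from firings.\<close>

definition net :: "stacks \<Rightarrow> (int \<Rightarrow> nat) \<Rightarrow> (int \<Rightarrow> nat) \<Rightarrow> int \<Rightarrow> int" where
  "net \<rho> \<eta> u x = int (\<eta> x) + int (cnt GoRight \<rho> (x - 1) (u (x - 1)))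
     + int (cnt GoLeft \<rho> (x + 1) (u (x + 1)))
     - int (cnt GoRight \<rho> x (u x)) - int (cnt GoLeft \<rho> x (u x))"

text \<open>Sleep is read off the stack: for finite \<open>lam\<close>, along legal firings a lone
  particle sleeps exactly if the last instruction used at its site is \<open>Sleep\<close>. An
  arrival raises \<open>net\<close> to 2, and returning to 1 takes a move, which is then the last
  instruction.\<close>

definition asleep :: "stacks \<Rightarrow> (int \<Rightarrow> nat) \<Rightarrow> int \<Rightarrow> bool" where
  "asleep \<rho> u x \<longleftrightarrow> u x > 0 \<and> \<rho> (x, u x - 1) = Sleep"

definition act :: "ennreal \<Rightarrow> stacks \<Rightarrow> (int \<Rightarrow> nat) \<Rightarrow> (int \<Rightarrow> nat) \<Rightarrow> int \<Rightarrow> bool" where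
  "act lam \<rho> \<eta> u x \<longleftrightarrow>
     net \<rho> \<eta> u x \<ge> 2 \<or> (net \<rho> \<eta> u x = 1 \<and> lam \<noteq> \<infinity> \<and> \<not> asleep \<rho> u x)"

definition stable_odo ::
  "ennreal \<Rightarrow> int set \<Rightarrow> stacks \<Rightarrow> (int \<Rightarrow> nat) \<Rightarrow> (int \<Rightarrow> nat) \<Rightarrow> bool" where
  "stable_odo lam D \<rho> \<eta> u \<longleftrightarrow> (\<forall>x. x \<notin> D \<longrightarrow> u x = 0) \<and> (\<forall>x\<in>D. \<not> act lam \<rho> \<eta> u x)"

definition min_odo ::
  "ennreal \<Rightarrow> int set \<Rightarrow> stacks \<Rightarrow> (int \<Rightarrow> nat) \<Rightarrow> (int \<Rightarrow> nat) \<Rightarrow> bool" where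
  "min_odo lam D \<rho> \<eta> u \<longleftrightarrow>
     stable_odo lam D \<rho> \<eta> u \<and> (\<forall>v. stable_odo lam D \<rho> \<eta> v \<longrightarrow> u \<le> v)"

lemma net_mono:
  assumes "\<eta> x \<le> \<eta>' x" "u (x - 1) \<le> v (x - 1)" "u (x + 1) \<le> v (x + 1)" "u x = v x"
  shows "net \<rho> \<eta> u x \<le> net \<rho> \<eta>' v x"
  using assms(1) cnt_mono[OF assms(2), of GoRight \<rho> "x - 1"]
    cnt_mono[OF assms(3), of GoLeft \<rho> "x + 1"] assms(4)
  by (simp add: net_def)

text \<open>Since \<open>u x = v x\<close>, the last instruction at \<open>x\<close> is the same,
  and further firings at the neighbours can only bring particles. A lone awake particle stays so or
  gets company, and two particles are active in any case.\<close>

lemma act_mono: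
  assumes "act lam \<rho> \<eta> u x"
    and "\<eta> x \<le> \<eta>' x" "u (x - 1) \<le> v (x - 1)" "u (x + 1) \<le> v (x + 1)" "u x = v x"
  shows "act lam \<rho> \<eta>' v x"
proof -
  have "net \<rho> \<eta> u x \<le> net \<rho> \<eta>' v x" using assms(2-5) by (rule net_mono)
  then show ?thesis using assms(1,5) by (auto simp: act_def asleep_def)
qed

lemma stable_odo_mono:
  assumes "stable_odo lam D \<rho> \<eta>' u" "\<And>x. x \<in> D \<Longrightarrow> \<eta> x \<le> \<eta>' x"
  shows "stable_odo lam D \<rho> \<eta> u"
  using assms act_mono[of lam \<rho> \<eta> u _ \<eta>' u] by (auto simp: stable_odo_def)

lemma min_odo_unique: "min_odo lam D \<rho> \<eta> u \<Longrightarrow> min_odo lam D \<rho> \<eta> v \<Longrightarrow> u = v"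
  by (meson antisym min_odo_def)

lemma min_odo_stable: "min_odo lam D \<rho> \<eta> u \<Longrightarrow> stable_odo lam D \<rho> \<eta> u"
  by (simp add: min_odo_def)

lemma min_odo_least: "min_odo lam D \<rho> \<eta> u \<Longrightarrow> stable_odo lam D \<rho> \<eta> v \<Longrightarrow> u x \<le> v x"
  by (auto simp: min_odo_def le_fun_def)

text \<open>The pointwise infimum of all stable odometers is stable: at each \<open>x\<close> it is
  attained by some stable \<open>w\<close> lying above it, and activity at \<open>x\<close> would
  pass from the infimum to \<open>w\<close> by \<open>act_mono\<close>.\<close>

lemma min_odo_exists:
  assumes "stable_odo lam D \<rho> \<eta> v"
  shows "\<exists>u. min_odo lam D \<rho> \<eta> u"
proof -
  define S where "S = {w. stable_odo lam D \<rho> \<eta> w}"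
  define u where "u = (\<lambda>x. Inf ((\<lambda>w. w x) ` S))"
  have le: "u x \<le> w x" if "w \<in> S" for w x
    unfolding u_def using that by (intro cInf_lower) auto
  have "\<exists>w\<in>S. u x = w x" for x
  proof -
    have "(\<lambda>w. w x) ` S \<noteq> {}" using assms by (auto simp: S_def)
    then have "u x \<in> (\<lambda>w. w x) ` S" unfolding u_def by (rule Inf_nat_def1)
    then show ?thesis by auto
  qed
  then have att: "\<exists>w. stable_odo lam D \<rho> \<eta> w \<and> u x = w x \<and> u \<le> w" for x
    using le by (fastforce simp: S_def le_fun_def)
  have "stable_odo lam D \<rho> \<eta> u"
    unfolding stable_odo_def
  proof (intro conjI allI impI ballI)
    fix x assume "x \<notin> D"
    then show "u x = 0" using att[of x] by (auto simp: stable_odo_def)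
  next
    fix x assume "x \<in> D"
    obtain w where w: "stable_odo lam D \<rho> \<eta> w" "u x = w x" "u \<le> w" using att by blast
    show "\<not> act lam \<rho> \<eta> u x"
    proof
      assume "act lam \<rho> \<eta> u x"
      then have "act lam \<rho> \<eta> w x" by (rule act_mono) (use w in \<open>auto simp: le_fun_def\<close>)
      with w \<open>x \<in> D\<close> show False by (auto simp: stable_odo_def)
    qed
  qed
  then show ?thesis
    using le by (auto simp: min_odo_def S_def le_fun_def)
qed

text \<open>The least action principle; \<open>v\<close> need not come from a firing sequence.\<close>

lemma act_less_stable:
  assumes "stable_odo lam D \<rho> \<eta> v" "u \<le> v" "act lam \<rho> \<eta> u x" "x \<in> D"
  shows "u x < v x"
proof (rule ccontr)
  assume "\<not> u x < v x"
  then have "u x = v x" using assms(2) by (simp add: le_fun_def antisym)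
  then have "act lam \<rho> \<eta> v x"
    using assms(2) by (intro act_mono[OF assms(3)]) (auto simp: le_fun_def)
  then show False using assms by (auto simp: stable_odo_def)
qed

text \<open>All arrivals from outside \<open>J\<close> during the whole evolution are put in place
  at the start. Odometers do not see the times of arrival, so this is everything that
  \<open>J\<close> knows of the outside.\<close>

definition restr_cfg :: "int set \<Rightarrow> stacks \<Rightarrow> (int \<Rightarrow> nat) \<Rightarrow> (int \<Rightarrow> nat) \<Rightarrow> int \<Rightarrow> nat" where
  "restr_cfg J \<rho> \<eta> u x = \<eta> x
     + (if x - 1 \<in> J then 0 else cnt GoRight \<rho> (x - 1) (u (x - 1)))
     + (if x + 1 \<in> J then 0 else cnt GoLeft \<rho> (x + 1) (u (x + 1)))"

lemma net_restr:
  assumes "x \<in> J" "\<And>y. y \<notin> J \<Longrightarrow> v y = 0"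
  shows "net \<rho> (restr_cfg J \<rho> \<eta> u) v x = net \<rho> \<eta> (\<lambda>y. if y \<in> J then v y else u y) x"
  using assms by (auto simp: net_def restr_cfg_def)

lemma act_restr:
  assumes "x \<in> J" "\<And>y. y \<notin> J \<Longrightarrow> v y = 0"
  shows "act lam \<rho> (restr_cfg J \<rho> \<eta> u) v x = act lam \<rho> \<eta> (\<lambda>y. if y \<in> J then v y else u y) x"
  using assms by (auto simp: act_def net_restr asleep_def)

text \<open>For \<open>v\<close> stable on \<open>J\<close>, lowering \<open>u\<close> to the
  minimum of \<open>u\<close> and \<open>v\<close> inside \<open>J\<close> keeps it stable on
  \<open>D\<close>: at each site the minimum equals \<open>u\<close> or \<open>v\<close>, and
  activity would pass to that one by \<open>act_mono\<close>. Minimality of \<open>u\<close> then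
  gives the bound by \<open>v\<close>.\<close>

lemma min_odo_restr:
  assumes min: "min_odo lam D \<rho> \<eta> u" and "J \<subseteq> D"
  shows "min_odo lam J \<rho> (restr_cfg J \<rho> \<eta> u) (\<lambda>x. if x \<in> J then u x else 0)"
  unfolding min_odo_def
proof (intro conjI allI impI)
  have u: "stable_odo lam D \<rho> \<eta> u" using min by (rule min_odo_stable)
  have *: "(\<lambda>y. if y \<in> J then if y \<in> J then u y else 0 else u y) = u" by auto
  show "stable_odo lam J \<rho> (restr_cfg J \<rho> \<eta> u) (\<lambda>x. if x \<in> J then u x else 0)"
    using u \<open>J \<subseteq> D\<close> unfolding stable_odo_def by (auto simp: act_restr *)
  fix v assume v: "stable_odo lam J \<rho> (restr_cfg J \<rho> \<eta> u) v"
  define w where "w = (\<lambda>y. if y \<in> J then min (u y) (v y) else u y)"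
  have "stable_odo lam D \<rho> \<eta> w"
    unfolding stable_odo_def
  proof (intro conjI allI impI ballI)
    fix x assume "x \<notin> D" then show "w x = 0"
      using u by (auto simp: w_def stable_odo_def)
  next
    fix x assume "x \<in> D"
    show "\<not> act lam \<rho> \<eta> w x"
    proof
      assume a: "act lam \<rho> \<eta> w x"
      have "x \<in> J \<and> v x \<le> u x \<or> w x = u x" by (simp add: w_def min_def)
      then consider "x \<in> J" "v x \<le> u x" | "w x = u x" by blast
      then show False
      proof cases
        case 1
        have "act lam \<rho> \<eta> (\<lambda>y. if y \<in> J then v y else u y) x"
          by (rule act_mono[OF a]) (use 1 in \<open>auto simp: w_def\<close>)
        then have "act lam \<rho> (restr_cfg J \<rho> \<eta> u) v x"
          using 1 v by (subst act_restr) (auto simp: stable_odo_def)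
        then show False using v 1 by (auto simp: stable_odo_def)
      next
        case 2
        have "act lam \<rho> \<eta> u x"
          by (rule act_mono[OF a]) (use 2 in \<open>auto simp: w_def\<close>)
        then show False using u \<open>x \<in> D\<close> by (auto simp: stable_odo_def)
      qed
    qed
  qed
  then have "u \<le> w" using min by (auto simp: min_odo_def)
  then show "(\<lambda>x. if x \<in> J then u x else 0) \<le> v"
    by (auto simp: le_fun_def w_def min_def split: if_splits)
qed

text \<open>The working form of the comparison: entrances need only be bounded from above, and
  \<open>v\<close> may be any stable odometer, for instance one made by walkers that ignore
  sleep.\<close>

lemma min_odo_le_on:
  assumes min: "min_odo lam D \<rho> \<eta> u" and "J \<subseteq> D" and v: "stable_odo lam J \<rho> \<eta>' v"
    and "\<And>x. x \<in> J \<Longrightarrow> restr_cfg J \<rho> \<eta> u x \<le> \<eta>' x" and "x \<in> J"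
  shows "u x \<le> v x"
proof -
  have "stable_odo lam J \<rho> (restr_cfg J \<rho> \<eta> u) v"
    by (rule stable_odo_mono[OF v]) (use assms in auto)
  from min_odo_least[OF min_odo_restr[OF min \<open>J \<subseteq> D\<close>] this, of x] show ?thesis
    using \<open>x \<in> J\<close> by simp
qed

lemma stable_odo_zero: "(\<And>x. x \<in> D \<Longrightarrow> \<eta> x = 0) \<Longrightarrow> stable_odo lam D \<rho> \<eta> (\<lambda>x. 0)"
  by (auto simp: stable_odo_def act_def net_def)

text \<open>No instruction is used at \<open>x\<close>, so nothing crosses it, and the empty
  half-line behind it is stable by itself. In particular no fired site lies beyond an unfired one,
  seen from the source.\<close>

lemma min_odo_gap:
  assumes min: "min_odo lam UNIV \<rho> \<eta> u" and "u x = 0"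
  shows "(\<And>y. x < y \<Longrightarrow> \<eta> y = 0) \<Longrightarrow> x < z \<Longrightarrow> u z = 0"
    and "(\<And>y. y < x \<Longrightarrow> \<eta> y = 0) \<Longrightarrow> z < x \<Longrightarrow> u z = 0"
proof -
  assume eta: "\<And>y. x < y \<Longrightarrow> \<eta> y = 0" and "x < z"
  have "u z \<le> 0"
    using \<open>x < z\<close>
  proof (intro min_odo_le_on[OF min, of "{x<..}" "\<lambda>y. 0" "\<lambda>y. 0"])
    fix y assume "y \<in> {x<..}"
    then have "y - 1 \<in> {x<..} \<or> y - 1 = x" by auto
    with eta \<open>u x = 0\<close> \<open>y \<in> {x<..}\<close> show "restr_cfg {x<..} \<rho> \<eta> u y \<le> 0"
      by (auto simp: restr_cfg_def)
  qed (auto intro: stable_odo_zero)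
  then show "u z = 0" by simp
next
  assume eta: "\<And>y. y < x \<Longrightarrow> \<eta> y = 0" and "z < x"
  have "u z \<le> 0"
    using \<open>z < x\<close>
  proof (intro min_odo_le_on[OF min, of "{..<x}" "\<lambda>y. 0" "\<lambda>y. 0"])
    fix y assume "y \<in> {..<x}"
    then have "y + 1 \<in> {..<x} \<or> y + 1 = x" by auto
    with eta \<open>u x = 0\<close> \<open>y \<in> {..<x}\<close> show "restr_cfg {..<x} \<rho> \<eta> u y \<le> 0"
      by (auto simp: restr_cfg_def)
  qed (auto intro: stable_odo_zero)
  then show "u z = 0" by simp
qed

subsection \<open>Restarting from an intermediate odometer\<close>

definition advance :: "(int \<Rightarrow> nat) \<Rightarrow> stacks \<Rightarrow> stacks" where
  "advance v \<rho> = (\<lambda>(x, k). \<rho> (x, v x + k))"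

lemma advance_0 [simp]: "advance (\<lambda>x. 0) \<rho> = \<rho>"
  by (auto simp: advance_def)

lemma cnt_advance: "cnt i \<rho> x (v x + k) = cnt i \<rho> x (v x) + cnt i (advance v \<rho>) x k"
  by (induction k) (auto simp: advance_def)

lemma net_advance:
  assumes "\<And>y. net \<rho> \<eta> v y = int (\<eta>' y)"
  shows "net (advance v \<rho>) \<eta>' w x = net \<rho> \<eta> (\<lambda>y. v y + w y) x"
  using assms[of x] by (simp add: net_def cnt_advance)

lemma asleep_advance:
  "asleep (advance v \<rho>) w x \<longleftrightarrow> w x > 0 \<and> asleep \<rho> (\<lambda>y. v y + w y) x"
  by (auto simp: asleep_def advance_def)

text \<open>A site not fired after the restart counts as awake, so stability with the fresh stacks
  is the stronger requirement and implies stability of the sum.\<close>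

lemma stable_odo_advance:
  assumes net: "\<And>y. net \<rho> \<eta> v y = int (\<eta>' y)" and v: "\<And>x. x \<notin> D \<Longrightarrow> v x = 0"
    and w: "stable_odo lam D (advance v \<rho>) \<eta>' w"
  shows "stable_odo lam D \<rho> \<eta> (\<lambda>x. v x + w x)"
  using v w by (auto simp: stable_odo_def act_def net_advance[OF net] asleep_advance)

lemma net_ge_zero_odo: "w x = 0 \<Longrightarrow> net \<rho> \<eta> w x \<ge> int (\<eta> x)"
  by (simp add: net_def)

text \<open>The converse fails where \<open>v\<close> leaves a lone sleeping particle, which the
  restart would wake up; \<open>awake\<close> excludes this.\<close>

lemma stable_odo_advanceD:
  assumes net: "\<And>y. net \<rho> \<eta> v y = int (\<eta>' y)" and v: "\<And>x. x \<notin> D \<Longrightarrow> v x = 0"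
    and ge1: "\<And>x. x \<in> D \<Longrightarrow> \<eta>' x \<ge> 1" and awake: "\<And>x. x \<in> D \<Longrightarrow> asleep \<rho> v x \<Longrightarrow> \<eta>' x \<ge> 2"
    and st: "stable_odo lam D \<rho> \<eta> (\<lambda>x. v x + w x)"
  shows "stable_odo lam D (advance v \<rho>) \<eta>' w"
  unfolding stable_odo_def
proof (intro conjI allI impI ballI)
  fix x assume "x \<notin> D" then show "w x = 0" using st by (auto simp: stable_odo_def)
next
  fix x assume x: "x \<in> D"
  have n: "\<not> act lam \<rho> \<eta> (\<lambda>x. v x + w x) x" using st x by (auto simp: stable_odo_def)
  show "\<not> act lam (advance v \<rho>) \<eta>' w x"
  proof (cases "w x = 0")
    case False
    then show ?thesis using n by (auto simp: act_def net_advance[OF net] asleep_advance)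
  next
    case True
    have "int (\<eta>' x) \<le> net (advance v \<rho>) \<eta>' w x" by (rule net_ge_zero_odo) fact
    moreover have "asleep \<rho> (\<lambda>x. v x + w x) x \<longleftrightarrow> asleep \<rho> v x"
      using True by (simp add: asleep_def)
    ultimately show ?thesis
      using n True awake[OF x] ge1[OF x]
      by (auto simp: act_def net_advance[OF net] asleep_advance)
  qed
qed

lemma min_odo_advance:
  assumes net: "\<And>y. net \<rho> \<eta> v y = int (\<eta>' y)" and v: "\<And>x. x \<notin> D \<Longrightarrow> v x = 0"
    and ge1: "\<And>x. x \<in> D \<Longrightarrow> \<eta>' x \<ge> 1" and awake: "\<And>x. x \<in> D \<Longrightarrow> asleep \<rho> v x \<Longrightarrow> \<eta>' x \<ge> 2"
    and min: "min_odo lam D \<rho> \<eta> u" and "v \<le> u"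
  shows "min_odo lam D (advance v \<rho>) \<eta>' (\<lambda>x. u x - v x)"
  unfolding min_odo_def
proof (intro conjI allI impI)
  have *: "(\<lambda>x. v x + (u x - v x)) = u" using \<open>v \<le> u\<close> by (auto simp: le_fun_def)
  show "stable_odo lam D (advance v \<rho>) \<eta>' (\<lambda>x. u x - v x)"
    by (rule stable_odo_advanceD[OF net v ge1 awake]) (use min in \<open>auto simp: * min_odo_stable\<close>)
  fix w assume "stable_odo lam D (advance v \<rho>) \<eta>' w"
  then have "stable_odo lam D \<rho> \<eta> (\<lambda>x. v x + w x)"
    by (intro stable_odo_advance[OF net v]) auto
  then have "u \<le> (\<lambda>x. v x + w x)" using min by (auto simp: min_odo_def)
  then show "(\<lambda>x. u x - v x) \<le> w" by (auto simp: le_fun_def le_diff_conv add.commute)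
qed

subsection \<open>Odometers and firing sequences\<close>

definition odo_conf :: "ennreal \<Rightarrow> stacks \<Rightarrow> (int \<Rightarrow> nat) \<Rightarrow> (int \<Rightarrow> nat) \<Rightarrow> int \<Rightarrow> site_state" where
  "odo_conf lam \<rho> \<eta> u x =
     (if net \<rho> \<eta> u x = 1 \<and> (lam = \<infinity> \<or> asleep \<rho> u x) then Asleep else Num (nat (net \<rho> \<eta> u x)))"

text \<open>The last clause protects the reading of \<open>asleep\<close>: a site whose last
  instruction is \<open>Sleep\<close> is never empty, so a new arrival there cannot be mistaken for
  a sleeper.\<close>

definition agrees :: "ennreal \<Rightarrow> stacks \<Rightarrow> int set \<Rightarrow> (int \<Rightarrow> nat) \<Rightarrow> state \<Rightarrow> bool" where
  "agrees lam \<rho> D \<eta> S \<longleftrightarrow>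
     (\<forall>x. x \<notin> D \<longrightarrow> fst S x = Num 0 \<and> snd S x = 0) \<and>
     (\<forall>x\<in>D. fst S x = odo_conf lam \<rho> \<eta> (snd S) x \<and> net \<rho> \<eta> (snd S) x \<ge> 0 \<and>
        (asleep \<rho> (snd S) x \<longrightarrow> net \<rho> \<eta> (snd S) x \<ge> 1))"

lemma agrees_active:
  assumes "agrees lam \<rho> D \<eta> S"
  shows "active (fst S x) \<longleftrightarrow> x \<in> D \<and> act lam \<rho> \<eta> (snd S) x"
  using assms by (cases "x \<in> D") (auto simp: agrees_def active_def odo_conf_def act_def)

lemma agrees_initial:
  assumes "\<And>x. x \<notin> D \<Longrightarrow> \<eta> x = 0"
  shows "agrees lam \<rho> D \<eta> (initial lam (\<lambda>x. Num (\<eta> x)))"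
  using assms by (auto simp: agrees_def initial_def settle_def odo_conf_def net_def asleep_def)

lemma agrees_fire:
  assumes ag: "agrees lam \<rho> D \<eta> S" and a: "active (fst S x)"
  shows "agrees lam \<rho> D \<eta> (fire lam \<rho> D x S)"
proof -
  obtain c u where S: "S = (c, u)" by (cases S)
  have x: "x \<in> D" "act lam \<rho> \<eta> u x" using ag a agrees_active S by auto
  have off: "\<And>y. y \<notin> D \<Longrightarrow> c y = Num 0 \<and> u y = 0"
    and on: "\<And>y. y \<in> D \<Longrightarrow> c y = odo_conf lam \<rho> \<eta> u y \<and> net \<rho> \<eta> u y \<ge> 0 \<and>
        (asleep \<rho> u y \<longrightarrow> net \<rho> \<eta> u y \<ge> 1)"
    using ag by (auto simp: agrees_def S)
  define u' where "u' = u(x := u x + 1)"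
  define c' where "c' = execute D x (\<rho> (x, u x)) c"
  have nx: "net \<rho> \<eta> u x \<ge> 1" using x by (auto simp: act_def)
  have cx: "c x = Num (nat (net \<rho> \<eta> u x))"
    using x on[OF x(1)] by (auto simp: act_def odo_conf_def)
  have sl: "asleep \<rho> u' y = (if y = x then \<rho> (x, u x) = Sleep else asleep \<rho> u y)" for y
    by (auto simp: asleep_def u'_def)
  have net': "net \<rho> \<eta> u' y = net \<rho> \<eta> u y
      + (if y = x + 1 \<and> \<rho> (x, u x) = GoRight then 1 else 0)
      + (if y = x - 1 \<and> \<rho> (x, u x) = GoLeft then 1 else 0)
      - (if y = x \<and> \<rho> (x, u x) \<noteq> Sleep then 1 else 0)" for y
    by (cases "\<rho> (x, u x)") (auto simp: net_def u'_def)
  have main: "settle lam c' y = odo_conf lam \<rho> \<eta> u' y \<and> net \<rho> \<eta> u' y \<ge> 0 \<and>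
        (asleep \<rho> u' y \<longrightarrow> net \<rho> \<eta> u' y \<ge> 1)" if y: "y \<in> D" for y
  proof (cases "y = x")
    case True
    have c'x: "c' x = (if \<rho> (x, u x) = Sleep then (if net \<rho> \<eta> u x = 1 then Asleep else c x)
        else Num (nat (net \<rho> \<eta> u x) - 1))"
      using cx nx by (cases "\<rho> (x, u x)") (auto simp: c'_def move_particle_def Let_def)
    show ?thesis
      using nx c'x cx True by (auto simp: settle_def odo_conf_def net' sl nat_diff_distrib)
  next
    case False
    define t where "t \<longleftrightarrow> y = x + 1 \<and> \<rho> (x, u x) = GoRight \<or> y = x - 1 \<and> \<rho> (x, u x) = GoLeft"
    have c'y: "c' y = (if t then add_particle (c y) else c y)"
      using False y by (cases "\<rho> (x, u x)") (auto simp: c'_def move_particle_def Let_def t_def)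
    have n'y: "net \<rho> \<eta> u' y = net \<rho> \<eta> u y + (if t then 1 else 0)"
      using False by (auto simp: net' t_def)
    have sy: "asleep \<rho> u' y = asleep \<rho> u y" using False by (simp add: sl)
    show ?thesis
    proof (cases t)
      case False
      then show ?thesis using on[OF y] by (auto simp: settle_def c'y odo_conf_def n'y sy)
    next
      case True
      have n: "net \<rho> \<eta> u y \<ge> 0" "asleep \<rho> u y \<longrightarrow> net \<rho> \<eta> u y \<ge> 1" using on[OF y] by auto
      consider "net \<rho> \<eta> u y = 0" | "net \<rho> \<eta> u y = 1" | "net \<rho> \<eta> u y \<ge> 2" using n(1) by linarith
      then show ?thesis
        using on[OF y] True
        by cases (auto simp: settle_def c'y odo_conf_def n'y sy nat_add_distrib)
    qed
  qed
  have off': "settle lam c' y = Num 0 \<and> u' y = 0" if "y \<notin> D" for y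
  proof -
    have "y \<noteq> x" using that x by auto
    then have "c' y = c y"
      using that by (cases "\<rho> (x, u x)") (auto simp: c'_def move_particle_def Let_def)
    then show ?thesis using off[OF that] \<open>y \<noteq> x\<close> by (simp add: settle_def u'_def)
  qed
  have "fire lam \<rho> D x S = (settle lam c', u')" by (simp add: S c'_def u'_def)
  then show ?thesis using main off' by (auto simp: agrees_def)
qed

lemma snd_fire: "snd (fire lam \<rho> D x S) = (snd S)(x := snd S x + 1)"
  by (cases S) simp

lemma legal_from_append:
  "legal_from lam \<rho> D S (xs @ ys) \<longleftrightarrow>
     legal_from lam \<rho> D S xs \<and> legal_from lam \<rho> D (fold (fire lam \<rho> D) xs S) ys"
  by (induction xs arbitrary: S) auto

lemma agrees_fold:
  assumes "agrees lam \<rho> D \<eta> S" "legal_from lam \<rho> D S xs"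
  shows "agrees lam \<rho> D \<eta> (fold (fire lam \<rho> D) xs S)"
  using assms
proof (induction xs arbitrary: S)
  case (Cons x xs)
  have "agrees lam \<rho> D \<eta> (fire lam \<rho> D x S)" using Cons.prems by (intro agrees_fire) auto
  moreover have "legal_from lam \<rho> D (fire lam \<rho> D x S) xs" using Cons.prems by simp
  ultimately show ?case using Cons.IH by simp
qed simp

lemma snd_fold_fire: "snd (fold (fire lam \<rho> D) xs S) y = snd S y + count_list xs y"
  by (induction xs arbitrary: S) (auto simp: snd_fire)

definition num_cfg :: "(int \<Rightarrow> nat) \<Rightarrow> config" where
  "num_cfg \<eta> = (\<lambda>x. Num (\<eta> x))"

lemma agrees_result:
  assumes "\<And>x. x \<notin> D \<Longrightarrow> \<eta> x = 0" "legal lam \<rho> D (num_cfg \<eta>) xs"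
  shows "agrees lam \<rho> D \<eta> (result lam \<rho> D (num_cfg \<eta>) xs, count_list xs)"
proof -
  have "agrees lam \<rho> D \<eta> (fold (fire lam \<rho> D) xs (initial lam (num_cfg \<eta>)))"
    using assms unfolding num_cfg_def legal_def by (intro agrees_fold agrees_initial) auto
  moreover have "snd (fold (fire lam \<rho> D) xs (initial lam (num_cfg \<eta>))) = count_list xs"
    by (auto simp: snd_fold_fire initial_def)
  ultimately show ?thesis by (metis prod.collapse result_def)
qed

lemma legal_snoc:
  assumes "\<And>x. x \<notin> D \<Longrightarrow> \<eta> x = 0"
  shows "legal lam \<rho> D (num_cfg \<eta>) (xs @ [x]) \<longleftrightarrow>
    legal lam \<rho> D (num_cfg \<eta>) xs \<and> x \<in> D \<and> act lam \<rho> \<eta> (count_list xs) x"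
  using agrees_active[OF agrees_result[of D \<eta> lam \<rho> xs, OF assms], of x]
  by (auto simp: legal_def legal_from_append result_def)

lemma legal_Nil: "legal lam \<rho> D c []"
  by (simp add: legal_def)

lemma legal_iff_act:
  assumes "\<And>x. x \<notin> D \<Longrightarrow> \<eta> x = 0"
  shows "legal lam \<rho> D (num_cfg \<eta>) xs \<longleftrightarrow>
    (\<forall>i<length xs. xs ! i \<in> D \<and> act lam \<rho> \<eta> (count_list (take i xs)) (xs ! i))"
proof (induction xs rule: rev_induct)
  case (snoc x xs)
  then show ?case
    by (auto simp: legal_snoc[OF assms] nth_append less_Suc_eq)
qed (simp add: legal_Nil)

lemma legal_le_stable:
  assumes "\<And>x. x \<notin> D \<Longrightarrow> \<eta> x = 0" "stable_odo lam D \<rho> \<eta> v" "legal lam \<rho> D (num_cfg \<eta>) xs"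
  shows "count_list xs x \<le> v x"
  using assms(3)
proof (induction xs arbitrary: x rule: rev_induct)
  case (snoc y xs)
  have l: "legal lam \<rho> D (num_cfg \<eta>) xs" "y \<in> D" "act lam \<rho> \<eta> (count_list xs) y"
    using snoc.prems legal_snoc[OF assms(1)] by auto
  have "count_list xs \<le> v" using snoc.IH[OF l(1)] by (simp add: le_fun_def)
  then have "count_list xs y < v y" using act_less_stable assms(2) l by blast
  then show ?case using snoc.IH[OF l(1)] by auto
qed simp

text \<open>Legal sequences with counts below \<open>u\<close> have bounded length; take a longest
  one. Its counts are stable for \<xi> on \<open>E\<close>, as an active site could be fired once
  more without exceeding \<open>u\<close>; so they equal \<open>u\<close>. The freedom between \<xi>
  and \<eta> lets the odometer of an infinite configuration dominate that of a finite part.\<close>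

lemma legal_reaches:
  assumes min: "min_odo lam E \<rho> \<xi> u" and fin: "finite {x. u x \<noteq> 0}"
    and \<xi>: "\<And>x. x \<in> E \<Longrightarrow> \<xi> x \<le> \<eta> x" and ED: "E \<subseteq> D" and \<eta>: "\<And>x. x \<notin> D \<Longrightarrow> \<eta> x = 0"
  shows "\<exists>xs. legal lam \<rho> D (num_cfg \<eta>) xs \<and> count_list xs = u"
proof -
  define P where "P = (\<lambda>xs. legal lam \<rho> D (num_cfg \<eta>) xs \<and> count_list xs \<le> u)"
  have "length xs \<le> sum u {x. u x \<noteq> 0}" if "P xs" for xs
  proof -
    have "set xs \<subseteq> {x. u x \<noteq> 0}"
    proof
      fix x assume "x \<in> set xs"
      then have "count_list xs x \<noteq> 0" by (simp add: count_list_0_iff)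
      moreover have "count_list xs x \<le> u x" using that by (simp add: P_def le_fun_def)
      ultimately show "x \<in> {x. u x \<noteq> 0}" by simp
    qed
    then have "length xs = sum (count_list xs) {x. u x \<noteq> 0}"
      using sum_count_set[of xs "{x. u x \<noteq> 0}"] fin by simp
    also have "\<dots> \<le> sum u {x. u x \<noteq> 0}"
      using that by (intro sum_mono) (auto simp: P_def le_fun_def)
    finally show ?thesis .
  qed
  moreover have "P []" by (auto simp: P_def legal_Nil le_fun_def)
  ultimately obtain xs where xs: "P xs" and mx: "\<And>ys. P ys \<Longrightarrow> length ys \<le> length xs"
    using ex_has_greatest_nat[of P "[]" length] by (metis le_imp_less_Suc)
  have c: "count_list xs \<le> u" using xs by (simp add: P_def)
  have u: "stable_odo lam E \<rho> \<xi> u" using min by (rule min_odo_stable)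
  have "stable_odo lam E \<rho> \<xi> (count_list xs)"
    unfolding stable_odo_def
  proof (intro conjI allI impI ballI notI)
    fix x assume "x \<notin> E"
    then show "count_list xs x = 0" using u c by (auto simp: stable_odo_def le_fun_def) (metis le_zero_eq)
  next
    fix x assume x: "x \<in> E" and a: "act lam \<rho> \<xi> (count_list xs) x"
    have less: "count_list xs x < u x" by (rule act_less_stable[OF u c a x])
    have "act lam \<rho> \<eta> (count_list xs) x" by (rule act_mono[OF a]) (use \<xi>[OF x] in auto)
    then have "P (xs @ [x])"
      using xs x ED less by (auto simp: P_def legal_snoc[OF \<eta>] le_fun_def)
    then show False using mx[of "xs @ [x]"] by simp
  qed
  then have "u \<le> count_list xs" using min by (auto simp: min_odo_def)
  then show ?thesis using c xs by (auto simp: P_def intro!: exI[of _ xs] antisym)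
qed

section \<open>Stabilization in terms of least stable odometers\<close>

lemma stabilizing_iff_stable:
  assumes "\<And>x. x \<notin> D \<Longrightarrow> \<eta> x = 0"
  shows "stabilizing lam \<rho> D (num_cfg \<eta>) xs \<longleftrightarrow>
    legal lam \<rho> D (num_cfg \<eta>) xs \<and> stable_odo lam D \<rho> \<eta> (count_list xs)"
proof (cases "legal lam \<rho> D (num_cfg \<eta>) xs")
  case True
  let ?c = "result lam \<rho> D (num_cfg \<eta>) xs"
  have ag: "agrees lam \<rho> D \<eta> (?c, count_list xs)" by (rule agrees_result[OF assms True])
  have "stable ?c \<longleftrightarrow> (\<forall>x. \<not> active (?c x))"
  proof -
    have "(c \<in> {Num 0, Asleep}) = (\<not> active c)" for c
      by (cases c) (auto simp: active_def)
    then show ?thesis by (simp add: stable_def)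
  qed
  also have "\<dots> \<longleftrightarrow> stable_odo lam D \<rho> \<eta> (count_list xs)"
    using ag agrees_active[OF ag] by (auto simp: stable_odo_def agrees_def)
  finally show ?thesis using True by (simp add: stabilizing_def)
qed (simp add: stabilizing_def)

text \<open>This contains the Abelian property: a legal sequence never exceeds a stable odometer, so
  ending in a stable configuration forces the least one, whatever the order of firings.\<close>

lemma stabilizing_iff:
  assumes "\<And>x. x \<notin> D \<Longrightarrow> \<eta> x = 0"
  shows "stabilizing lam \<rho> D (num_cfg \<eta>) xs \<longleftrightarrow>
    legal lam \<rho> D (num_cfg \<eta>) xs \<and> min_odo lam D \<rho> \<eta> (count_list xs)"
proof -
  have "count_list xs \<le> v"
    if "stable_odo lam D \<rho> \<eta> v" "legal lam \<rho> D (num_cfg \<eta>) xs" for v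
    using legal_le_stable[of D \<eta> lam \<rho> v xs, OF assms that] by (simp add: le_fun_def)
  moreover have "stabilizing lam \<rho> D (num_cfg \<eta>) xs \<longleftrightarrow>
      legal lam \<rho> D (num_cfg \<eta>) xs \<and> stable_odo lam D \<rho> \<eta> (count_list xs)"
    by (rule stabilizing_iff_stable) (rule assms)
  ultimately show ?thesis by (auto simp: min_odo_def)
qed

lemma stabilizing_count:
  assumes "\<And>x. x \<notin> D \<Longrightarrow> \<eta> x = 0" "min_odo lam D \<rho> \<eta> u"
    and "stabilizing lam \<rho> D (num_cfg \<eta>) ys"
  shows "count_list ys = u"
proof (rule min_odo_unique)
  show "min_odo lam D \<rho> \<eta> (count_list ys)"
    using assms(3) stabilizing_iff[of D \<eta> lam \<rho> ys] assms(1) by blast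
qed (rule assms(2))

lemma stabilizing_exists:
  assumes "\<And>x. x \<notin> D \<Longrightarrow> \<eta> x = 0" "min_odo lam D \<rho> \<eta> u" "finite {x. u x \<noteq> 0}"
  shows "\<exists>xs. stabilizing lam \<rho> D (num_cfg \<eta>) xs \<and> count_list xs = u"
  using legal_reaches[OF assms(2,3), of \<eta> D] assms stabilizing_iff[OF assms(1)] by auto

lemma num_cfg_point: "(\<lambda>y. if y = 0 then Num n else Num 0) = num_cfg ((\<lambda>_. 0)(0 := n))"
  by (auto simp: num_cfg_def)

lemma one_on_num: "one_on I = num_cfg (\<lambda>x. if x \<in> I then 1 else 0)"
  by (auto simp: num_cfg_def one_on_def)

lemma fired_set_eq:
  assumes min: "min_odo lam UNIV \<rho> ((\<lambda>_. 0)(0 := n)) u" and fin: "finite {x. u x \<noteq> 0}"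
  shows "fired_set lam \<rho> n = {x. u x \<noteq> 0}"
proof -
  obtain xs where xs: "stabilizing lam \<rho> UNIV (num_cfg ((\<lambda>_. 0)(0 := n))) xs" "count_list xs = u"
    using stabilizing_exists[OF _ min fin] by auto
  have "count_list ys = u" if "stabilizing lam \<rho> UNIV (num_cfg ((\<lambda>_. 0)(0 := n))) ys" for ys
    by (rule stabilizing_count[OF _ min that]) simp
  then have "fired_set lam \<rho> n = set xs"
    unfolding fired_set_def num_cfg_point using xs
    by (auto; metis count_list_0_iff)
  moreover have "{x. u x \<noteq> 0} = set xs"
    unfolding xs(2)[symmetric] count_list_0_iff by simp
  ultimately show ?thesis by simp
qed

lemma finite_fired_set: "finite (fired_set lam \<rho> n)"
proof (cases "\<exists>xs. stabilizing lam \<rho> UNIV (num_cfg ((\<lambda>_. 0)(0 := n))) xs")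
  case True
  then obtain xs where xs: "stabilizing lam \<rho> UNIV (num_cfg ((\<lambda>_. 0)(0 := n))) xs" by auto
  then have "min_odo lam UNIV \<rho> ((\<lambda>_. 0)(0 := n)) (count_list xs)" using stabilizing_iff[of UNIV] by blast
  moreover have *: "{x. count_list xs x \<noteq> 0} = set xs" by (auto simp: count_list_0_iff)
  ultimately show ?thesis using fired_set_eq by force
next
  case False
  then show ?thesis by (simp add: fired_set_def num_cfg_point)
qed

text \<open>The definite description in \<open>stabilization\<close> denotes because all stabilizing
  sequences share one odometer, and by \<open>agrees\<close> the final configuration is a function
  of it.\<close>

lemma particles_left_eq:
  assumes min: "min_odo lam I \<rho> (\<lambda>x. if x \<in> I then 1 else 0) u" and fin: "finite I"
  shows "int (particles_left lam \<rho> I) = (\<Sum>x\<in>I. net \<rho> (\<lambda>x. if x \<in> I then 1 else 0) u x)"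
proof -
  let ?\<eta> = "\<lambda>x. if x \<in> I then 1 else (0::nat)"
  have "{x. u x \<noteq> 0} \<subseteq> I" using min by (auto simp: min_odo_def stable_odo_def)
  then have fu: "finite {x. u x \<noteq> 0}" using fin by (rule finite_subset)
  have \<eta>0: "\<And>x. x \<notin> I \<Longrightarrow> ?\<eta> x = 0" by auto
  obtain xs where xs: "stabilizing lam \<rho> I (num_cfg ?\<eta>) xs" "count_list xs = u"
    using stabilizing_exists[OF \<eta>0 min fu] by auto
  have ag: "agrees lam \<rho> I ?\<eta> (result lam \<rho> I (num_cfg ?\<eta>) ys, u)"
    if "stabilizing lam \<rho> I (num_cfg ?\<eta>) ys" for ys
  proof -
    have "count_list ys = u" by (rule stabilizing_count[OF \<eta>0 min that])
    moreover have "legal lam \<rho> I (num_cfg ?\<eta>) ys" using that by (simp add: stabilizing_def)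
    from agrees_result[OF \<eta>0 this]
    have "agrees lam \<rho> I ?\<eta> (result lam \<rho> I (num_cfg ?\<eta>) ys, count_list ys)" .
    ultimately show ?thesis by simp
  qed
  have "result lam \<rho> I (num_cfg ?\<eta>) ys = result lam \<rho> I (num_cfg ?\<eta>) xs"
    if "stabilizing lam \<rho> I (num_cfg ?\<eta>) ys" for ys
  proof
    fix x show "result lam \<rho> I (num_cfg ?\<eta>) ys x = result lam \<rho> I (num_cfg ?\<eta>) xs x"
      using ag[OF that] ag[OF xs(1)] by (cases "x \<in> I") (auto simp: agrees_def)
  qed
  note same = this
  have "stabilization lam \<rho> I (one_on I) = result lam \<rho> I (num_cfg ?\<eta>) xs"
    unfolding stabilization_def one_on_num
  proof (rule the_equality)
    show "\<exists>ys. stabilizing lam \<rho> I (num_cfg ?\<eta>) ys \<and>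
        result lam \<rho> I (num_cfg ?\<eta>) xs = result lam \<rho> I (num_cfg ?\<eta>) ys"
      using xs(1) by blast
    fix c
    assume "\<exists>ys. stabilizing lam \<rho> I (num_cfg ?\<eta>) ys \<and> c = result lam \<rho> I (num_cfg ?\<eta>) ys"
    then obtain ys where "stabilizing lam \<rho> I (num_cfg ?\<eta>) ys"
      "c = result lam \<rho> I (num_cfg ?\<eta>) ys" by blast
    then show "c = result lam \<rho> I (num_cfg ?\<eta>) xs" using same by metis
  qed
  moreover have "int (mass (result lam \<rho> I (num_cfg ?\<eta>) xs x)) = net \<rho> ?\<eta> u x" if "x \<in> I" for x
  proof -
    have "result lam \<rho> I (num_cfg ?\<eta>) xs x = odo_conf lam \<rho> ?\<eta> u x" "net \<rho> ?\<eta> u x \<ge> 0"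
      using ag[OF xs(1)] that by (simp_all only: agrees_def fst_conv snd_conv)
    then show ?thesis by (simp add: odo_conf_def)
  qed
  ultimately show ?thesis by (simp add: particles_left_def)
qed

section \<open>The stack measure\<close>

lemma space_stack [simp]: "space (stack_measure lam) = UNIV"
  by (simp add: stack_measure_def space_PiM)

lemma prob_space_stack: "prob_space (stack_measure lam)"
  unfolding stack_measure_def by (intro prob_space_PiM) (rule measure_pmf.prob_space_axioms)

lemma coord_stack: "(\<lambda>\<rho>. \<rho> p) \<in> measurable (stack_measure lam) (count_space UNIV)"
proof -
  have "(\<lambda>\<rho>. \<rho> p) \<in> measurable (stack_measure lam) (measure_pmf (instr_pmf lam))"
    unfolding stack_measure_def by (rule measurable_component_singleton) simp
  then show ?thesis by simp
qed

lemma measurable_into_stack: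
  assumes "\<And>p. (\<lambda>\<omega>. f \<omega> p) \<in> measurable M (count_space UNIV)"
  shows "f \<in> measurable M (stack_measure lam)"
  unfolding stack_measure_def
  by (rule measurable_PiM_single) (use measurable_sets[OF assms] in \<open>auto simp: vimage_def Int_def conj_commute\<close>)

lemma distr_stack_reindex:
  assumes "inj t"
  shows "distr (stack_measure lam) (stack_measure lam) (\<lambda>\<rho> p. \<rho> (t p)) = stack_measure lam"
  using distr_PiM_reindex[of UNIV "\<lambda>_. measure_pmf (instr_pmf lam)" t UNIV] assms
  by (simp add: stack_measure_def measure_pmf.prob_space_axioms restrict_def)

definition pop :: "int \<Rightarrow> stacks \<Rightarrow> stacks" where
  "pop x = advance ((\<lambda>_. 0)(x := 1))"

lemma advance_measurable: "advance v \<in> measurable (stack_measure lam) (stack_measure lam)"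
  by (rule measurable_into_stack) (auto simp: advance_def intro: coord_stack split: prod.split)

text \<open>The Markov property of the stacks: the top instruction at \<open>x\<close> is
  independent of what remains after removing it, and the remainder has the original law. The
  coordinate \<open>(x, 0)\<close> is split off and the other coordinates are relabelled.\<close>

lemma push_measure:
  assumes A: "A \<in> sets (stack_measure lam)"
  shows "{\<rho>. \<rho> (x, 0) = i \<and> pop x \<rho> \<in> A} \<in> sets (stack_measure lam)"
    and "measure (stack_measure lam) {\<rho>. \<rho> (x, 0) = i \<and> pop x \<rho> \<in> A} =
      pmf (instr_pmf lam) i * measure (stack_measure lam) A"
proof -
  let ?S = "stack_measure lam" and ?p = "instr_pmf lam"
  let ?Q = "{\<rho>. \<rho> (x, 0) = i \<and> pop x \<rho> \<in> A}"
  have "?Q = ((\<lambda>\<rho>. \<rho> (x, 0)) -` {i} \<inter> space ?S) \<inter> (pop x -` A \<inter> space ?S)" by auto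
  also have "\<dots> \<in> sets ?S"
    unfolding pop_def by (intro sets.Int measurable_sets[OF coord_stack] measurable_sets[OF advance_measurable A]) auto
  finally show Q: "?Q \<in> sets ?S" .
  define I where "I = UNIV - {(x, 0 :: nat)}"
  \<comment> \<open>The image of \<open>t\<close> misses exactly \<open>(x, 0)\<close>, so composing
    with \<open>t\<close> removes the top of the stack at \<open>x\<close>, whatever instruction
    lies there.\<close>
  define t where "t = (\<lambda>(y, k). (y, ((\<lambda>_. 0)(x := 1 :: nat)) y + k))"
  let ?R = "PiM I (\<lambda>_. measure_pmf ?p)"
  interpret R: prob_space ?R by (intro prob_space_PiM) (rule measure_pmf.prob_space_axioms)
  interpret P: pair_sigma_finite "measure_pmf ?p" ?R ..
  have t: "inj t" "t p \<in> I" for p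
    by (auto simp: t_def inj_def I_def fun_upd_def split: if_splits prod.splits)
  have ins: "insert (x, 0) I = UNIV" by (auto simp: I_def)
  have D: "distr (measure_pmf ?p \<Otimes>\<^sub>M ?R) ?S (\<lambda>(a, X). X((x, 0) := a)) = ?S"
    using distr_pair_PiM_eq_PiM[of I "\<lambda>_. measure_pmf ?p" "(x, 0)"]
    by (simp add: ins stack_measure_def measure_pmf.prob_space_axioms)
  have E: "distr ?R ?S (\<lambda>X p. X (t p)) = ?S"
    using distr_PiM_reindex[of I "\<lambda>_. measure_pmf ?p" t UNIV] t
    by (simp add: stack_measure_def measure_pmf.prob_space_axioms inj_on_subset Pi_def restrict_def)
  have mD: "(\<lambda>(a, X). X((x, 0) := a)) \<in> measurable (measure_pmf ?p \<Otimes>\<^sub>M ?R) ?S"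
    using measurable_add_dim[of "(x, 0)" I "\<lambda>_. measure_pmf ?p"]
    by (subst measurable_cong_sets[OF refl, of _ "PiM (insert (x,0) I) (\<lambda>_. measure_pmf ?p)"])
       (auto simp: ins stack_measure_def intro!: measurable_fun_upd[where J = I])
  have mE: "(\<lambda>X p. X (t p)) \<in> measurable ?R ?S"
  proof (rule measurable_into_stack)
    fix p
    have "(\<lambda>X. X (t p)) \<in> measurable ?R (measure_pmf ?p)"
      by (rule measurable_component_singleton) (rule t)
    then show "(\<lambda>X. X (t p)) \<in> measurable ?R (count_space UNIV)" by simp
  qed
  have pre: "(\<lambda>(a, X). X((x, 0) := a)) -` ?Q \<inter> space (measure_pmf ?p \<Otimes>\<^sub>M ?R)
      = {i} \<times> ((\<lambda>X p. X (t p)) -` A \<inter> space ?R)"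
  proof -
    have "pop x (X((x, 0) := a)) = (\<lambda>p. X (t p))" for X a
      by (auto simp: pop_def advance_def t_def fun_eq_iff)
    then show ?thesis by (auto simp: space_pair_measure)
  qed
  have "emeasure ?S ?Q = emeasure (distr (measure_pmf ?p \<Otimes>\<^sub>M ?R) ?S (\<lambda>(a, X). X((x, 0) := a))) ?Q"
    by (simp add: D)
  also have "\<dots> = emeasure (measure_pmf ?p \<Otimes>\<^sub>M ?R) ({i} \<times> ((\<lambda>X p. X (t p)) -` A \<inter> space ?R))"
    by (subst emeasure_distr[OF mD Q]) (simp only: pre)
  also have "\<dots> = emeasure (measure_pmf ?p) {i} * emeasure ?R ((\<lambda>X p. X (t p)) -` A \<inter> space ?R)"
    by (rule R.emeasure_pair_measure_Times) (auto intro: measurable_sets[OF mE A])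
  also have "emeasure ?R ((\<lambda>X p. X (t p)) -` A \<inter> space ?R) = emeasure (distr ?R ?S (\<lambda>X p. X (t p))) A"
    by (rule emeasure_distr[OF mE A, symmetric])
  finally have "emeasure ?S ?Q = emeasure (measure_pmf ?p) {i} * emeasure ?S A" by (simp add: E)
  then show "measure ?S ?Q = pmf ?p i * measure ?S A"
    by (simp add: measure_def enn2real_mult emeasure_pmf_single)
qed

definition move_prob :: "ennreal \<Rightarrow> real" where
  "move_prob lam = pmf (instr_pmf lam) GoLeft"

lemma instr_pmf_values:
  "pmf (instr_pmf lam) GoRight = move_prob lam"
  "pmf (instr_pmf lam) Sleep = 1 - 2 * move_prob lam"
  "0 < move_prob lam" "2 * move_prob lam \<le> 1"
proof -
  have "pmf (instr_pmf lam) GoRight = move_prob lam \<and> pmf (instr_pmf lam) Sleep = 1 - 2 * move_prob lam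
    \<and> 0 < move_prob lam \<and> 2 * move_prob lam \<le> 1"
  proof (cases "lam = \<infinity>")
    case True
    then show ?thesis by (simp add: instr_pmf_def move_prob_def)
  next
    case False
    define l where "l = enn2real lam"
    have l: "0 \<le> l" by (simp add: l_def)
    have "pmf (instr_pmf lam) i = sum_list (map snd (filter (\<lambda>z. fst z = i)
        [(Sleep, l / (1 + l)), (GoLeft, 1 / (2 * (1 + l))), (GoRight, 1 / (2 * (1 + l)))]))" for i
      using False pmf_pmf_of_list[OF instr_pmf_wf[OF l], of i]
      by (simp add: instr_pmf_def Let_def l_def)
    then show ?thesis using l by (auto simp: move_prob_def field_simps)
  qed
  then show "pmf (instr_pmf lam) GoRight = move_prob lam"
    "pmf (instr_pmf lam) Sleep = 1 - 2 * move_prob lam"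
    "0 < move_prob lam" "2 * move_prob lam \<le> 1" by auto
qed

section \<open>Outer probability bounds\<close>

text \<open>Runs choose their sites by \<open>SOME\<close>, and events about them are not shown to
  be measurable; a bound by a measurable superset is all that the union bounds and Borel-Cantelli
  require.\<close>

definition outer_le :: "ennreal \<Rightarrow> stacks set \<Rightarrow> real \<Rightarrow> bool" where
  "outer_le lam Q e \<longleftrightarrow>
     (\<exists>M\<in>sets (stack_measure lam). Q \<subseteq> M \<and> measure (stack_measure lam) M \<le> e)"

lemma outer_le_mono: "outer_le lam Q e \<Longrightarrow> Q' \<subseteq> Q \<Longrightarrow> e \<le> e' \<Longrightarrow> outer_le lam Q' e'"
  unfolding outer_le_def by (meson order_trans)

lemma outer_le_empty: "0 \<le> e \<Longrightarrow> outer_le lam {} e"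
  unfolding outer_le_def by (intro bexI[of _ "{}"]) auto

lemma outer_le_one: "1 \<le> e \<Longrightarrow> outer_le lam Q e"
  unfolding outer_le_def
  using prob_space.prob_le_1[OF prob_space_stack, of lam "space (stack_measure lam)"]
    sets.top[of "stack_measure lam"]
  by (intro bexI[of _ "space (stack_measure lam)"]) auto

lemma outer_le_meas:
  "Q \<in> sets (stack_measure lam) \<Longrightarrow> measure (stack_measure lam) Q \<le> e \<Longrightarrow> outer_le lam Q e"
  unfolding outer_le_def by auto

lemma outer_le_nonneg: "outer_le lam Q e \<Longrightarrow> 0 \<le> e"
  unfolding outer_le_def using measure_nonneg order_trans by blast

lemma outer_le_Un:
  assumes "outer_le lam Q e" "outer_le lam Q' e'"
  shows "outer_le lam (Q \<union> Q') (e + e')"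
proof -
  interpret prob_space "stack_measure lam" by (rule prob_space_stack)
  obtain M M' where M: "M \<in> events" "Q \<subseteq> M" "prob M \<le> e" "M' \<in> events" "Q' \<subseteq> M'" "prob M' \<le> e'"
    using assms unfolding outer_le_def by blast
  have "prob (M \<union> M') \<le> e + e'" using measure_Un_le[of M "stack_measure lam" M'] M by linarith
  then show ?thesis unfolding outer_le_def using M by (intro bexI[of _ "M \<union> M'"]) auto
qed

lemma outer_le_UN:
  assumes "finite I" "\<And>i. i \<in> I \<Longrightarrow> outer_le lam (Q i) (e i)"
  shows "outer_le lam (\<Union>i\<in>I. Q i) (\<Sum>i\<in>I. e i)"
  using assms
proof (induction I rule: finite_induct)
  case (insert i I)
  then show ?case using outer_le_Un[of lam "Q i" "e i" "\<Union>i\<in>I. Q i" "sum e I"] by simp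
qed (simp add: outer_le_empty)

lemma outer_le_push:
  assumes "outer_le lam (Q GoLeft) (e GoLeft)" "outer_le lam (Q GoRight) (e GoRight)"
    "outer_le lam (Q Sleep) (e Sleep)"
  shows "outer_le lam {\<rho>. pop x \<rho> \<in> Q (\<rho> (x, 0))}
    (move_prob lam * e GoLeft + move_prob lam * e GoRight + (1 - 2 * move_prob lam) * e Sleep)"
proof -
  have one: "outer_le lam {\<rho>. \<rho> (x, 0) = i \<and> pop x \<rho> \<in> Q i} (pmf (instr_pmf lam) i * e i)"
    if "outer_le lam (Q i) (e i)" for i
  proof -
    obtain M where M: "M \<in> sets (stack_measure lam)" "Q i \<subseteq> M" "measure (stack_measure lam) M \<le> e i"
      using \<open>outer_le lam (Q i) (e i)\<close> unfolding outer_le_def by blast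
    have "outer_le lam {\<rho>. \<rho> (x, 0) = i \<and> pop x \<rho> \<in> M} (pmf (instr_pmf lam) i * e i)"
      using M push_measure[OF M(1), of x i] by (intro outer_le_meas) (auto intro: mult_left_mono)
    then show ?thesis by (rule outer_le_mono) (use M in auto)
  qed
  have "outer_le lam ({\<rho>. \<rho> (x, 0) = GoLeft \<and> pop x \<rho> \<in> Q GoLeft} \<union>
      {\<rho>. \<rho> (x, 0) = GoRight \<and> pop x \<rho> \<in> Q GoRight} \<union>
      {\<rho>. \<rho> (x, 0) = Sleep \<and> pop x \<rho> \<in> Q Sleep})
    (pmf (instr_pmf lam) GoLeft * e GoLeft + pmf (instr_pmf lam) GoRight * e GoRight
      + pmf (instr_pmf lam) Sleep * e Sleep)"
    using assms by (intro outer_le_Un one)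
  then show ?thesis
    unfolding instr_pmf_values move_prob_def[symmetric]
  proof (rule outer_le_mono)
    show "{\<rho>. pop x \<rho> \<in> Q (\<rho> (x, 0))} \<subseteq> {\<rho>. \<rho> (x, 0) = GoLeft \<and> pop x \<rho> \<in> Q GoLeft} \<union>
      {\<rho>. \<rho> (x, 0) = GoRight \<and> pop x \<rho> \<in> Q GoRight} \<union>
      {\<rho>. \<rho> (x, 0) = Sleep \<and> pop x \<rho> \<in> Q Sleep}"
    proof
      fix \<rho> assume "\<rho> \<in> {\<rho>. pop x \<rho> \<in> Q (\<rho> (x, 0))}"
      then show "\<rho> \<in> {\<rho>. \<rho> (x, 0) = GoLeft \<and> pop x \<rho> \<in> Q GoLeft} \<union>
        {\<rho>. \<rho> (x, 0) = GoRight \<and> pop x \<rho> \<in> Q GoRight} \<union>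
        {\<rho>. \<rho> (x, 0) = Sleep \<and> pop x \<rho> \<in> Q Sleep}"
        by (cases "\<rho> (x, 0)") auto
    qed
  qed simp
qed

lemma outer_le_eventually:
  assumes "\<And>k. k \<ge> k0 \<Longrightarrow> outer_le lam (Q k) (e k)" "summable e"
  shows "AE \<rho> in stack_measure lam. \<forall>\<^sub>F k in sequentially. \<rho> \<notin> Q k"
proof -
  interpret prob_space "stack_measure lam" by (rule prob_space_stack)
  have "\<exists>M. M \<in> events \<and> Q (k + k0) \<subseteq> M \<and> prob M \<le> e (k + k0)" for k
    using assms(1)[of "k + k0"] by (auto simp: outer_le_def)
  then obtain M where M: "\<And>k. M k \<in> events" "\<And>k. Q (k + k0) \<subseteq> M k" "\<And>k. prob (M k) \<le> e (k + k0)"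
    by metis
  have "summable (\<lambda>k. prob (M k))"
    by (rule summable_comparison_test'[of "\<lambda>k. e (k + k0)" 0])
       (use M assms(2) in \<open>auto simp: summable_iff_shift\<close>)
  then have "AE \<rho> in stack_measure lam. \<forall>\<^sub>F k in sequentially. \<rho> \<in> space (stack_measure lam) - M k"
    using M by (intro borel_cantelli_AE1) (auto simp: less_top[symmetric])
  then show ?thesis
  proof (rule AE_mp, intro AE_I2 impI)
    fix \<rho> assume "\<forall>\<^sub>F k in sequentially. \<rho> \<in> space (stack_measure lam) - M k"
    then have "\<forall>\<^sub>F k in sequentially. \<rho> \<notin> Q (k + k0)" by eventually_elim (use M in auto)
    then show "\<forall>\<^sub>F k in sequentially. \<rho> \<notin> Q k"
      by (simp add: eventually_sequentially_seg[of "\<lambda>k. \<rho> \<notin> Q k"])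
  qed
qed

section \<open>Running a strategy\<close>

definition mv :: "int \<Rightarrow> int \<Rightarrow> (int \<Rightarrow> nat) \<Rightarrow> int \<Rightarrow> nat" where
  "mv x y \<eta> = \<eta>(x := \<eta> x - 1, y := \<eta> y + 1)"

fun fire_cfg :: "int \<Rightarrow> instr \<Rightarrow> (int \<Rightarrow> nat) \<Rightarrow> int \<Rightarrow> nat" where
  "fire_cfg x GoLeft \<eta> = mv x (x - 1) \<eta>"
| "fire_cfg x GoRight \<eta> = mv x (x + 1) \<eta>"
| "fire_cfg x Sleep \<eta> = \<eta>"

fun run :: "((int \<Rightarrow> nat) \<Rightarrow> int option) \<Rightarrow> nat \<Rightarrow> (int \<Rightarrow> nat) \<Rightarrow> stacks
    \<Rightarrow> (int \<Rightarrow> nat) \<times> (int \<Rightarrow> nat) \<times> stacks" where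
  "run sel 0 \<eta> \<rho> = (\<eta>, \<lambda>_. 0, \<rho>)"
| "run sel (Suc T) \<eta> \<rho> = (case sel \<eta> of None \<Rightarrow> (\<eta>, \<lambda>_. 0, \<rho>)
     | Some x \<Rightarrow> (case run sel T (fire_cfg x (\<rho> (x, 0)) \<eta>) (pop x \<rho>) of
         (\<eta>', u', \<rho>') \<Rightarrow> (\<eta>', u'(x := u' x + 1), \<rho>')))"

definition run_cfg where "run_cfg sel T \<eta> \<rho> = fst (run sel T \<eta> \<rho>)"
definition run_odo where "run_odo sel T \<eta> \<rho> = fst (snd (run sel T \<eta> \<rho>))"

lemma run_0 [simp]: "run_cfg sel 0 \<eta> \<rho> = \<eta>" "run_odo sel 0 \<eta> \<rho> = (\<lambda>_. 0)"
  by (simp_all add: run_cfg_def run_odo_def)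

lemma run_None [simp]:
  "sel \<eta> = None \<Longrightarrow> run_cfg sel T \<eta> \<rho> = \<eta>" "sel \<eta> = None \<Longrightarrow> run_odo sel T \<eta> \<rho> = (\<lambda>_. 0)"
  by (cases T; simp add: run_cfg_def run_odo_def)+

lemma run_Some:
  assumes "sel \<eta> = Some x"
  shows "run_cfg sel (Suc T) \<eta> \<rho> = run_cfg sel T (fire_cfg x (\<rho> (x, 0)) \<eta>) (pop x \<rho>)"
    and "run_odo sel (Suc T) \<eta> \<rho> =
      (\<lambda>y. ((\<lambda>_. 0)(x := 1)) y + run_odo sel T (fire_cfg x (\<rho> (x, 0)) \<eta>) (pop x \<rho>) y)"
  using assms by (auto simp: run_cfg_def run_odo_def split: prod.splits)

lemma run_bound:
  fixes \<Phi> :: "nat \<Rightarrow> (int \<Rightarrow> nat) \<Rightarrow> real"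
  assumes base: "\<And>\<eta>. Inv 0 \<eta> \<Longrightarrow> outer_le lam {\<rho>. B \<eta> \<rho>} (\<Phi> 0 \<eta>)"
    and stop: "\<And>t \<eta>. Inv t \<eta> \<Longrightarrow> sel \<eta> = None \<Longrightarrow> outer_le lam {\<rho>. B \<eta> \<rho>} (\<Phi> t \<eta>)"
    and inv: "\<And>t \<eta> x i. Inv (Suc t) \<eta> \<Longrightarrow> sel \<eta> = Some x \<Longrightarrow> Inv t (fire_cfg x i \<eta>)"
    and step: "\<And>t \<eta> x. Inv (Suc t) \<eta> \<Longrightarrow> sel \<eta> = Some x \<Longrightarrow>
      move_prob lam * \<Phi> t (mv x (x - 1) \<eta>) + move_prob lam * \<Phi> t (mv x (x + 1) \<eta>)
        + (1 - 2 * move_prob lam) * \<Phi> t \<eta> \<le> \<Phi> (Suc t) \<eta>"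
    and "Inv T \<eta>"
  shows "outer_le lam {\<rho>. B (run_cfg sel T \<eta> \<rho>) (advance (run_odo sel T \<eta> \<rho>) \<rho>)} (\<Phi> T \<eta>)"
  using \<open>Inv T \<eta>\<close>
proof (induction T arbitrary: \<eta>)
  case 0
  then show ?case using base by simp
next
  case (Suc T)
  show ?case
  proof (cases "sel \<eta>")
    case None
    then show ?thesis using stop[OF Suc.prems None] by simp
  next
    case (Some x)
    define Q where "Q i = {\<rho>. B (run_cfg sel T (fire_cfg x i \<eta>) \<rho>)
      (advance (run_odo sel T (fire_cfg x i \<eta>) \<rho>) \<rho>)}" for i
    have "outer_le lam {\<rho>. pop x \<rho> \<in> Q (\<rho> (x, 0))}
      (move_prob lam * \<Phi> T (fire_cfg x GoLeft \<eta>) + move_prob lam * \<Phi> T (fire_cfg x GoRight \<eta>)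
        + (1 - 2 * move_prob lam) * \<Phi> T (fire_cfg x Sleep \<eta>))"
      unfolding Q_def by (intro outer_le_push[where e = "\<lambda>i. \<Phi> T (fire_cfg x i \<eta>)"] Suc.IH inv[OF Suc.prems Some])
    then show ?thesis
    proof (rule outer_le_mono)
      show "{\<rho>. B (run_cfg sel (Suc T) \<eta> \<rho>) (advance (run_odo sel (Suc T) \<eta> \<rho>) \<rho>)}
          \<subseteq> {\<rho>. pop x \<rho> \<in> Q (\<rho> (x, 0))}"
      proof -
        have "advance (\<lambda>y. ((\<lambda>_. 0)(x := 1)) y + u y) \<rho> = advance u (pop x \<rho>)" for u \<rho>
          by (auto simp: pop_def advance_def)
        then show ?thesis by (auto simp: Q_def run_Some[of sel \<eta> x, OF Some])
      qed
    qed (use step[OF Suc.prems Some] in simp)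
  qed
qed

lemma net_fire:
  assumes "\<eta> x \<ge> 1"
  shows "net \<rho> \<eta> ((\<lambda>_. 0)(x := 1)) y = int (fire_cfg x (\<rho> (x, 0)) \<eta> y)"
  using assms by (cases "\<rho> (x, 0)") (auto simp: net_def mv_def)

lemma net_run:
  assumes "\<And>\<eta> x. sel \<eta> = Some x \<Longrightarrow> \<eta> x \<ge> 1"
  shows "net \<rho> \<eta> (run_odo sel T \<eta> \<rho>) y = int (run_cfg sel T \<eta> \<rho> y)"
proof (induction T arbitrary: \<eta> \<rho>)
  case 0
  then show ?case by (simp add: net_def)
next
  case (Suc T)
  show ?case
  proof (cases "sel \<eta>")
    case None
    then show ?thesis by (simp add: net_def)
  next
    case (Some x)
    have *: "net \<rho> \<eta> ((\<lambda>_. 0)(x := 1)) y = int (fire_cfg x (\<rho> (x, 0)) \<eta> y)" for y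
      using assms[OF Some] by (rule net_fire)
    show ?thesis
      unfolding run_Some[of sel \<eta> x, OF Some] net_advance[OF *, symmetric] pop_def[symmetric] by (rule Suc.IH)
  qed
qed

lemma run_odo_outside:
  assumes "\<And>\<eta> x. sel \<eta> = Some x \<Longrightarrow> x \<in> D" "y \<notin> D"
  shows "run_odo sel T \<eta> \<rho> y = 0"
proof (induction T arbitrary: \<eta> \<rho>)
  case (Suc T)
  then show ?case
    using assms by (cases "sel \<eta>") (auto simp: run_Some)
qed simp

lemma run_inv:
  assumes "P \<eta>" "\<And>\<eta> x i. P \<eta> \<Longrightarrow> sel \<eta> = Some x \<Longrightarrow> P (fire_cfg x i \<eta>)"
  shows "P (run_cfg sel T \<eta> \<rho>)"
  using assms(1)
proof (induction T arbitrary: \<eta> \<rho>)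
  case (Suc T)
  then show ?case using assms(2) by (cases "sel \<eta>") (auto simp: run_Some)
qed simp

lemma run_odo_sum:
  assumes "finite D" "\<And>\<eta> x. sel \<eta> = Some x \<Longrightarrow> x \<in> D"
  shows "sum (run_odo sel T \<eta> \<rho>) D \<le> T"
proof (induction T arbitrary: \<eta> \<rho>)
  case (Suc T)
  show ?case
  proof (cases "sel \<eta>")
    case (Some x)
    have "sum (run_odo sel (Suc T) \<eta> \<rho>) D =
        (\<Sum>y\<in>D. if y = x then 1 else 0) + sum (run_odo sel T (fire_cfg x (\<rho> (x, 0)) \<eta>) (pop x \<rho>)) D"
      unfolding run_Some[of sel \<eta> x, OF Some] sum.distrib fun_upd_def by (rule refl)
    then show ?thesis using Suc.IH[of "fire_cfg x (\<rho> (x, 0)) \<eta>" "pop x \<rho>"] assms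
      by (simp add: assms(2)[OF Some])
  qed simp
qed simp

text \<open>A site with two or more particles is active whatever its last instruction was, so the strategies
  considered here are legal and the least action principle applies to them.\<close>

lemma run_legal:
  assumes sel: "\<And>\<eta> x. sel \<eta> = Some x \<Longrightarrow> x \<in> D \<and> \<eta> x \<ge> 2"
    and v: "stable_odo lam D \<rho> \<eta> v" and "\<And>x. x \<in> D \<Longrightarrow> \<eta>0 x \<le> \<eta> x"
  shows "run_odo sel T \<eta>0 \<rho> \<le> v"
proof -
  have "stable_odo lam D \<rho> \<eta>0 v" by (rule stable_odo_mono[OF v]) fact
  then show ?thesis
  proof (induction T arbitrary: \<eta>0 \<rho> v)
    case 0
    then show ?case by (simp add: le_fun_def)
  next
    case (Suc T)
    show ?case
    proof (cases "sel \<eta>0")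
      case None
      then show ?thesis by (simp add: le_fun_def)
    next
      case (Some x)
      let ?e = "(\<lambda>_. 0)(x := 1 :: nat)"
      have x: "x \<in> D" "\<eta>0 x \<ge> 2" using sel[OF Some] by auto
      have "(0::nat) < v x"
        by (rule act_less_stable[OF Suc.prems _ _ x(1), where u = "\<lambda>_. 0"])
           (use x in \<open>auto simp: le_fun_def act_def net_def\<close>)
      then have e: "?e \<le> v" by (auto simp: le_fun_def)
      then have ve: "(\<lambda>y. ?e y + (v y - ?e y)) = v" by (auto simp: le_fun_def)
      have net: "net \<rho> \<eta>0 ?e y = int (fire_cfg x (\<rho> (x, 0)) \<eta>0 y)" for y
        by (rule net_fire) (use x in simp)
      have nn: "net (advance ?e \<rho>) (fire_cfg x (\<rho> (x, 0)) \<eta>0) (\<lambda>y. v y - ?e y) z = net \<rho> \<eta>0 v z" for z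
        unfolding net_advance[OF net] ve ..
      have nas: "asleep (advance ?e \<rho>) (\<lambda>y. v y - ?e y) z \<longleftrightarrow> v z - ?e z > 0 \<and> asleep \<rho> v z" for z
        unfolding asleep_advance ve ..
      have "stable_odo lam D (advance ?e \<rho>) (fire_cfg x (\<rho> (x, 0)) \<eta>0) (\<lambda>y. v y - ?e y)"
        unfolding stable_odo_def
      proof (intro conjI allI impI ballI)
        fix y assume "y \<notin> D"
        then show "v y - ?e y = 0" using Suc.prems by (simp add: stable_odo_def)
      next
        fix y assume y: "y \<in> D"
        have n: "\<not> act lam \<rho> \<eta>0 v y" using Suc.prems y by (simp add: stable_odo_def)
        show "\<not> act lam (advance ?e \<rho>) (fire_cfg x (\<rho> (x, 0)) \<eta>0) (\<lambda>y. v y - ?e y) y"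
        \<comment> \<open>Only in this case is the last instruction of \<open>v\<close> the one just
          removed. A \<open>Sleep\<close> there would leave two particles at \<open>x\<close>,
          against stability of \<open>v\<close>; so no sleep mark is lost.\<close>
        proof (cases "y = x \<and> v x = 1")
          case True
          then have "v x = 1" "y = x" by auto
          have "net \<rho> \<eta>0 v x \<ge> int (\<eta>0 x) - 1"
            using \<open>v x = 1\<close> by (simp add: net_def)
          moreover have "\<rho> (x, 0) = Sleep \<Longrightarrow> net \<rho> \<eta>0 v x \<ge> int (\<eta>0 x)"
            using \<open>v x = 1\<close> by (simp add: net_def)
          ultimately show ?thesis
            using n x True unfolding act_def nn nas by (auto simp: asleep_def)
        next
          case False
          then show ?thesis
            using n unfolding act_def nn nas by (auto simp: asleep_def)
        qed
      qed
      from Suc.IH[OF this] show ?thesis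
        using e unfolding run_Some[of sel \<eta>0 x, OF Some] pop_def le_fun_def by (metis add.commute le_diff_conv2)
    qed
  qed
qed

text \<open>A \<open>Sleep\<close> used at a site with two or more particles leaves them all there,
  and until the site fires again their number cannot drop. This supplies the \<open>awake\<close>
  hypothesis for restarts.\<close>

lemma run_asleep:
  assumes sel: "\<And>\<eta> x. sel \<eta> = Some x \<Longrightarrow> \<eta> x \<ge> 2"
    and "asleep \<rho> (run_odo sel T \<eta> \<rho>) y"
  shows "run_cfg sel T \<eta> \<rho> y \<ge> 2"
  using assms(2)
proof (induction T arbitrary: \<eta> \<rho>)
  case 0
  then show ?case by (simp add: asleep_def)
next
  case (Suc T)
  show ?case
  proof (cases "sel \<eta>")
    case None
    then show ?thesis using Suc.prems by (simp add: asleep_def)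
  next
    case (Some x)
    let ?\<eta> = "fire_cfg x (\<rho> (x, 0)) \<eta>"
    let ?u = "run_odo sel T ?\<eta> (pop x \<rho>)"
    have as: "asleep \<rho> (\<lambda>z. ((\<lambda>_. 0)(x := 1)) z + ?u z) y"
      using Suc.prems by (simp add: run_Some[of sel \<eta> x, OF Some])
    show ?thesis
    proof (cases "?u y > 0")
      case True
      then have "asleep (advance ((\<lambda>_. 0)(x := 1)) \<rho>) ?u y"
        using as asleep_advance[of "(\<lambda>_. 0)(x := 1)" \<rho> ?u y] by blast
      then have "asleep (pop x \<rho>) ?u y" by (simp only: pop_def)
      then show ?thesis using Suc.IH[of "pop x \<rho>" ?\<eta>] by (simp add: run_Some[of sel \<eta> x, OF Some])
    next
      case False
      then have y: "y = x" "\<rho> (x, 0) = Sleep" using as by (auto simp: asleep_def split: if_splits)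
      have "int (run_cfg sel T ?\<eta> (pop x \<rho>) y) = net (pop x \<rho>) ?\<eta> ?u y"
        by (rule net_run[symmetric]) (use sel in force)
      also have "\<dots> \<ge> int (?\<eta> y)" using False by (intro net_ge_zero_odo) simp
      finally show ?thesis using sel[OF Some] y by (simp add: run_Some[of sel \<eta> x, OF Some])
    qed
  qed
qed

text \<open>\<open>Sleep\<close> leaves the configuration unchanged, so its share cancels and the
  condition on \<Phi> is that of simple random walk, for every \<open>lam\<close>.\<close>

lemma run_terminal:
  fixes \<Phi> :: "(int \<Rightarrow> nat) \<Rightarrow> real"
  assumes nonneg: "\<And>\<eta>. Inv \<eta> \<Longrightarrow> 0 \<le> \<Phi> \<eta>"
    and stop: "\<And>\<eta>. Inv \<eta> \<Longrightarrow> sel \<eta> = None \<Longrightarrow> outer_le lam {\<rho>. B \<eta> \<rho>} (\<Phi> \<eta>)"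
    and inv: "\<And>\<eta> x i. Inv \<eta> \<Longrightarrow> sel \<eta> = Some x \<Longrightarrow> Inv (fire_cfg x i \<eta>)"
    and step: "\<And>\<eta> x. Inv \<eta> \<Longrightarrow> sel \<eta> = Some x \<Longrightarrow>
      \<Phi> (mv x (x - 1) \<eta>) + \<Phi> (mv x (x + 1) \<eta>) \<le> 2 * \<Phi> \<eta>"
    and "Inv \<eta>"
  shows "outer_le lam {\<rho>. sel (run_cfg sel T \<eta> \<rho>) = None \<and>
    B (run_cfg sel T \<eta> \<rho>) (advance (run_odo sel T \<eta> \<rho>) \<rho>)} (\<Phi> \<eta>)"
proof (rule run_bound[where Inv = "\<lambda>_. Inv" and \<Phi> = "\<lambda>_. \<Phi>" and B = "\<lambda>\<eta> \<rho>. sel \<eta> = None \<and> B \<eta> \<rho>"])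
  fix \<eta> assume i: "Inv \<eta>"
  show "outer_le lam {\<rho>. sel \<eta> = None \<and> B \<eta> \<rho>} (\<Phi> \<eta>)"
    using stop[OF i] nonneg[OF i] by (cases "sel \<eta> = None") (auto intro: outer_le_empty)
  show "outer_le lam {\<rho>. sel \<eta> = None \<and> B \<eta> \<rho>} (\<Phi> \<eta>)" if "sel \<eta> = None"
    using stop[OF i that] that by simp
next
  fix \<eta> x assume "Inv \<eta>" "sel \<eta> = Some x"
  from mult_left_mono[OF step[OF this], of "move_prob lam"] instr_pmf_values(3)[of lam]
  show "move_prob lam * \<Phi> (mv x (x - 1) \<eta>) + move_prob lam * \<Phi> (mv x (x + 1) \<eta>) +
      (1 - 2 * move_prob lam) * \<Phi> \<eta> \<le> \<Phi> \<eta>"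
    by (simp add: algebra_simps)
qed (use inv \<open>Inv \<eta>\<close> in auto)

lemma run_markov:
  fixes \<Phi> :: "(int \<Rightarrow> nat) \<Rightarrow> real"
  assumes nonneg: "\<And>\<eta>. Inv \<eta> \<Longrightarrow> 0 \<le> \<Phi> \<eta>"
    and inv: "\<And>\<eta> x i. Inv \<eta> \<Longrightarrow> sel \<eta> = Some x \<Longrightarrow> Inv (fire_cfg x i \<eta>)"
    and step: "\<And>\<eta> x. Inv \<eta> \<Longrightarrow> sel \<eta> = Some x \<Longrightarrow>
      \<Phi> (mv x (x - 1) \<eta>) + \<Phi> (mv x (x + 1) \<eta>) \<le> 2 * \<Phi> \<eta>"
    and "Inv \<eta>" "0 < c"
  shows "outer_le lam {\<rho>. c \<le> \<Phi> (run_cfg sel T \<eta> \<rho>)} (\<Phi> \<eta> / c)"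
proof (rule run_bound[where Inv = "\<lambda>_. Inv" and \<Phi> = "\<lambda>_ \<eta>. \<Phi> \<eta> / c" and B = "\<lambda>\<eta> _. c \<le> \<Phi> \<eta>"])
  fix \<eta> assume i: "Inv \<eta>"
  show "outer_le lam {\<rho>. c \<le> \<Phi> \<eta>} (\<Phi> \<eta> / c)"
    using nonneg[OF i] \<open>0 < c\<close>
    by (cases "c \<le> \<Phi> \<eta>") (auto intro: outer_le_empty outer_le_one)
  then show "outer_le lam {\<rho>. c \<le> \<Phi> \<eta>} (\<Phi> \<eta> / c)" .
next
  fix \<eta> x assume "Inv \<eta>" "sel \<eta> = Some x"
  then have "\<Phi> (mv x (x - 1) \<eta>) / c + \<Phi> (mv x (x + 1) \<eta>) / c \<le> 2 * (\<Phi> \<eta> / c)"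
    using step \<open>0 < c\<close> by (simp add: divide_simps)
  from mult_left_mono[OF this, of "move_prob lam"] instr_pmf_values(3)[of lam]
  show "move_prob lam * (\<Phi> (mv x (x - 1) \<eta>) / c) + move_prob lam * (\<Phi> (mv x (x + 1) \<eta>) / c) +
      (1 - 2 * move_prob lam) * (\<Phi> \<eta> / c) \<le> \<Phi> \<eta> / c"
    by (simp add: algebra_simps)
qed (use inv \<open>Inv \<eta>\<close> in auto)

lemma sum_mv:
  fixes h :: "int \<Rightarrow> real"
  assumes "finite S" "x \<in> S" "y \<in> S" "x \<noteq> y" "\<eta> x \<ge> 1"
  shows "(\<Sum>z\<in>S. h z * mv x y \<eta> z) = (\<Sum>z\<in>S. h z * \<eta> z) - h x + h y"
proof -
  have "(\<Sum>z\<in>S. h z * mv x y \<eta> z) =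
      (\<Sum>z\<in>S. h z * \<eta> z - (if z = x then h x else 0) + (if z = y then h y else 0))"
    using assms by (intro sum.cong) (auto simp: mv_def of_nat_diff algebra_simps)
  also have "\<dots> = (\<Sum>z\<in>S. h z * \<eta> z) - h x + h y"
    using assms by (simp add: sum.distrib sum_subtractf)
  finally show ?thesis .
qed

text \<open>A fair step raises the square of a position by 1 on average, so the total weight
  \<open>L^2 - x^2\<close> loses \<open>2 * move_prob lam\<close> per firing in the mean while
  staying nonnegative. A long run would consume more than the initial weight.\<close>

lemma run_nonterm:
  assumes sel: "\<And>\<eta> x. sel \<eta> = Some x \<Longrightarrow> \<bar>x\<bar> < L \<and> \<eta> x \<ge> 1" and "T > 0"
  shows "outer_le lam {\<rho>. sel (run_cfg sel T \<eta> \<rho>) \<noteq> None}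
    ((\<Sum>x\<in>{-L..L}. (of_int L ^ 2 - of_int x ^ 2) * real (\<eta> x)) / (2 * move_prob lam * T))"
proof -
  define \<Psi> where "\<Psi> \<eta> = (\<Sum>x\<in>{-L..L}. (of_int L ^ 2 - of_int x ^ 2) * real (\<eta> x))" for \<eta> :: "int \<Rightarrow> nat"
  \<comment> \<open>The remaining weight plus the expected consumption of the \<open>T - t\<close>
    steps already made, normalised to be at least 1 once all \<open>T\<close> steps are
    spent.\<close>
  define \<Phi> where "\<Phi> t \<eta> = (\<Psi> \<eta> + 2 * move_prob lam * (real T - real t)) / (2 * move_prob lam * T)" for t \<eta>
  have q: "move_prob lam > 0" by (rule instr_pmf_values)
  have pos: "0 \<le> \<Psi> \<eta>" for \<eta>
    unfolding \<Psi>_def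
  proof (intro sum_nonneg mult_nonneg_nonneg)
    fix x assume "x \<in> {-L..L}"
    then have "\<bar>x\<bar> \<le> \<bar>L\<bar>" by auto
    then have "x ^ 2 \<le> L ^ 2" by (rule abs_le_square_iff[THEN iffD1])
    then show "0 \<le> (of_int L ^ 2 - of_int x ^ 2 :: real)"
      by (metis diff_ge_0_iff_ge of_int_le_iff of_int_power)
  qed simp
  have "outer_le lam {\<rho>. sel (run_cfg sel T \<eta> \<rho>) \<noteq> None} (\<Phi> T \<eta>)"
  proof (rule run_bound[where Inv = "\<lambda>t _. t \<le> T" and B = "\<lambda>\<eta> _. sel \<eta> \<noteq> None"])
    fix \<eta>
    show "outer_le lam {\<rho>. sel \<eta> \<noteq> None} (\<Phi> 0 \<eta>)"
      using pos[of \<eta>] q \<open>T > 0\<close> by (intro outer_le_one) (simp add: \<Phi>_def)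
    fix t assume "t \<le> T" "sel \<eta> = None"
    then show "outer_le lam {\<rho>. sel \<eta> \<noteq> None} (\<Phi> t \<eta>)"
      using pos[of \<eta>] q \<open>T > 0\<close> by (auto simp: \<Phi>_def intro!: outer_le_empty)
  next
    fix t \<eta> x assume "Suc t \<le> T" and x: "sel \<eta> = Some x"
    have xL: "\<bar>x\<bar> < L" "\<eta> x \<ge> 1" using sel[OF x] by auto
    have "\<Psi> (mv x (x - 1) \<eta>) + \<Psi> (mv x (x + 1) \<eta>) = 2 * \<Psi> \<eta> - 2"
    proof -
      have "\<Psi> (mv x y \<eta>) = \<Psi> \<eta> - (of_int L ^ 2 - of_int x ^ 2) + (of_int L ^ 2 - of_int y ^ 2)"
        if "y = x - 1 \<or> y = x + 1" for y
        unfolding \<Psi>_def using that xL by (intro sum_mv) auto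
      from this[of "x - 1"] this[of "x + 1"] show ?thesis
        by (simp add: power2_eq_square algebra_simps)
    qed
    then have e: "\<Psi> (mv x (x + 1) \<eta>) = 2 * \<Psi> \<eta> - 2 - \<Psi> (mv x (x - 1) \<eta>)" by simp
    show "move_prob lam * \<Phi> t (mv x (x - 1) \<eta>) + move_prob lam * \<Phi> t (mv x (x + 1) \<eta>) +
        (1 - 2 * move_prob lam) * \<Phi> t \<eta> \<le> \<Phi> (Suc t) \<eta>"
      unfolding \<Phi>_def e using q \<open>T > 0\<close> by (simp add: divide_simps) (simp add: algebra_simps)
  qed auto
  then show ?thesis by (simp add: \<Phi>_def \<Psi>_def)
qed

definition pick :: "int set \<Rightarrow> ((int \<Rightarrow> nat) \<Rightarrow> int \<Rightarrow> bool) \<Rightarrow> (int \<Rightarrow> nat) \<Rightarrow> int option" where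
  "pick D P \<eta> = (if \<exists>x\<in>D. P \<eta> x then Some (SOME x. x \<in> D \<and> P \<eta> x) else None)"

lemma pick_Some: "pick D P \<eta> = Some x \<Longrightarrow> x \<in> D \<and> P \<eta> x"
  unfolding pick_def by (auto split: if_splits intro: someI2)

lemma pick_None: "pick D P \<eta> = None \<longleftrightarrow> (\<forall>x\<in>D. \<not> P \<eta> x)"
  by (auto simp: pick_def)

subsection \<open>Walkers leaving an interval\<close>

abbreviation "walk_out D \<equiv> pick D (\<lambda>\<eta> x. 0 < \<eta> x)"

text \<open>Gambler's ruin for many walkers at once: the sum of a linear function over their
  positions is a martingale, and a single walker at \<open>z\<close> contributes
  \<open>h z\<close>.\<close>

lemma walk_out_hit:
  fixes h :: "int \<Rightarrow> real"
  assumes "\<And>x. a \<le> x \<Longrightarrow> x \<le> b \<Longrightarrow> 0 \<le> h x"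
    and lin: "\<And>x. h (x - 1) + h (x + 1) = 2 * h x"
    and z: "a \<le> z" "z \<le> b" "0 < h z"
  shows "outer_le lam {\<rho>. run_cfg (walk_out {a<..<b}) T \<eta> \<rho> z \<ge> 1} ((\<Sum>x\<in>{a..b}. h x * \<eta> x) / h z)"
proof -
  have "outer_le lam {\<rho>. h z \<le> (\<Sum>x\<in>{a..b}. h x * run_cfg (walk_out {a<..<b}) T \<eta> \<rho> x)}
      ((\<Sum>x\<in>{a..b}. h x * \<eta> x) / h z)"
  proof (rule run_markov[where Inv = "\<lambda>_. True" and \<Phi> = "\<lambda>\<eta>. \<Sum>x\<in>{a..b}. h x * real (\<eta> x)"])
    fix \<eta> show "0 \<le> (\<Sum>x\<in>{a..b}. h x * real (\<eta> x))"
      using assms by (intro sum_nonneg) auto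
  next
    fix \<eta> x assume "walk_out {a<..<b} \<eta> = Some x"
    from pick_Some[OF this] have x: "a < x" "x < b" "\<eta> x \<ge> 1" by auto
    then show "(\<Sum>z\<in>{a..b}. h z * real (mv x (x - 1) \<eta> z)) +
        (\<Sum>z\<in>{a..b}. h z * real (mv x (x + 1) \<eta> z)) \<le> 2 * (\<Sum>x\<in>{a..b}. h x * real (\<eta> x))"
      using lin[of x] by (simp add: sum_mv)
  qed (use z in auto)
  then show ?thesis
  proof (rule outer_le_mono)
    show "{\<rho>. run_cfg (walk_out {a<..<b}) T \<eta> \<rho> z \<ge> 1} \<subseteq>
      {\<rho>. h z \<le> (\<Sum>x\<in>{a..b}. h x * run_cfg (walk_out {a<..<b}) T \<eta> \<rho> x)}"
    proof safe
      fix \<rho> assume g: "run_cfg (walk_out {a<..<b}) T \<eta> \<rho> z \<ge> 1"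
      have "h z * 1 \<le> h z * real (run_cfg (walk_out {a<..<b}) T \<eta> \<rho> z)"
        using g z by (intro mult_left_mono) auto
      also have "\<dots> \<le> (\<Sum>x\<in>{a..b}. h x * run_cfg (walk_out {a<..<b}) T \<eta> \<rho> x)"
        using assms z by (intro member_le_sum) auto
      finally show "h z \<le> (\<Sum>x\<in>{a..b}. h x * run_cfg (walk_out {a<..<b}) T \<eta> \<rho> x)" by simp
    qed
  qed simp
qed

subsection \<open>Aggregation on prescribed targets\<close>

abbreviation "aggregate D \<sigma> \<equiv> pick D (\<lambda>\<eta> x. \<sigma> x < \<eta> x)"

definition filled_towards :: "int \<Rightarrow> int \<Rightarrow> int set \<Rightarrow> (int \<Rightarrow> nat) \<Rightarrow> (int \<Rightarrow> nat) \<Rightarrow> bool" where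
  "filled_towards s c D \<sigma> \<eta> \<longleftrightarrow>
     (\<forall>y z. 0 \<le> s * (z - c) \<longrightarrow> s * (z - c) < s * (y - c) \<longrightarrow> 1 \<le> \<eta> y \<longrightarrow> z \<in> D \<longrightarrow> \<sigma> z \<le> \<eta> z)"

text \<open>Only a site with more than its target fires, so it stays filled. The particle advances
  by one site at most, and everything between \<open>c\<close> and its old position was filled
  before.\<close>

lemma filled_towards_fire:
  assumes s: "s = 1 \<or> s = -1" and f: "filled_towards s c D \<sigma> \<eta>" and x: "\<sigma> x < \<eta> x"
  shows "filled_towards s c D \<sigma> (fire_cfg x i \<eta>)"
proof -
  have main: "filled_towards s c D \<sigma> (mv x w \<eta>)" if w: "w = x - 1 \<or> w = x + 1" for w
    unfolding filled_towards_def
  proof (intro allI impI)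
    fix y z assume z: "0 \<le> s * (z - c)" "s * (z - c) < s * (y - c)" "z \<in> D" and y: "1 \<le> mv x w \<eta> y"
    show "\<sigma> z \<le> mv x w \<eta> z"
    proof (cases "z = x")
      case True
      then show ?thesis using x w by (auto simp: mv_def)
    next
      case False
      have le: "\<eta> z \<le> mv x w \<eta> z" using False by (auto simp: mv_def)
      consider "1 \<le> \<eta> y" | "y = w" using y by (auto simp: mv_def split: if_splits)
      then have "\<sigma> z \<le> \<eta> z"
      proof cases
        case 1
        then show ?thesis using f z unfolding filled_towards_def by blast
      next
        case 2
        have "s * (z - c) < s * (x - c)" using z False 2 w s by auto
        moreover have "1 \<le> \<eta> x" using x by simp
        ultimately show ?thesis using f z unfolding filled_towards_def by blast
      qed
      with le show ?thesis by simp
    qed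
  qed
  show ?thesis using main f by (cases i) auto
qed

lemma filled_towards_start: "filled_towards s c D \<sigma> ((\<lambda>_. 0)(c := n))"
  by (auto simp: filled_towards_def)

lemma sum_fire_cfg:
  assumes "finite S" "x \<in> S" "x - 1 \<in> S" "x + 1 \<in> S" "\<eta> x \<ge> 1"
  shows "sum (fire_cfg x i \<eta>) S = sum \<eta> S"
proof -
  have "sum (mv x y \<eta>) S = sum \<eta> S" if "y = x - 1 \<or> y = x + 1" for y
    using sum_mv[of S x y \<eta> "\<lambda>_. 1"] that assms by (auto simp flip: of_nat_sum)
  then show ?thesis by (cases i) auto
qed

text \<open>With \<open>Q\<close> the sum of the positions, \<open>Q\<^sup>2\<close> minus the sum of the squared positions is a
  martingale, which makes Chebyshev's inequality available without counting steps.\<close>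

lemma aggregate_center:
  assumes "r > 0" "c > 0"
  shows "outer_le lam {\<rho>. c \<le> \<bar>\<Sum>x\<in>{-r..r}. of_int x * real (run_cfg (aggregate {-r<..<r} \<sigma>) T ((\<lambda>_. 0)(0 := n)) \<rho> x)\<bar>}
    (real n * of_int r ^ 2 / c ^ 2)"
proof -
  let ?S = "{-r..r}" and ?sel = "aggregate {-r<..<r} \<sigma>"
  define Q where "Q \<eta> = (\<Sum>x\<in>?S. of_int x * real (\<eta> x))" for \<eta> :: "int \<Rightarrow> nat"
  define V where "V \<eta> = (\<Sum>x\<in>?S. of_int x ^ 2 * real (\<eta> x))" for \<eta> :: "int \<Rightarrow> nat"
  define \<Phi> where "\<Phi> \<eta> = Q \<eta> ^ 2 + real n * of_int r ^ 2 - V \<eta>" for \<eta>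
  let ?Inv = "\<lambda>\<eta> :: int \<Rightarrow> nat. sum \<eta> ?S = n"
  have V: "V \<eta> \<le> real n * of_int r ^ 2" if "?Inv \<eta>" for \<eta>
  proof -
    have "V \<eta> \<le> (\<Sum>x\<in>?S. of_int r ^ 2 * real (\<eta> x))"
      unfolding V_def
    proof (intro sum_mono mult_right_mono)
      fix x assume "x \<in> ?S"
      then have "\<bar>x\<bar> \<le> \<bar>r\<bar>" by auto
      then have "x ^ 2 \<le> r ^ 2" by (rule abs_le_square_iff[THEN iffD1])
      then show "(of_int x ^ 2 :: real) \<le> of_int r ^ 2" by (metis of_int_le_iff of_int_power)
    qed simp
    also have "\<dots> = of_int r ^ 2 * real (sum \<eta> ?S)" by (simp add: sum_distrib_left)
    finally show ?thesis using that by (simp add: mult.commute)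
  qed
  have "outer_le lam {\<rho>. c ^ 2 \<le> \<Phi> (run_cfg ?sel T ((\<lambda>_. 0)(0 := n)) \<rho>)}
      (\<Phi> ((\<lambda>_. 0)(0 := n)) / c ^ 2)"
  proof (rule run_markov[where Inv = ?Inv])
    fix \<eta> assume "?Inv \<eta>"
    then show "0 \<le> \<Phi> \<eta>" using V unfolding \<Phi>_def by (smt (verit) zero_le_power2)
  next
    fix \<eta> x i assume "?Inv \<eta>" "?sel \<eta> = Some x"
    then show "?Inv (fire_cfg x i \<eta>)" using pick_Some by (subst sum_fire_cfg) force+
  next
    fix \<eta> x assume "?sel \<eta> = Some x"
    from pick_Some[OF this] have x: "-r < x" "x < r" "\<eta> x \<ge> 1" by auto
    have 1: "Q (mv x y \<eta>) = Q \<eta> - of_int x + of_int y"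
      "V (mv x y \<eta>) = V \<eta> - of_int x ^ 2 + of_int y ^ 2" if "y = x - 1 \<or> y = x + 1" for y
      unfolding Q_def V_def using that x by (subst sum_mv; auto)+
    show "\<Phi> (mv x (x - 1) \<eta>) + \<Phi> (mv x (x + 1) \<eta>) \<le> 2 * \<Phi> \<eta>"
      by (simp add: \<Phi>_def 1 power2_eq_square algebra_simps)
  next
    show "?Inv ((\<lambda>_. 0)(0 := n))" using \<open>r > 0\<close> by (simp add: fun_upd_def)
  qed (use assms in auto)
  moreover have "\<Phi> ((\<lambda>_. 0)(0 := n)) = real n * of_int r ^ 2"
    unfolding \<Phi>_def Q_def V_def by (simp add: fun_upd_def if_distrib sum.neutral)
  moreover have "{\<rho>. c \<le> \<bar>\<Sum>x\<in>?S. of_int x * real (run_cfg ?sel T ((\<lambda>_. 0)(0 := n)) \<rho> x)\<bar>}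
     \<subseteq> {\<rho>. c ^ 2 \<le> \<Phi> (run_cfg ?sel T ((\<lambda>_. 0)(0 := n)) \<rho>)}"
  proof safe
    fix \<rho> let ?\<eta> = "run_cfg ?sel T ((\<lambda>_. 0)(0 := n)) \<rho>"
    assume a: "c \<le> \<bar>\<Sum>x\<in>?S. of_int x * real (?\<eta> x)\<bar>"
    have "?Inv ?\<eta>"
    proof (rule run_inv[where P = ?Inv])
      show "?Inv ((\<lambda>_. 0)(0 := n))" using \<open>r > 0\<close> by (simp add: fun_upd_def)
      fix \<eta> x i assume "?Inv \<eta>" "?sel \<eta> = Some x"
      then show "?Inv (fire_cfg x i \<eta>)" using pick_Some by (subst sum_fire_cfg) force+
    qed
    from V[OF this] have "Q ?\<eta> ^ 2 \<le> \<Phi> ?\<eta>" by (simp add: \<Phi>_def)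
    moreover have "c ^ 2 \<le> Q ?\<eta> ^ 2"
      using a \<open>c > 0\<close> unfolding Q_def[symmetric] by (simp add: abs_le_square_iff[symmetric])
    ultimately show "c ^ 2 \<le> \<Phi> ?\<eta>" by simp
  qed
  ultimately show ?thesis by (auto intro: outer_le_mono)
qed

subsection \<open>Filling an interval from one of its ends\<close>

definition segment :: "int \<Rightarrow> int \<Rightarrow> nat \<Rightarrow> int set" where
  "segment s c m = {x. 0 \<le> s * (x - c) \<and> s * (x - c) < int m}"

abbreviation "fill J \<equiv> pick J (\<lambda>\<eta> x. 2 \<le> \<eta> x \<and> (\<exists>y\<in>J. \<eta> y = 0))"

lemma finite_segment: "s = 1 \<or> s = -1 \<Longrightarrow> finite (segment s c m)"
  by (rule finite_subset[of _ "{c - int m..c + int m}"]) (auto simp: segment_def)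

text \<open>An empty site weighs 2 and \<open>j\<close> particles weigh
  \<open>f x ^ (j - 1)\<close>; the linear profile \<open>f\<close> makes the product of the weights
  a supermartingale. It starts below \<open>2 ^ card J * f c ^ (K - 1)\<close>, which is small for
  large \<open>K\<close>, but is at least 1 whenever the run stops with a site still empty.\<close>

lemma fill_bound:
  fixes s :: int
  assumes s: "s = 1 \<or> s = -1" and "m \<ge> 1" "K \<ge> 1" and "0 \<le> p"
    and J: "J = segment s c m"
    and full: "\<And>\<eta>. (\<And>x. x \<in> J \<Longrightarrow> \<eta> x \<ge> 1) \<Longrightarrow> outer_le lam {\<rho>. B \<eta> \<rho>} p"
  shows "outer_le lam {\<rho>. fill J (run_cfg (fill J) T ((\<lambda>_. 0)(c := K)) \<rho>) = None \<and>
      B (run_cfg (fill J) T ((\<lambda>_. 0)(c := K)) \<rho>) (advance (run_odo (fill J) T ((\<lambda>_. 0)(c := K)) \<rho>) \<rho>)}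
    (p + 2 ^ (card J) * (1 - 1 / (2 * (real m + 1))) ^ (K - 1))"
proof -
  \<comment> \<open>With this slope \<open>f\<close> extends to 1 at the site just before
    \<open>c\<close>, matching the weight of a lost particle, and stays at least 1/2 on
    \<open>J\<close>. So filling an empty site, which contributes a factor 1/2, is never worse than
    joining an occupied one.\<close>
  define \<alpha> where "\<alpha> = 1 / (2 * (real m + 1))"
  define f where "f x = 1 - \<alpha> * (of_int (s * (x - c)) + 1)" for x
  define g where "g x j = (if j = 0 then 2 else f x ^ (j - 1))" for x and j :: nat
  define \<Phi> where "\<Phi> \<eta> = (\<Prod>x\<in>J. g x (\<eta> x))" for \<eta> :: "int \<Rightarrow> nat"
  have finJ: "finite J" using s J finite_segment by simp
  have \<alpha>: "0 < \<alpha>" "\<alpha> * real m \<le> 1 / 2" using \<open>m \<ge> 1\<close> by (auto simp: \<alpha>_def field_simps)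
  have f: "1 / 2 \<le> f x" if "x \<in> J" for x
  proof -
    have "s * (x - c) + 1 \<le> int m" using that by (simp add: J segment_def)
    then have "of_int (s * (x - c)) + 1 \<le> real m" by linarith
    then have "\<alpha> * (of_int (s * (x - c)) + 1) \<le> \<alpha> * real m" using \<alpha> by (intro mult_left_mono) auto
    then show ?thesis using \<alpha> unfolding f_def by linarith
  qed
  have gpos: "0 < g x j" if "x \<in> J" for x j
    using f[OF that] by (auto simp: g_def intro!: zero_less_power)
  have \<Phi>pos: "0 < \<Phi> \<eta>" for \<eta> unfolding \<Phi>_def by (intro prod_pos) (use gpos in auto)
  let ?Inv = "filled_towards s c J (\<lambda>_. 1)"
  have "outer_le lam {\<rho>. fill J (run_cfg (fill J) T ((\<lambda>_. 0)(c := K)) \<rho>) = None \<and>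
      B (run_cfg (fill J) T ((\<lambda>_. 0)(c := K)) \<rho>) (advance (run_odo (fill J) T ((\<lambda>_. 0)(c := K)) \<rho>) \<rho>)}
    (p + \<Phi> ((\<lambda>_. 0)(c := K)))"
  proof (rule run_terminal[where Inv = ?Inv and \<Phi> = "\<lambda>\<eta>. p + \<Phi> \<eta>"])
    fix \<eta> show "0 \<le> p + \<Phi> \<eta>" using \<Phi>pos[of \<eta>] \<open>0 \<le> p\<close> by simp
  next
    fix \<eta> assume "fill J \<eta> = None"
    then have n: "\<And>x. x \<in> J \<Longrightarrow> \<eta> x < 2 \<or> (\<forall>y\<in>J. \<eta> y \<noteq> 0)"
      unfolding pick_None by (meson not_less)
    show "outer_le lam {\<rho>. B \<eta> \<rho>} (p + \<Phi> \<eta>)"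
    proof (cases "\<forall>y\<in>J. \<eta> y \<noteq> 0")
      case True
      then have "outer_le lam {\<rho>. B \<eta> \<rho>} p" by (intro full) (auto simp: Suc_le_eq)
      then show ?thesis by (rule outer_le_mono) (use \<Phi>pos[of \<eta>] in auto)
    next
      case False
      \<comment> \<open>The run stopped although a site is empty, so no site holds two particles and
        each weight is 2 or 1.\<close>
      have "1 \<le> g x (\<eta> x)" if "x \<in> J" for x
      proof -
        have "\<eta> x = 0 \<or> \<eta> x = 1" using n[OF that] False by linarith
        then show ?thesis by (auto simp: g_def)
      qed
      then have "1 \<le> \<Phi> \<eta>" unfolding \<Phi>_def by (intro prod_ge_1) auto
      then show ?thesis using \<open>0 \<le> p\<close> by (intro outer_le_one) simp
    qed
  next
    fix \<eta> x i assume "?Inv \<eta>" "fill J \<eta> = Some x"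
    then show "?Inv (fire_cfg x i \<eta>)" using pick_Some s by (intro filled_towards_fire) force+
  next
    fix \<eta> x assume inv: "?Inv \<eta>" and "fill J \<eta> = Some x"
    from pick_Some[OF this(2)] obtain e where x: "x \<in> J" "2 \<le> \<eta> x" and e: "e \<in> J" "\<eta> e = 0" by auto
    define R where "R y = (if y \<in> J then if \<eta> y = 0 then 1 / 2 else f y else 1)" for y
    have mvR: "\<Phi> (mv x y \<eta>) = \<Phi> \<eta> / f x * R y" if "y \<noteq> x" for y
    proof -
      have "\<Phi> (mv x y \<eta>) = (\<Prod>z\<in>J. g z (\<eta> z) * (if z = x then 1 / f x else 1) * (if z = y then R y else 1))"
        unfolding \<Phi>_def
      proof (rule prod.cong)
        fix z assume z: "z \<in> J"
        have "\<eta> x = Suc (Suc (\<eta> x - 2))" using x by simp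
        then obtain k where k: "\<eta> x = Suc (Suc k)" by blast
        have "f x \<noteq> 0" using f[OF x(1)] by auto
        show "g z (mv x y \<eta> z) = g z (\<eta> z) * (if z = x then 1 / f x else 1) * (if z = y then R y else 1)"
        proof -
          consider "z = x" | "z = y" | "z \<noteq> x" "z \<noteq> y" by blast
          then show ?thesis
          proof cases
            case 1
            then show ?thesis using that k \<open>f x \<noteq> 0\<close> by (simp add: g_def mv_def)
          next
            case 2
            then show ?thesis using that z
              by (cases "\<eta> y") (auto simp: g_def mv_def R_def)
          qed (simp add: mv_def)
        qed
      qed simp
      also have "\<dots> = \<Phi> \<eta> * (1 / f x) * R y"
        using finJ x(1) by (simp add: prod.distrib \<Phi>_def R_def)
      finally show ?thesis by simp
    qed
    \<comment> \<open>Towards the source: sites between \<open>c\<close> and \<open>x\<close> are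
      occupied by the invariant, so this neighbour is occupied, or \<open>x = c\<close> and the
      particle is lost.\<close>
    have "R (x - s) \<le> f x + \<alpha>"
    proof (cases "x - s \<in> J")
      case True
      then have "1 \<le> \<eta> (x - s)" 
        using inv[unfolded filled_towards_def, rule_format, of "x - s" x] x s
        by (auto simp: J segment_def)
      then have "R (x - s) = f (x - s)" using True by (simp add: R_def)
      also have "\<dots> = f x + \<alpha>" using s by (auto simp: f_def algebra_simps)
      finally show ?thesis by simp
    next
      case False
      then have z: "s * (x - c) = 0" using x s by (auto simp: J segment_def)
      have "f x = 1 - \<alpha>" unfolding f_def z by simp
      then show ?thesis using False by (simp add: R_def)
    qed
    \<comment> \<open>Away from the source: the empty site \<open>e\<close> must lie beyond
      \<open>x\<close>, so this step stays in \<open>J\<close>.\<close>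
    moreover have "R (x + s) \<le> f x - \<alpha>"
    proof -
      have "s * (x - c) < s * (e - c)"
      proof (rule ccontr)
        assume "\<not> s * (x - c) < s * (e - c)"
        moreover have "s * (x - c) \<noteq> s * (e - c)" using x e s by auto
        ultimately have "s * (e - c) < s * (x - c)" by linarith
        then have "1 \<le> \<eta> e"
          using inv[unfolded filled_towards_def, rule_format, of e x] x e by (auto simp: J segment_def)
        then show False using e by simp
      qed
      then have "x + s \<in> J" using x e s by (auto simp: J segment_def)
      moreover have "f (x + s) = f x - \<alpha>" using s by (auto simp: f_def algebra_simps)
      ultimately show ?thesis using f[of "x + s"] by (auto simp: R_def)
    qed
    ultimately have "R (x - s) + R (x + s) \<le> 2 * f x" by simp
    then have "R (x - 1) + R (x + 1) \<le> 2 * f x" using s by (auto simp: add.commute)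
    then have "\<Phi> \<eta> / f x * (R (x - 1) + R (x + 1)) \<le> \<Phi> \<eta> / f x * (2 * f x)"
      using \<Phi>pos[of \<eta>] f[OF x(1)] by (intro mult_left_mono) auto
    then show "p + \<Phi> (mv x (x - 1) \<eta>) + (p + \<Phi> (mv x (x + 1) \<eta>)) \<le> 2 * (p + \<Phi> \<eta>)"
      using f[OF x(1)] by (simp add: mvR algebra_simps)
  next
    show "?Inv ((\<lambda>_. 0)(c := K))" by (rule filled_towards_start)
  qed
  moreover have "\<Phi> ((\<lambda>_. 0)(c := K)) \<le> 2 ^ card J * (1 - 1 / (2 * (real m + 1))) ^ (K - 1)"
  proof -
    have c: "c \<in> J" using \<open>m \<ge> 1\<close> by (simp add: J segment_def)
    have "\<Phi> ((\<lambda>_. 0)(c := K)) = g c K * (\<Prod>x\<in>J - {c}. 2)"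
      unfolding \<Phi>_def using finJ c by (subst prod.remove[of J c]) (auto simp: g_def intro!: prod.cong)
    also have "\<dots> = 2 ^ (card J - 1) * f c ^ (K - 1)"
      using c finJ \<open>K \<ge> 1\<close> by (simp add: g_def)
    also have "\<dots> \<le> 2 ^ card J * f c ^ (K - 1)"
      using f[OF c] by (intro mult_right_mono power_increasing) auto
    finally show ?thesis by (simp add: f_def \<alpha>_def)
  qed
  ultimately show ?thesis by (auto intro: outer_le_mono)
qed

section \<open>Measurability\<close>

context
  fixes M :: "'a measure" and f :: "'a \<Rightarrow> stacks" and g :: "'a \<Rightarrow> int \<Rightarrow> nat"
  assumes f: "\<And>p. (\<lambda>\<omega>. f \<omega> p) \<in> measurable M (count_space UNIV)"
    and g: "\<And>x. (\<lambda>\<omega>. g \<omega> x) \<in> measurable M (count_space UNIV)"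
begin

lemma pred_coord: "Measurable.pred M (\<lambda>\<omega>. f \<omega> p = i)"
  using f[of p] by simp

lemma net_measurable: "(\<lambda>\<omega>. real_of_int (net (f \<omega>) (g \<omega>) u x)) \<in> borel_measurable M"
proof -
  have "(\<lambda>\<omega>. real (cnt i (f \<omega>) y k)) \<in> borel_measurable M" for i y k
    unfolding cnt_def of_nat_sum
    by (intro borel_measurable_sum measurable_compose[OF f, where g = "\<lambda>a. real (if a = i then 1 else 0)"]) simp
  moreover have "(\<lambda>\<omega>. real (g \<omega> x)) \<in> borel_measurable M"
    by (intro measurable_compose[OF g]) simp
  ultimately show ?thesis unfolding net_def by simp
qed

lemma act_measurable: "Measurable.pred M (\<lambda>\<omega>. act lam (f \<omega>) (g \<omega>) u x)"
proof -
  note [measurable] = net_measurable pred_coord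
  have "act lam (f \<omega>) (g \<omega>) u x \<longleftrightarrow> real_of_int (net (f \<omega>) (g \<omega>) u x) \<ge> 2 \<or>
      (real_of_int (net (f \<omega>) (g \<omega>) u x) = 1 \<and> lam \<noteq> \<infinity> \<and> \<not> (u x > 0 \<and> f \<omega> (x, u x - 1) = Sleep))" for \<omega>
    unfolding act_def asleep_def by (simp add: of_int_eq_1_iff)
  then show ?thesis by (simp only:) measurable
qed

lemma legal_measurable:
  assumes "\<And>\<omega> x. x \<notin> D \<Longrightarrow> g \<omega> x = 0"
  shows "Measurable.pred M (\<lambda>\<omega>. legal lam (f \<omega>) D (num_cfg (g \<omega>)) xs)"
proof -
  note [measurable] = act_measurable
  have "legal lam (f \<omega>) D (num_cfg (g \<omega>)) xs \<longleftrightarrow>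
    (\<forall>i\<in>{..<length xs}. xs ! i \<in> D \<and> act lam (f \<omega>) (g \<omega>) (count_list (take i xs)) (xs ! i))" for \<omega>
    using legal_iff_act[of D "g \<omega>"] assms by auto
  then show ?thesis by simp
qed

lemma stabilizing_measurable:
  assumes "\<And>\<omega> x. x \<notin> D \<Longrightarrow> g \<omega> x = 0"
  shows "Measurable.pred M (\<lambda>\<omega>. stabilizing lam (f \<omega>) D (num_cfg (g \<omega>)) xs)"
proof -
  note [measurable] = act_measurable legal_measurable[OF assms]
  have "stabilizing lam (f \<omega>) D (num_cfg (g \<omega>)) xs \<longleftrightarrow> legal lam (f \<omega>) D (num_cfg (g \<omega>)) xs \<and>
    (\<forall>x. x \<notin> D \<longrightarrow> count_list xs x = 0) \<and> (\<forall>x. x \<in> D \<longrightarrow> \<not> act lam (f \<omega>) (g \<omega>) (count_list xs) x)" for \<omega>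
    using stabilizing_iff_stable[of D "g \<omega>"] assms by (auto simp: stable_odo_def)
  then show ?thesis by simp
qed

lemma odometer_measurable:
  "(\<lambda>\<omega>. ennreal_of_enat (odometer lam (f \<omega>) (num_cfg (g \<omega>)) x)) \<in> borel_measurable M"
proof -
  note [measurable] = legal_measurable[of UNIV]
  let ?L = "\<lambda>\<omega>. {xs. legal lam (f \<omega>) UNIV (num_cfg (g \<omega>)) xs}"
  have "ennreal_of_enat (odometer lam (f \<omega>) (num_cfg (g \<omega>)) x) =
      (SUP xs. if legal lam (f \<omega>) UNIV (num_cfg (g \<omega>)) xs then ennreal_of_enat (enat (count_list xs x)) else 0)"
    (is "?l = ?r") for \<omega>
  proof (rule antisym)
    show "?l \<le> ?r" unfolding odometer_def ennreal_of_enat_Sup image_image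
    proof (rule SUP_least)
      fix xs assume "xs \<in> ?L \<omega>"
      then show "ennreal_of_enat (enat (count_list xs x)) \<le> ?r"
        by (intro SUP_upper2[of xs]) auto
    qed
    show "?r \<le> ?l" unfolding odometer_def ennreal_of_enat_Sup image_image
      by (rule SUP_least) (auto intro: SUP_upper2)
  qed
  then show ?thesis by (simp only:) measurable
qed

end

lemma stack_coord_const:
  "(\<lambda>\<rho>. \<rho> p) \<in> measurable (stack_measure lam) (count_space UNIV)"
  "(\<lambda>\<rho>. c :: nat) \<in> measurable (stack_measure lam) (count_space UNIV)"
  by (rule coord_stack) simp

lemma stabilizing_sets:
  assumes "\<And>x. x \<notin> D \<Longrightarrow> \<eta> x = 0"
  shows "{\<rho>. stabilizing lam \<rho> D (num_cfg \<eta>) xs} \<in> sets (stack_measure lam')"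
  using stabilizing_measurable[of "\<lambda>\<rho>. \<rho>" "stack_measure lam'" "\<lambda>_. \<eta>" D lam xs] stack_coord_const assms
  by (simp add: pred_def)

lemma fired_set_measurable: "{\<rho>. fired_set lam \<rho> n = A} \<in> sets (stack_measure lam)"
proof -
  have "{\<rho>. x \<in> fired_set lam \<rho> n} \<in> sets (stack_measure lam)" for x
  proof -
    have "{\<rho>. x \<in> fired_set lam \<rho> n} =
      (\<Union>xs\<in>{xs. x \<in> set xs}. {\<rho>. stabilizing lam \<rho> UNIV (num_cfg ((\<lambda>_. 0)(0 := n))) xs})"
      by (auto simp: fired_set_def num_cfg_point)
    also have "\<dots> \<in> sets (stack_measure lam)"
      by (intro sets.countable_UN'' stabilizing_sets) auto
    finally show ?thesis .
  qed
  then have [measurable]: "Measurable.pred (stack_measure lam) (\<lambda>\<rho>. x \<in> fired_set lam \<rho> n)" for x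
    by (simp add: pred_def)
  have "Measurable.pred (stack_measure lam) (\<lambda>\<rho>. \<forall>x. x \<in> fired_set lam \<rho> n \<longleftrightarrow> x \<in> A)"
    by measurable
  then show ?thesis by (simp add: pred_def set_eq_iff)
qed

text \<open>An arbitrary \<open>P\<close> is allowed because fired sets are finite sets of integers
  and hence take only countably many values.\<close>

lemma fired_set_pred_measurable: "Measurable.pred (stack_measure lam) (\<lambda>\<rho>. P (fired_set lam \<rho> n))"
proof -
  have "{\<rho>. P (fired_set lam \<rho> n)} = (\<Union>A\<in>{A. finite A \<and> P A}. {\<rho>. fired_set lam \<rho> n = A})"
    using finite_fired_set by auto
  also have "\<dots> \<in> sets (stack_measure lam)"
  proof (rule sets.countable_UN'')
    show "countable {A :: int set. finite A \<and> P A}"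
      by (rule countable_subset[OF _ countable_Collect_finite]) auto
  qed (rule fired_set_measurable)
  finally show ?thesis by (simp add: pred_def)
qed

lemma particles_left_measurable: "{\<rho>. particles_left lam \<rho> I > z} \<in> sets (stack_measure lam)"
proof -
  let ?\<eta> = "\<lambda>x. if x \<in> I then 1 else (0 :: nat)"
  define st where "st xs \<rho> = stabilizing lam \<rho> I (num_cfg ?\<eta>) xs" for xs \<rho>
  have st [measurable]: "Measurable.pred (stack_measure lam) (st xs)" for xs
    unfolding st_def using stabilizing_sets[of I ?\<eta> lam xs lam] by (simp add: pred_def)
  \<comment> \<open>Without a stabilizing sequence the description in \<open>stabilization\<close>
    ranges over an empty predicate, so the value is a constant that does not depend on the
    stacks.\<close>
  define val where "val \<rho> = (if \<exists>xs. st xs \<rho> then particles_left lam \<rho> I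
    else (\<Sum>x\<in>I. mass ((THE \<eta>'. False) x)))" for \<rho>
  have "particles_left lam \<rho> I = val \<rho>" for \<rho>
    by (auto simp: val_def particles_left_def stabilization_def one_on_num st_def[symmetric])
  have fin: "{\<rho>. particles_left lam \<rho> I > z} \<in> sets (stack_measure lam)" if "finite I"
  proof -
    have eq: "real (particles_left lam \<rho> I) = (\<Sum>x\<in>I. real_of_int (net \<rho> ?\<eta> (count_list xs) x))" if "st xs \<rho>" for xs \<rho>
    proof -
      have "min_odo lam I \<rho> ?\<eta> (count_list xs)"
        using that stabilizing_iff[of I ?\<eta> lam \<rho> xs] by (auto simp: st_def)
      from particles_left_eq[OF this \<open>finite I\<close>] have "real_of_int (int (particles_left lam \<rho> I)) =
        real_of_int (\<Sum>x\<in>I. net \<rho> ?\<eta> (count_list xs) x)" by simp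
      then show ?thesis by simp
    qed
    have [measurable]: "(\<lambda>\<rho>. real_of_int (net \<rho> ?\<eta> u x)) \<in> borel_measurable (stack_measure lam)" for u x
      by (rule net_measurable[of "\<lambda>\<rho>. \<rho>" _ "\<lambda>_. ?\<eta>"]) (rule stack_coord_const)+
    have "particles_left lam \<rho> I > z \<longleftrightarrow>
      (\<exists>xs. st xs \<rho> \<and> (\<Sum>x\<in>I. real_of_int (net \<rho> ?\<eta> (count_list xs) x)) > real z) \<or>
      (\<not> (\<exists>xs. st xs \<rho>) \<and> (\<Sum>x\<in>I. mass ((THE \<eta>'. False) x)) > z)" for \<rho>
    proof (cases "\<exists>xs. st xs \<rho>")
      case True
      then show ?thesis using eq by (metis of_nat_less_iff)
    next
      case False
      then show ?thesis using \<open>particles_left lam \<rho> I = val \<rho>\<close> by (simp add: val_def)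
    qed
    moreover have "Measurable.pred (stack_measure lam) (\<lambda>\<rho>.
      (\<exists>xs. st xs \<rho> \<and> (\<Sum>x\<in>I. real_of_int (net \<rho> ?\<eta> (count_list xs) x)) > real z) \<or>
      (\<not> (\<exists>xs. st xs \<rho>) \<and> (\<Sum>x\<in>I. mass ((THE \<eta>'. False) x)) > z))"
      by measurable
    ultimately show ?thesis by (simp add: pred_def)
  qed
  then show ?thesis
    by (cases "finite I") (auto simp: particles_left_def)
qed

section \<open>Moments of the odometer of a Bernoulli configuration\<close>

lemma space_bernoulli [simp]: "space (bernoulli_field \<zeta>) = UNIV"
  by (simp add: bernoulli_field_def space_PiM)

lemma prob_space_bernoulli: "prob_space (bernoulli_field \<zeta>)"
  unfolding bernoulli_field_def by (intro prob_space_PiM) (rule measure_pmf.prob_space_axioms)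

lemma coord_bernoulli: "(\<lambda>\<sigma>. \<sigma> x) \<in> measurable (bernoulli_field \<zeta>) (count_space UNIV)"
proof -
  have "(\<lambda>\<sigma>. \<sigma> x) \<in> measurable (bernoulli_field \<zeta>) (measure_pmf (bernoulli_pmf \<zeta>))"
    unfolding bernoulli_field_def by (rule measurable_component_singleton) simp
  then show ?thesis by simp
qed

lemma distr_bernoulli_shift:
  "distr (bernoulli_field \<zeta>) (bernoulli_field \<zeta>) (\<lambda>\<sigma> x. \<sigma> (x + b)) = bernoulli_field \<zeta>"
  using distr_PiM_reindex[of UNIV "\<lambda>_. measure_pmf (bernoulli_pmf \<zeta>)" "\<lambda>x :: int. x + b" UNIV]
  by (simp add: bernoulli_field_def measure_pmf.prob_space_axioms restrict_def)

abbreviation "occ \<sigma> \<equiv> (\<lambda>x. if \<sigma> x then 1 else (0 :: nat))"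

lemma count_list_map_add: "count_list (map (\<lambda>x. x + b) xs) (y + b) = count_list xs (y :: int)"
  by (induction xs) auto

lemma odometer_translate:
  "odometer lam (\<lambda>(x, k). \<rho> (x + b, k)) (num_cfg (\<lambda>x. \<eta> (x + b))) 0 = odometer lam \<rho> (num_cfg \<eta>) b"
proof -
  let ?\<rho> = "\<lambda>(x, k). \<rho> (x + b, k)" and ?\<eta> = "\<lambda>x. \<eta> (x + b)"
  have cnt: "cnt i ?\<rho> x k = cnt i \<rho> (x + b) k" for i x k by (simp add: cnt_def)
  have act: "act lam ?\<rho> ?\<eta> (\<lambda>x. u (x + b)) x = act lam \<rho> \<eta> u (x + b)" for u x
    by (simp add: act_def net_def asleep_def cnt algebra_simps)
  have legal: "legal lam ?\<rho> UNIV (num_cfg ?\<eta>) xs \<longleftrightarrow> legal lam \<rho> UNIV (num_cfg \<eta>) (map (\<lambda>x. x + b) xs)" for xs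
  proof -
    have "act lam ?\<rho> ?\<eta> (count_list ys) x = act lam \<rho> \<eta> (count_list (map (\<lambda>x. x + b) ys)) (x + b)" for ys x
      using act[of "count_list (map (\<lambda>x. x + b) ys)" x] by (simp add: count_list_map_add)
    then show ?thesis
      using legal_iff_act[of UNIV ?\<eta> lam ?\<rho> xs] legal_iff_act[of UNIV \<eta> lam \<rho> "map (\<lambda>x. x + b) xs"]
      by (simp add: take_map)
  qed
  have "{xs. legal lam \<rho> UNIV (num_cfg \<eta>) xs} = map (\<lambda>x. x + b) ` {xs. legal lam ?\<rho> UNIV (num_cfg ?\<eta>) xs}"
  proof (safe)
    fix xs assume "legal lam \<rho> UNIV (num_cfg \<eta>) xs"
    moreover have "map (\<lambda>x. x + b) (map (\<lambda>x. x - b) xs) = xs" by (simp add: o_def)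
    ultimately show "xs \<in> map (\<lambda>x. x + b) ` {xs. legal lam ?\<rho> UNIV (num_cfg ?\<eta>) xs}"
      using legal[of "map (\<lambda>x. x - b) xs"] by (metis image_eqI mem_Collect_eq)
  qed (simp add: legal)
  then show ?thesis
    using count_list_map_add[of b _ 0] by (simp add: odometer_def image_image)
qed

text \<open>The third moment with the particle configuration held fixed, which is what is needed
  once a particular \<sigma> has been selected.\<close>

definition odo_moment :: "ennreal \<Rightarrow> int \<Rightarrow> (int \<Rightarrow> bool) \<Rightarrow> ennreal" where
  "odo_moment lam b \<sigma> =
     (\<integral>\<^sup>+\<rho>. ennreal_of_enat (odometer lam \<rho> (num_cfg (occ \<sigma>)) b) ^ 3 \<partial>stack_measure lam)"

lemma one_on_occ: "one_on {x. \<sigma> x} = num_cfg (occ \<sigma>)"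
  by (simp add: one_on_num)

lemma odometer_pair_measurable:
  "(\<lambda>p. ennreal_of_enat (odometer lam (fst p) (num_cfg (occ (snd p))) b) ^ 3)
     \<in> borel_measurable (stack_measure lam \<Otimes>\<^sub>M bernoulli_field \<zeta>)"
proof (intro borel_measurable_power_ennreal odometer_measurable)
  fix p show "(\<lambda>\<omega>. fst \<omega> p) \<in> measurable (stack_measure lam \<Otimes>\<^sub>M bernoulli_field \<zeta>) (count_space UNIV)"
    by (rule measurable_compose[OF measurable_fst coord_stack])
next
  fix x
  have "(\<lambda>\<omega>. snd \<omega> x) \<in> measurable (stack_measure lam \<Otimes>\<^sub>M bernoulli_field \<zeta>) (count_space UNIV)"
    by (rule measurable_compose[OF measurable_snd coord_bernoulli])
  then show "(\<lambda>\<omega>. occ (snd \<omega>) x) \<in> measurable (stack_measure lam \<Otimes>\<^sub>M bernoulli_field \<zeta>) (count_space UNIV)"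
    by (rule measurable_compose) simp
qed

lemma odo_moment_measurable: "odo_moment lam b \<in> borel_measurable (bernoulli_field \<zeta>)"
proof -
  interpret S: prob_space "stack_measure lam" by (rule prob_space_stack)
  show ?thesis
    unfolding odo_moment_def
    using measurable_pair_swap[OF odometer_pair_measurable[of lam b \<zeta>]]
    by (intro S.borel_measurable_nn_integral) (simp add: case_prod_beta')
qed

lemma odo_moment_shift: "odo_moment lam b \<sigma> = odo_moment lam 0 (\<lambda>x. \<sigma> (x + b))"
proof -
  let ?t = "\<lambda>\<rho> :: stacks. (\<lambda>p. \<rho> ((\<lambda>(x, k). (x + b, k)) p))"
  let ?F = "\<lambda>\<rho>. ennreal_of_enat (odometer lam \<rho> (num_cfg (occ (\<lambda>x. \<sigma> (x + b)))) 0) ^ 3"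
  have t: "distr (stack_measure lam) (stack_measure lam) ?t = stack_measure lam"
    by (rule distr_stack_reindex) (auto simp: inj_def)
  have m: "?t \<in> measurable (stack_measure lam) (stack_measure lam)"
    by (rule measurable_into_stack) (rule coord_stack)
  have pt: "?F (?t \<rho>) = ennreal_of_enat (odometer lam \<rho> (num_cfg (occ \<sigma>)) b) ^ 3" for \<rho>
    using odometer_translate[of lam \<rho> b "occ \<sigma>"] by (simp add: case_prod_beta')
  have "odo_moment lam 0 (\<lambda>x. \<sigma> (x + b)) = (\<integral>\<^sup>+\<rho>. ?F \<rho> \<partial>distr (stack_measure lam) (stack_measure lam) ?t)"
    unfolding t by (simp add: odo_moment_def)
  also have "\<dots> = (\<integral>\<^sup>+\<rho>. ?F (?t \<rho>) \<partial>stack_measure lam)"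
  proof (rule nn_integral_distr[OF m])
    have "?F \<in> borel_measurable (stack_measure lam)"
      by (intro borel_measurable_power_ennreal odometer_measurable stack_coord_const)
    then show "?F \<in> borel_measurable (distr (stack_measure lam) (stack_measure lam) ?t)" by simp
  qed
  also have "\<dots> = odo_moment lam b \<sigma>" by (simp only: odo_moment_def pt)
  finally show ?thesis by simp
qed

text \<open>Fubini and translation invariance: the moment assumption, made at the origin, serves at
  any site \<open>b\<close>, in particular at both ends of an interval.\<close>

lemma odo_moment_integral: "(\<integral>\<^sup>+\<sigma>. odo_moment lam b \<sigma> \<partial>bernoulli_field \<zeta>) = outer_moment lam \<zeta>"
proof -
  interpret S: prob_space "stack_measure lam" by (rule prob_space_stack)
  interpret B: prob_space "bernoulli_field \<zeta>" by (rule prob_space_bernoulli)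
  interpret P: pair_sigma_finite "stack_measure lam" "bernoulli_field \<zeta>" ..
  have m: "(\<lambda>\<sigma> x. \<sigma> (x + b)) \<in> measurable (bernoulli_field \<zeta>) (bernoulli_field \<zeta>)"
  proof -
    have "(\<lambda>\<sigma> x. \<sigma> (x + b)) \<in> measurable (bernoulli_field \<zeta>) (PiM UNIV (\<lambda>_. measure_pmf (bernoulli_pmf \<zeta>)))"
      using measurable_sets[OF coord_bernoulli]
      by (intro measurable_PiM_single) (auto simp: vimage_def)
    then show ?thesis by (simp add: bernoulli_field_def)
  qed
  have "(\<integral>\<^sup>+\<sigma>. odo_moment lam b \<sigma> \<partial>bernoulli_field \<zeta>) =
      (\<integral>\<^sup>+\<sigma>. odo_moment lam 0 \<sigma> \<partial>distr (bernoulli_field \<zeta>) (bernoulli_field \<zeta>) (\<lambda>\<sigma> x. \<sigma> (x + b)))"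
    using nn_integral_distr[OF m, of "odo_moment lam 0"] odo_moment_measurable
    by (simp add: odo_moment_shift[of lam b, symmetric])
  also have "\<dots> = (\<integral>\<^sup>+\<sigma>. odo_moment lam 0 \<sigma> \<partial>bernoulli_field \<zeta>)" by (simp only: distr_bernoulli_shift)
  also have "\<dots> = outer_moment lam \<zeta>"
    unfolding odo_moment_def outer_moment_def
    using P.nn_integral_snd[OF odometer_pair_measurable[of lam 0 \<zeta>]]
    by (simp add: one_on_occ case_prod_beta')
  finally show ?thesis .
qed

lemma odometer_tail:
  assumes "odo_moment lam b \<sigma> \<le> ennreal C" "0 < k" "0 \<le> C"
  shows "outer_le lam {\<rho>. \<not> odometer lam \<rho> (num_cfg (occ \<sigma>)) b \<le> enat k} (C / real k ^ 3)"
proof (rule outer_le_meas)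
  interpret S: prob_space "stack_measure lam" by (rule prob_space_stack)
  let ?F = "\<lambda>\<rho>. ennreal_of_enat (odometer lam \<rho> (num_cfg (occ \<sigma>)) b)"
  let ?Q = "{\<rho>. \<not> odometer lam \<rho> (num_cfg (occ \<sigma>)) b \<le> enat k}"
  have [measurable]: "?F \<in> borel_measurable (stack_measure lam)"
    by (intro odometer_measurable stack_coord_const)
  have Q: "?Q = {\<rho> \<in> space (stack_measure lam). \<not> ?F \<rho> \<le> of_nat k}"
    by (metis (no_types, lifting) ennreal_of_enat_enat ennreal_of_enat_le_iff space_stack UNIV_I)
  have "{\<rho> \<in> space (stack_measure lam). \<not> ?F \<rho> \<le> of_nat k} \<in> sets (stack_measure lam)" by measurable
  then show m: "?Q \<in> sets (stack_measure lam)" unfolding Q .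
  have "emeasure (stack_measure lam) ?Q \<le>
    emeasure (stack_measure lam) {\<rho>\<in>space (stack_measure lam). 1 \<le> ennreal (1 / real k ^ 3) * ?F \<rho> ^ 3}"
  proof (rule emeasure_mono)
    show "?Q \<subseteq> {\<rho>\<in>space (stack_measure lam). 1 \<le> ennreal (1 / real k ^ 3) * ?F \<rho> ^ 3}"
    proof safe
      fix \<rho> assume "\<not> odometer lam \<rho> (num_cfg (occ \<sigma>)) b \<le> enat k"
      then have "of_nat k \<le> ?F \<rho>" by (metis ennreal_of_enat_enat ennreal_of_enat_le_iff linear)
      then have "of_nat k ^ 3 \<le> ?F \<rho> ^ 3" by (rule power_mono) simp
      then have "ennreal (1 / real k ^ 3) * of_nat k ^ 3 \<le> ennreal (1 / real k ^ 3) * ?F \<rho> ^ 3"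
        by (rule mult_left_mono) simp
      moreover have "ennreal (1 / real k ^ 3) * of_nat k ^ 3 = 1"
        using \<open>0 < k\<close> by (simp add: ennreal_of_nat_eq_real_of_nat ennreal_power ennreal_mult[symmetric])
      ultimately show "1 \<le> ennreal (1 / real k ^ 3) * ?F \<rho> ^ 3" by simp
    qed simp
  qed measurable
  also have "\<dots> \<le> ennreal (1 / real k ^ 3) * (\<integral>\<^sup>+\<rho>. ?F \<rho> ^ 3 * indicator (space (stack_measure lam)) \<rho> \<partial>stack_measure lam)"
    using sets.top[of "stack_measure lam"] by (intro nn_integral_Markov_inequality) auto
  also have "\<dots> = ennreal (1 / real k ^ 3) * odo_moment lam b \<sigma>"
    by (simp add: odo_moment_def)
  also have "\<dots> \<le> ennreal (1 / real k ^ 3) * ennreal C" by (rule mult_left_mono[OF assms(1)]) simp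
  also have "\<dots> = ennreal (C / real k ^ 3)" using \<open>0 \<le> C\<close> by (simp add: ennreal_mult[symmetric])
  finally have "ennreal (S.prob ?Q) \<le> ennreal (C / real k ^ 3)" by (simp add: S.emeasure_eq_measure)
  then show "S.prob ?Q \<le> C / real k ^ 3" using \<open>0 \<le> C\<close> by (simp add: ennreal_le_iff)
qed

section \<open>Linear statistics of the Bernoulli field\<close>

lemma bernoulli_linear_tail:
  fixes a :: "int \<Rightarrow> real"
  assumes "finite S" "0 \<le> \<zeta>" "\<zeta> \<le> 1" "0 < t"
  shows "measure (bernoulli_field \<zeta>) {\<sigma>. t \<le> \<bar>\<Sum>x\<in>S. a x * (of_bool (\<sigma> x) - \<zeta>)\<bar>}
      \<le> (\<Sum>x\<in>S. a x ^ 2) / t ^ 2"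
    and "{\<sigma>. t \<le> \<bar>\<Sum>x\<in>S. a x * (of_bool (\<sigma> x) - \<zeta>)\<bar>} \<in> sets (bernoulli_field \<zeta>)"
proof -
  let ?B = "bernoulli_field \<zeta>" and ?p = "measure_pmf (bernoulli_pmf \<zeta>)"
  interpret B: prob_space ?B by (rule prob_space_bernoulli)
  interpret P: product_prob_space "\<lambda>_ :: int. ?p" UNIV ..
  define X where "X x \<sigma> = (of_bool (\<sigma> x) - \<zeta> :: real)" for x :: int and \<sigma>
  define W where "W \<sigma> = (\<Sum>x\<in>S. a x * X x \<sigma>)" for \<sigma>
  have Xm [measurable]: "X x \<in> borel_measurable ?B" for x
    unfolding X_def by (intro measurable_compose[OF coord_bernoulli]) simp
  have Xb: "\<bar>X x \<sigma>\<bar> \<le> 1" for x \<sigma> using assms by (auto simp: X_def)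
  have XXb: "\<bar>X x \<sigma> * X y \<sigma>\<bar> \<le> 1" for x y \<sigma> using Xb by (simp add: abs_mult mult_le_one)
  have XXi: "integrable ?B (\<lambda>\<sigma>. X x \<sigma> * X y \<sigma>)" for x y
    using XXb by (intro B.integrable_const_bound[of _ 1]) auto
  have XX1: "B.expectation (\<lambda>\<sigma>. X x \<sigma> * X x \<sigma>) \<le> 1" for x
  proof -
    have "B.expectation (\<lambda>\<sigma>. X x \<sigma> * X x \<sigma>) \<le> B.expectation (\<lambda>\<sigma>. 1)"
      using XXb XXi by (intro integral_mono) (auto simp: abs_le_iff)
    then show ?thesis using B.prob_space by simp
  qed
  \<comment> \<open>Restricting to two coordinates reduces independence to the finite product
    formula, whose factors are centred.\<close>
  have XX0: "B.expectation (\<lambda>\<sigma>. X x \<sigma> * X y \<sigma>) = 0" if "x \<noteq> y" for x y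
  proof -
    have r: "(\<lambda>\<sigma>. restrict \<sigma> {x, y}) \<in> measurable ?B (PiM {x, y} (\<lambda>_. ?p))"
      unfolding bernoulli_field_def by (rule measurable_restrict_subset) simp
    have c: "(\<lambda>\<sigma>. \<sigma> z) \<in> measurable (PiM {x, y} (\<lambda>_. ?p)) (count_space UNIV)" if "z \<in> {x, y}" for z
      using measurable_component_singleton[OF that, of "\<lambda>_. ?p"] by simp
    have "B.expectation (\<lambda>\<sigma>. X x \<sigma> * X y \<sigma>) =
        B.expectation (\<lambda>\<sigma>. (\<Prod>z\<in>{x, y}. X z (restrict \<sigma> {x, y})))"
      using that by (simp add: X_def)
    also have "\<dots> = (\<integral>\<sigma>. (\<Prod>z\<in>{x, y}. of_bool (\<sigma> z) - \<zeta>) \<partial>distr ?B (PiM {x, y} (\<lambda>_. ?p)) (\<lambda>\<sigma>. restrict \<sigma> {x, y}))"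
      unfolding X_def
      by (rule integral_distr[symmetric, OF r])
         (intro borel_measurable_prod measurable_compose[OF c]; simp)
    also have "distr ?B (PiM {x, y} (\<lambda>_. ?p)) (\<lambda>\<sigma>. restrict \<sigma> {x, y}) = PiM {x, y} (\<lambda>_. ?p)"
      unfolding bernoulli_field_def by (rule P.distr_PiM_restrict_finite) auto
    also have "(\<integral>\<sigma>. (\<Prod>z\<in>{x, y}. of_bool (\<sigma> z) - \<zeta>) \<partial>PiM {x, y} (\<lambda>_. ?p)) =
        (\<Prod>z\<in>{x, y}. \<integral>s. of_bool s - \<zeta> \<partial>?p)"
      by (rule P.product_integral_prod) (auto intro: integrable_measure_pmf_finite)
    also have "(\<integral>s. of_bool s - \<zeta> \<partial>?p) = 0"
      using assms by (simp add: algebra_simps)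
    finally show ?thesis using that by simp
  qed
  have W2: "W \<sigma> ^ 2 = (\<Sum>x\<in>S. \<Sum>y\<in>S. a x * a y * (X x \<sigma> * X y \<sigma>))" for \<sigma>
    by (simp add: W_def power2_eq_square sum_product mult_ac)
  have W2i: "integrable ?B (\<lambda>\<sigma>. W \<sigma> ^ 2)" unfolding W2 using XXi by simp
  have "B.expectation (\<lambda>\<sigma>. W \<sigma> ^ 2) = (\<Sum>x\<in>S. \<Sum>y\<in>S. a x * a y * B.expectation (\<lambda>\<sigma>. X x \<sigma> * X y \<sigma>))"
    unfolding W2 using XXi by simp
  also have "\<dots> = (\<Sum>x\<in>S. \<Sum>y\<in>S. if y = x then a x ^ 2 * B.expectation (\<lambda>\<sigma>. X x \<sigma> * X x \<sigma>) else 0)"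
    by (intro sum.cong refl) (auto simp: XX0 power2_eq_square)
  also have "\<dots> = (\<Sum>x\<in>S. a x ^ 2 * B.expectation (\<lambda>\<sigma>. X x \<sigma> * X x \<sigma>))"
    using \<open>finite S\<close> by simp
  also have "\<dots> \<le> (\<Sum>x\<in>S. a x ^ 2 * 1)"
    by (intro sum_mono mult_left_mono) (use XX1 in auto)
  finally have E: "B.expectation (\<lambda>\<sigma>. W \<sigma> ^ 2) \<le> (\<Sum>x\<in>S. a x ^ 2)" by simp
  have Wm [measurable]: "W \<in> borel_measurable ?B" unfolding W_def by measurable
  have Q: "{\<sigma>. t \<le> \<bar>\<Sum>x\<in>S. a x * (of_bool (\<sigma> x) - \<zeta>)\<bar>} = {\<sigma>\<in>space ?B. t ^ 2 \<le> W \<sigma> ^ 2}"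
    using \<open>0 < t\<close> by (auto simp: W_def X_def abs_le_square_iff[symmetric])
  show "{\<sigma>. t \<le> \<bar>\<Sum>x\<in>S. a x * (of_bool (\<sigma> x) - \<zeta>)\<bar>} \<in> sets ?B" unfolding Q by measurable
  have "B.prob {\<sigma>\<in>space ?B. t ^ 2 \<le> W \<sigma> ^ 2} \<le> B.expectation (\<lambda>\<sigma>. W \<sigma> ^ 2) / t ^ 2"
    using \<open>0 < t\<close> W2i by (intro integral_Markov_inequality_measure[where A = "{}"]) auto
  also have "\<dots> \<le> (\<Sum>x\<in>S. a x ^ 2) / t ^ 2" using E by (intro divide_right_mono) auto
  finally show "B.prob {\<sigma>. t \<le> \<bar>\<Sum>x\<in>S. a x * (of_bool (\<sigma> x) - \<zeta>)\<bar>} \<le> (\<Sum>x\<in>S. a x ^ 2) / t ^ 2"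
    unfolding Q .
qed

section \<open>The outer bound\<close>

text \<open>If a particle reached \<open>r\<close>, all targets in \<open>[0, r)\<close> are filled.
  Anything at or left of \<open>-y\<close> would force the whole window \<open>(-y, r)\<close> to be
  filled, more than \<open>n\<close> particles together with the one at \<open>r\<close>. So all
  mass lies right of \<open>-y\<close>, and the sum of the positions is at least \<open>c\<close>,
  which the martingale bound makes unlikely.\<close>

lemma aggregate_shape:
  fixes \<sigma> \<eta> :: "int \<Rightarrow> nat"
  assumes total: "sum \<eta> {-r..r} = n" and settled: "\<And>x. x \<in> {-r<..<r} \<Longrightarrow> \<eta> x \<le> \<sigma> x"
    and fr: "filled_towards 1 0 {-r<..<r} \<sigma> \<eta>" and fl: "filled_towards (-1) 0 {-r<..<r} \<sigma> \<eta>"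
    and y: "0 < y" "y \<le> r" and exit: "\<eta> r \<ge> 1"
    and cnt: "n \<le> sum \<sigma> {-y<..<r}"
    and lin: "c \<le> (\<Sum>x\<in>{-y<..<r}. of_int (min x y) * real (\<sigma> x))"
  shows "c \<le> (\<Sum>x\<in>{-r..r}. of_int x * real (\<eta> x))"
proof -
  have right: "\<eta> x = \<sigma> x" if "0 \<le> x" "x < r" for x
    using fr[unfolded filled_towards_def, rule_format, of x r] settled[of x] that exit y
    by (simp add: antisym)
  have left: "\<eta> x = 0" if "x \<le> -y" for x
  proof (rule ccontr)
    assume "\<eta> x \<noteq> 0"
    have "\<sigma> z \<le> \<eta> z" if "z \<in> {-y<..<r}" for z
    proof (cases "0 \<le> z")
      case True
      then show ?thesis using right that by simp
    next
      case False
      then show ?thesis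
        using fl[unfolded filled_towards_def, rule_format, of z x] that \<open>\<eta> x \<noteq> 0\<close> \<open>x \<le> -y\<close> y by simp
    qed
    then have "sum \<sigma> {-y<..<r} \<le> sum \<eta> {-y<..<r}" by (rule sum_mono)
    moreover have "sum \<eta> {-y<..<r} + \<eta> r = sum \<eta> (insert r {-y<..<r})" by simp
    moreover have "\<dots> \<le> sum \<eta> {-r..r}" using y by (intro sum_mono2) auto
    ultimately show False using total cnt exit by linarith
  qed
  have "c \<le> (\<Sum>x\<in>{-y<..<r}. of_int x * real (\<eta> x))"
  proof (rule order_trans[OF lin], rule sum_mono)
    fix x assume x: "x \<in> {-y<..<r}"
    show "of_int (min x y) * real (\<sigma> x) \<le> of_int x * real (\<eta> x)"
    proof (cases "0 \<le> x")
      case True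
      then show ?thesis using right[of x] x by (auto intro: mult_right_mono)
    next
      case False
      then have "\<eta> x \<le> \<sigma> x" using settled[of x] x y by auto
      then show ?thesis using False y by (auto simp: min_def intro!: mult_left_mono_neg)
    qed
  qed
  also have "\<dots> \<le> (\<Sum>x\<in>insert r {-y<..<r}. of_int x * real (\<eta> x))"
    using y by simp
  also have "\<dots> = (\<Sum>x\<in>{-r..r}. of_int x * real (\<eta> x))"
  proof (rule sum.mono_neutral_left)
    show "\<forall>x\<in>{-r..r} - insert r {-y<..<r}. of_int x * real (\<eta> x) = 0"
    proof
      fix x assume "x \<in> {-r..r} - insert r {-y<..<r}"
      then show "of_int x * real (\<eta> x) = 0" using left[of x] by force
    qed
  qed (use y in auto)
  finally show ?thesis .
qed

lemma sum_reflect: "sum f {-b<..<a :: int} = (\<Sum>x\<in>{-a<..<b}. f (- x))"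
  by (rule sum.reindex_bij_witness[of _ uminus uminus]) auto

lemma sum_reflect_atLeastAtMost: "sum f {-a..a :: int} = (\<Sum>x\<in>{-a..a}. f (- x))"
  by (rule sum.reindex_bij_witness[of _ uminus uminus]) auto

lemma aggregate_shape_left:
  fixes \<sigma> \<eta> :: "int \<Rightarrow> nat"
  assumes total: "sum \<eta> {-r..r} = n" and settled: "\<And>x. x \<in> {-r<..<r} \<Longrightarrow> \<eta> x \<le> \<sigma> x"
    and fr: "filled_towards 1 0 {-r<..<r} \<sigma> \<eta>" and fl: "filled_towards (-1) 0 {-r<..<r} \<sigma> \<eta>"
    and y: "0 < y" "y \<le> r" and exit: "\<eta> (-r) \<ge> 1"
    and cnt: "n \<le> sum \<sigma> {-r<..<y}"
    and lin: "c \<le> (\<Sum>x\<in>{-r<..<y}. of_int (min (-x) y) * real (\<sigma> x))"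
  shows "(\<Sum>x\<in>{-r..r}. of_int x * real (\<eta> x)) \<le> - c"
proof -
  have "c \<le> (\<Sum>x\<in>{-r..r}. of_int x * real (\<eta> (- x)))"
  proof (rule aggregate_shape[where \<sigma> = "\<lambda>x. \<sigma> (- x)" and y = y])
    show "sum (\<lambda>x. \<eta> (- x)) {-r..r} = n" using total sum_reflect_atLeastAtMost[of \<eta> r] by simp
    show "filled_towards 1 0 {-r<..<r} (\<lambda>x. \<sigma> (- x)) (\<lambda>x. \<eta> (- x))"
      using fl unfolding filled_towards_def
      by (metis (no_types, lifting) diff_0_right greaterThanLessThan_iff minus_less_iff mult_minus1 mult_1 neg_less_iff_less add.inverse_inverse)
    show "filled_towards (- 1) 0 {-r<..<r} (\<lambda>x. \<sigma> (- x)) (\<lambda>x. \<eta> (- x))"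
      using fr unfolding filled_towards_def
      by (metis (no_types, lifting) diff_0_right greaterThanLessThan_iff minus_less_iff mult_minus1 mult_1 neg_less_iff_less add.inverse_inverse)
    show "n \<le> (\<Sum>x\<in>{-y<..<r}. \<sigma> (- x))" using cnt sum_reflect[of \<sigma> r y] by simp
    show "c \<le> (\<Sum>x\<in>{-y<..<r}. of_int (min x y) * real (\<sigma> (- x)))"
      using lin sum_reflect[of "\<lambda>x. of_int (min (-x) y) * real (\<sigma> x)" r y] by simp
  qed (use settled y exit in auto)
  also have "\<dots> = - (\<Sum>x\<in>{-r..r}. of_int x * real (\<eta> x))"
    using sum_reflect_atLeastAtMost[of "\<lambda>x. of_int x * real (\<eta> x)" r] by (simp add: sum_negf)
  finally show ?thesis by simp
qed

text \<open>\<open>T\<close> bounds the number of steps of the runs; the error terms with \<open>T\<close> vanish as \<open>T\<close> grows.\<close>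

definition contained :: "nat \<Rightarrow> int \<Rightarrow> int \<Rightarrow> nat \<Rightarrow> ennreal \<Rightarrow> (int \<Rightarrow> nat) \<Rightarrow> stacks \<Rightarrow> bool" where
  "contained T r m k lam \<sigma> \<rho> \<longleftrightarrow>
     odometer lam \<rho> (num_cfg \<sigma>) r \<le> enat k \<and> odometer lam \<rho> (num_cfg \<sigma>) (-r) \<le> enat k \<and>
     walk_out {-r-m-1<..<r+m+1} (run_cfg (walk_out {-r-m-1<..<r+m+1}) T
        (\<lambda>x. if \<bar>x\<bar> \<le> r + m then \<sigma> x else 0) \<rho>) = None \<and>
     walk_out {r<..<r+m} (run_cfg (walk_out {r<..<r+m}) T ((\<lambda>_. 0)(r+1 := k)) \<rho>) = None \<and>
     run_cfg (walk_out {r<..<r+m}) T ((\<lambda>_. 0)(r+1 := k)) \<rho> (r+m) = 0 \<and>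
     walk_out {-r-m<..<-r} (run_cfg (walk_out {-r-m<..<-r}) T ((\<lambda>_. 0)(-r-1 := k)) \<rho>) = None \<and>
     run_cfg (walk_out {-r-m<..<-r}) T ((\<lambda>_. 0)(-r-1 := k)) \<rho> (-r-m) = 0"

lemma walk_out_net:
  "net \<rho> \<eta> (run_odo (walk_out D) T \<eta> \<rho>) x = int (run_cfg (walk_out D) T \<eta> \<rho> x)"
  by (rule net_run) (use pick_Some in force)

lemma walk_out_odo_outside: "y \<notin> D \<Longrightarrow> run_odo (walk_out D) T \<eta> \<rho> y = 0"
  by (rule run_odo_outside[where D = D]) (use pick_Some in force)+

lemma stable_odo_walk_out:
  assumes "walk_out D (run_cfg (walk_out D) T \<eta> \<rho>) = None" "D \<subseteq> J"
    and "\<And>x. x \<in> J - D \<Longrightarrow> run_cfg (walk_out D) T \<eta> \<rho> x = 0"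
  shows "stable_odo lam J \<rho> \<eta> (run_odo (walk_out D) T \<eta> \<rho>)"
proof -
  have "run_cfg (walk_out D) T \<eta> \<rho> x = 0" if "x \<in> J" for x
    using assms that by (cases "x \<in> D") (auto simp: pick_None)
  moreover have "run_odo (walk_out D) T \<eta> \<rho> x = 0" if "x \<notin> J" for x
    using assms(2) that by (intro walk_out_odo_outside) auto
  ultimately show ?thesis by (auto simp: stable_odo_def act_def walk_out_net)
qed

text \<open>The least odometer \<open>u\<close> on the finite box is dominated by the odometer of
  \<sigma>, so at most \<open>k\<close> particles step out across each of \<open>r\<close> and
  \<open>-r\<close>. Beyond these sites \<open>u\<close> is bounded by walkers that return before
  distance \<open>m\<close>; hence nothing leaves the box, and \<open>u\<close> is stable on the
  whole line.\<close>

lemma contained_stable: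
  assumes G: "contained T r m k lam \<sigma> \<rho>" and "0 < r" "0 < m"
    and \<xi>: "\<And>x. \<xi> x \<le> \<sigma> x" "\<And>x. x \<notin> {-r<..<r} \<Longrightarrow> \<xi> x = 0"
  shows "\<exists>w. stable_odo lam UNIV \<rho> \<xi> w \<and> (\<forall>x. r + m < \<bar>x\<bar> \<longrightarrow> w x = 0)"
proof -
  let ?E = "{-r-m-1<..<r+m+1}"
  let ?\<eta> = "\<lambda>x. if \<bar>x\<bar> \<le> r + m then \<sigma> x else 0"
  have "stable_odo lam ?E \<rho> ?\<eta> (run_odo (walk_out ?E) T ?\<eta> \<rho>)"
    by (rule stable_odo_walk_out) (use G in \<open>auto simp: contained_def\<close>)
  then have "stable_odo lam ?E \<rho> \<xi> (run_odo (walk_out ?E) T ?\<eta> \<rho>)"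
    by (rule stable_odo_mono) (use \<xi> in auto)
  then obtain u where u: "min_odo lam ?E \<rho> \<xi> u" using min_odo_exists by blast
  have u0: "u x = 0" if "x \<notin> ?E" for x
    using min_odo_stable[OF u] that by (auto simp: stable_odo_def)
  have "{x. u x \<noteq> 0} \<subseteq> ?E"
  proof
    fix x assume "x \<in> {x. u x \<noteq> 0}"
    then show "x \<in> ?E" using u0[of x] by (cases "x \<in> ?E") simp_all
  qed
  then have fin: "finite {x. u x \<noteq> 0}" by (rule finite_subset) simp
  \<comment> \<open>The firings that stabilize \<xi> in the box are also legal from the larger
    \<sigma> on the whole line.\<close>
  obtain xs where xs: "legal lam \<rho> UNIV (num_cfg \<sigma>) xs" "count_list xs = u"
    using legal_reaches[OF u fin, of \<sigma> UNIV] \<xi> by auto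
  have "enat (u x) \<le> odometer lam \<rho> (num_cfg \<sigma>) x" for x
    unfolding odometer_def using xs by (intro SUP_upper2[of xs]) auto
  then have uk: "u r \<le> k" "u (-r) \<le> k"
    using G unfolding contained_def by (metis enat_ord_simps(1) order_trans)+
  \<comment> \<open>The comparison region contains \<open>r + m\<close>, but the walkers are stopped
    there and never fire it; that none of them sits there at the end makes their odometer
    stable.\<close>
  have right: "u (r + m) = 0"
  proof -
    let ?J = "{r+1..r+m}" and ?D = "{r<..<r+m}" and ?k = "(\<lambda>_. 0)(r+1 := k)"
    have "u (r + m) \<le> run_odo (walk_out ?D) T ?k \<rho> (r + m)"
    proof (rule min_odo_le_on[OF u, where J = ?J and v = "run_odo (walk_out ?D) T ?k \<rho>" and \<eta>' = ?k])
      show "stable_odo lam ?J \<rho> ?k (run_odo (walk_out ?D) T ?k \<rho>)"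
      proof (rule stable_odo_walk_out)
        fix x assume "x \<in> ?J - ?D"
        then have "x = r + m" by auto
        then show "run_cfg (walk_out ?D) T ?k \<rho> x = 0" using G by (simp add: contained_def)
      qed (use G in \<open>auto simp: contained_def\<close>)
      fix x assume x: "x \<in> ?J"
      have "u (x + 1) = 0" if "x + 1 \<notin> ?J" using that x by (intro u0) auto
      moreover have "x = r + 1" if "x - 1 \<notin> ?J" using that x by auto
      moreover have "cnt GoRight \<rho> r (u r) \<le> k" using cnt_le uk(1) by (rule order_trans)
      ultimately show "restr_cfg ?J \<rho> \<xi> u x \<le> ?k x"
        using \<xi>(2)[of x] x by (auto simp: restr_cfg_def)
    qed (use \<open>0 < m\<close> \<open>0 < r\<close> in auto)
    then show ?thesis using walk_out_odo_outside[of "r + m" ?D] by simp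
  qed
  have left: "u (- r - m) = 0"
  proof -
    let ?J = "{-r-m..-r-1}" and ?D = "{-r-m<..<-r}" and ?k = "(\<lambda>_. 0)(-r-1 := k)"
    have "u (-r-m) \<le> run_odo (walk_out ?D) T ?k \<rho> (-r-m)"
    proof (rule min_odo_le_on[OF u, where J = ?J and v = "run_odo (walk_out ?D) T ?k \<rho>" and \<eta>' = ?k])
      show "stable_odo lam ?J \<rho> ?k (run_odo (walk_out ?D) T ?k \<rho>)"
      proof (rule stable_odo_walk_out)
        fix x assume "x \<in> ?J - ?D"
        then have "x = -r-m" by auto
        then show "run_cfg (walk_out ?D) T ?k \<rho> x = 0" using G by (simp add: contained_def)
      qed (use G in \<open>auto simp: contained_def\<close>)
      fix x assume x: "x \<in> ?J"
      have "u (x - 1) = 0" if "x - 1 \<notin> ?J" using that x by (intro u0) auto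
      moreover have "x = -r-1" if "x + 1 \<notin> ?J" using that x by auto
      moreover have "cnt GoLeft \<rho> (-r) (u (-r)) \<le> k" using cnt_le uk(2) by (rule order_trans)
      ultimately show "restr_cfg ?J \<rho> \<xi> u x \<le> ?k x"
        using \<xi>(2)[of x] x by (auto simp: restr_cfg_def)
    qed (use \<open>0 < m\<close> \<open>0 < r\<close> in auto)
    then show ?thesis using walk_out_odo_outside[of "-r-m" ?D] by simp
  qed
  have "stable_odo lam UNIV \<rho> \<xi> u"
    unfolding stable_odo_def
  proof (intro conjI ballI allI impI)
    fix x
    show "\<not> act lam \<rho> \<xi> u x"
    proof (cases "x \<in> ?E")
      case True
      then show ?thesis using min_odo_stable[OF u] by (simp add: stable_odo_def)
    next
      case False
      have "u (x - 1) = 0" using u0[of "x - 1"] right False by (cases "x - 1 = r + m") auto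
      moreover have "u (x + 1) = 0" using u0[of "x + 1"] left False by (cases "x + 1 = -r-m") auto
      ultimately show ?thesis using u0[OF False] \<xi>(2)[of x] False \<open>0 < m\<close> by (auto simp: act_def net_def)
    qed
  qed simp
  moreover have "u x = 0" if "r + m < \<bar>x\<bar>" for x using that by (intro u0) auto
  ultimately show ?thesis by blast
qed

lemma walk_out_nonterm:
  assumes "D \<subseteq> {-L<..<L}" "T > 0"
  shows "outer_le lam {\<rho>. walk_out D (run_cfg (walk_out D) T \<eta> \<rho>) \<noteq> None}
    ((\<Sum>x\<in>{-L..L}. (of_int L ^ 2 - of_int x ^ 2) * real (\<eta> x)) / (2 * move_prob lam * T))"
  by (rule run_nonterm) (use assms pick_Some in force)+

text \<open>The constant \<open>A\<close> collects the truncation errors of the three runs and must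
  not depend on \<open>T\<close>, so that \<open>T\<close> can be chosen afterwards.\<close>

lemma contained_prob:
  assumes "0 < r" "0 < m" "0 < k" "0 \<le> C"
    and mom: "odo_moment lam r \<sigma> \<le> ennreal C" "odo_moment lam (-r) \<sigma> \<le> ennreal C"
  shows "\<exists>A\<ge>0. \<forall>T>0. outer_le lam {\<rho>. \<not> contained T r m k lam (occ \<sigma>) \<rho>}
    (2 * C / real k ^ 3 + 2 * real k / of_int m + A / T)"
proof -
  define L where "L = r + m + 1"
  define h where "h \<eta> = (\<Sum>x\<in>{-L..L}. (of_int L ^ 2 - of_int x ^ 2) * real (\<eta> x)) / (2 * move_prob lam)"
    for \<eta> :: "int \<Rightarrow> nat"
  let ?E = "{-r-m-1<..<r+m+1}" and ?R = "{r<..<r+m}" and ?L = "{-r-m<..<-r}"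
  let ?\<eta> = "\<lambda>x. if \<bar>x\<bar> \<le> r + m then occ \<sigma> x else 0"
  let ?kR = "(\<lambda>_. 0 :: nat)(r+1 := k)" and ?kL = "(\<lambda>_. 0 :: nat)(-r-1 := k)"
  define A where "A = \<bar>h ?\<eta>\<bar> + \<bar>h ?kR\<bar> + \<bar>h ?kL\<bar>"
  have nt: "outer_le lam {\<rho>. walk_out D (run_cfg (walk_out D) T \<eta> \<rho>) \<noteq> None} (\<bar>h \<eta>\<bar> / T)"
    if "D \<subseteq> {-L<..<L}" "T > 0" for D T \<eta>
  proof (rule outer_le_mono[OF walk_out_nonterm[OF that]])
    have "(\<Sum>x\<in>{-L..L}. (of_int L ^ 2 - of_int x ^ 2) * real (\<eta> x)) / (2 * move_prob lam * T) = h \<eta> / T"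
      by (simp add: h_def)
    also have "\<dots> \<le> \<bar>h \<eta>\<bar> / T" using \<open>T > 0\<close> by (intro divide_right_mono) auto
    finally show "(\<Sum>x\<in>{-L..L}. (of_int L ^ 2 - of_int x ^ 2) * real (\<eta> x)) / (2 * move_prob lam * T) \<le> \<bar>h \<eta>\<bar> / T" .
  qed simp
  have "outer_le lam {\<rho>. \<not> contained T r m k lam (occ \<sigma>) \<rho>}
    (2 * C / real k ^ 3 + 2 * real k / of_int m + A / T)" if T: "T > 0" for T
  proof -
    have hitR: "outer_le lam {\<rho>. run_cfg (walk_out ?R) T ?kR \<rho> (r+m) \<ge> 1} (real k / of_int m)"
    proof (rule outer_le_mono[OF walk_out_hit[where h = "\<lambda>x. of_int (x - r)" and T = T and \<eta> = ?kR]])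
      show "(\<Sum>x\<in>{r..r+m}. of_int (x - r) * real (?kR x)) / of_int (r + m - r) \<le> real k / of_int m"
        using \<open>0 < m\<close> by (simp add: fun_upd_def if_distrib[of "\<lambda>y. _ * real y"] cong: if_cong)
    qed (use \<open>0 < m\<close> in auto)
    have hitL: "outer_le lam {\<rho>. run_cfg (walk_out ?L) T ?kL \<rho> (-r-m) \<ge> 1} (real k / of_int m)"
    proof (rule outer_le_mono[OF walk_out_hit[where h = "\<lambda>x. of_int (- r - x)" and T = T and \<eta> = ?kL]])
      show "(\<Sum>x\<in>{-r-m..-r}. of_int (-r-x) * real (?kL x)) / of_int (-r - (-r-m)) \<le> real k / of_int m"
        using \<open>0 < m\<close> by (simp add: fun_upd_def if_distrib[of "\<lambda>y. _ * real y"] cong: if_cong)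
    qed (use \<open>0 < m\<close> in auto)
    let ?bad = "{\<rho>. \<not> odometer lam \<rho> (num_cfg (occ \<sigma>)) r \<le> enat k} \<union>
        {\<rho>. \<not> odometer lam \<rho> (num_cfg (occ \<sigma>)) (-r) \<le> enat k} \<union>
        {\<rho>. walk_out ?E (run_cfg (walk_out ?E) T ?\<eta> \<rho>) \<noteq> None} \<union>
        {\<rho>. walk_out ?R (run_cfg (walk_out ?R) T ?kR \<rho>) \<noteq> None} \<union>
        {\<rho>. run_cfg (walk_out ?R) T ?kR \<rho> (r+m) \<ge> 1} \<union>
        {\<rho>. walk_out ?L (run_cfg (walk_out ?L) T ?kL \<rho>) \<noteq> None} \<union>
        {\<rho>. run_cfg (walk_out ?L) T ?kL \<rho> (-r-m) \<ge> 1}"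
    have "outer_le lam ?bad (C / real k ^ 3 + C / real k ^ 3 + \<bar>h ?\<eta>\<bar> / T + \<bar>h ?kR\<bar> / T
        + real k / of_int m + \<bar>h ?kL\<bar> / T + real k / of_int m)"
      using assms T
      by (intro outer_le_Un odometer_tail nt hitR hitL) (auto simp: L_def)
    then show ?thesis
    proof (rule outer_le_mono)
      show "{\<rho>. \<not> contained T r m k lam (occ \<sigma>) \<rho>} \<subseteq> ?bad"
      proof
        fix \<rho> assume a: "\<rho> \<in> {\<rho>. \<not> contained T r m k lam (occ \<sigma>) \<rho>}"
        show "\<rho> \<in> ?bad" using a by (auto simp: contained_def Suc_le_eq)
      qed
    qed (simp add: A_def add_divide_distrib)
  qed
  then show ?thesis by (intro exI[of _ A]) (auto simp: A_def)
qed

lemma outer_stage: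
  assumes "0 < m" "0 < k" "0 \<le> C" "0 < y" "y \<le> r" "0 < c" "0 < \<delta>"
    and mom: "odo_moment lam r \<sigma> \<le> ennreal C" "odo_moment lam (-r) \<sigma> \<le> ennreal C"
    and cntR: "n \<le> sum (occ \<sigma>) {-y<..<r}"
    and linR: "c \<le> (\<Sum>x\<in>{-y<..<r}. of_int (min x y) * real (occ \<sigma> x))"
    and cntL: "n \<le> sum (occ \<sigma>) {-r<..<y}"
    and linL: "c \<le> (\<Sum>x\<in>{-r<..<y}. of_int (min (-x) y) * real (occ \<sigma> x))"
  shows "outer_le lam {\<rho>. \<not> (\<exists>v. stable_odo lam UNIV \<rho> ((\<lambda>_. 0)(0 := n)) v \<and> (\<forall>x. r + m < \<bar>x\<bar> \<longrightarrow> v x = 0))}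
    (real n * of_int r ^ 2 / c ^ 2 + 2 * C / real k ^ 3 + 2 * real k / of_int m + \<delta>)"
proof -
  have r: "0 < r" using assms by simp
  let ?D = "{-r<..<r}" and ?s = "(\<lambda>_. 0)(0 := n)"
  let ?sel = "aggregate ?D (occ \<sigma>)"
  obtain A where A: "A \<ge> 0" "\<And>T. T > 0 \<Longrightarrow> outer_le lam {\<rho>. \<not> contained T r m k lam (occ \<sigma>) \<rho>}
    (2 * C / real k ^ 3 + 2 * real k / of_int m + A / T)"
    using contained_prob[OF r assms(1-3) mom] by blast
  define H where "H = \<bar>(\<Sum>x\<in>{-r..r}. (of_int r ^ 2 - of_int x ^ 2) * real (?s x)) / (2 * move_prob lam)\<bar>"
  \<comment> \<open>Large enough for both truncation errors together to stay below \<delta>.\<close>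
  define T where "T = Suc (nat \<lceil>(A + H) / \<delta>\<rceil>)"
  have T: "T > 0" by (simp add: T_def)
  have "(A + H) / \<delta> \<le> T" unfolding T_def by linarith
  then have TH: "(A + H) / T \<le> \<delta>" using T \<open>0 < \<delta>\<close> by (simp add: field_simps)
  let ?e = "2 * C / real k ^ 3 + 2 * real k / of_int m + A / T"
  let ?N = "{\<rho>. ?sel (run_cfg ?sel T ?s \<rho>) \<noteq> None}"
  let ?B = "{\<rho>. ?sel (run_cfg ?sel T ?s \<rho>) = None \<and>
     \<not> contained T r m k lam (occ \<sigma>) (advance (run_odo ?sel T ?s \<rho>) \<rho>)}"
  let ?Q = "{\<rho>. c \<le> \<bar>\<Sum>x\<in>{-r..r}. of_int x * real (run_cfg ?sel T ?s \<rho> x)\<bar>}"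
  have e0: "0 \<le> ?e" using A(2)[OF T] by (rule outer_le_nonneg)
  have N: "outer_le lam ?N (H / T)"
  proof (rule outer_le_mono[OF run_nonterm[where L = r and T = T and \<eta> = ?s and sel = ?sel]])
    fix \<eta> x assume "?sel \<eta> = Some x"
    from pick_Some[OF this] show "\<bar>x\<bar> < r \<and> 1 \<le> \<eta> x" by auto
  next
    have "(\<Sum>x\<in>{-r..r}. (of_int r ^ 2 - of_int x ^ 2) * real (?s x)) / (2 * move_prob lam * T) =
       (\<Sum>x\<in>{-r..r}. (of_int r ^ 2 - of_int x ^ 2) * real (?s x)) / (2 * move_prob lam) / T" by simp
    also have "\<dots> \<le> H / T" unfolding H_def using T by (intro divide_right_mono abs_ge_self) auto
    finally show "(\<Sum>x\<in>{-r..r}. (of_int r ^ 2 - of_int x ^ 2) * real (?s x)) / (2 * move_prob lam * T) \<le> H / T" .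
  qed (use T in auto)
  have B: "outer_le lam ?B ?e"
    by (rule run_terminal[where Inv = "\<lambda>_. True" and \<Phi> = "\<lambda>_. ?e" and B = "\<lambda>_ \<rho>. \<not> contained T r m k lam (occ \<sigma>) \<rho>"])
       (use A(2)[OF T] e0 in auto)
  have Q: "outer_le lam ?Q (real n * of_int r ^ 2 / c ^ 2)"
    by (rule aggregate_center) (use assms in auto)
  have "outer_le lam (?N \<union> ?B \<union> ?Q) (H / T + ?e + real n * of_int r ^ 2 / c ^ 2)"
    by (intro outer_le_Un N B Q)
  then show ?thesis
  proof (rule outer_le_mono)
    show "H / T + ?e + real n * of_int r ^ 2 / c ^ 2 \<le>
      real n * of_int r ^ 2 / c ^ 2 + 2 * C / real k ^ 3 + 2 * real k / of_int m + \<delta>"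
      using TH by (simp add: add_divide_distrib)
    show "{\<rho>. \<not> (\<exists>v. stable_odo lam UNIV \<rho> ?s v \<and> (\<forall>x. r + m < \<bar>x\<bar> \<longrightarrow> v x = 0))} \<subseteq> ?N \<union> ?B \<union> ?Q"
    proof (rule ccontr)
      assume "\<not> ?thesis"
      then obtain \<rho> where no: "\<not> (\<exists>v. stable_odo lam UNIV \<rho> ?s v \<and> (\<forall>x. r + m < \<bar>x\<bar> \<longrightarrow> v x = 0))"
        and \<rho>: "\<rho> \<notin> ?N" "\<rho> \<notin> ?B" "\<rho> \<notin> ?Q" by blast
      define \<eta> where "\<eta> = run_cfg ?sel T ?s \<rho>"
      define v where "v = run_odo ?sel T ?s \<rho>"
      have settled_run: "?sel \<eta> = None" using \<rho>(1) by (simp add: \<eta>_def)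
      have G: "contained T r m k lam (occ \<sigma>) (advance v \<rho>)"
        using \<rho>(2) settled_run by (simp add: \<eta>_def v_def)
      have q: "\<bar>\<Sum>x\<in>{-r..r}. of_int x * real (\<eta> x)\<bar> < c" using \<rho>(3) by (simp add: \<eta>_def)
      have inv: "filled_towards s 0 ?D (occ \<sigma>) \<eta>" if "s = 1 \<or> s = -1" for s
        unfolding \<eta>_def
      proof (rule run_inv[where P = "filled_towards s 0 ?D (occ \<sigma>)"])
        fix \<eta> x i assume "filled_towards s 0 ?D (occ \<sigma>) \<eta>" "?sel \<eta> = Some x"
        then show "filled_towards s 0 ?D (occ \<sigma>) (fire_cfg x i \<eta>)"
          using pick_Some that by (intro filled_towards_fire) force+
      qed (rule filled_towards_start)
      let ?P = "\<lambda>\<eta>. sum \<eta> {-r..r} = n \<and> (\<forall>x. x \<notin> {-r..r} \<longrightarrow> \<eta> x = 0)"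
      have P: "?P \<eta>"
        unfolding \<eta>_def
      proof (rule run_inv[where P = ?P])
        show "?P ?s" using r by (simp add: fun_upd_def)
        fix \<eta> x i assume p: "?P \<eta>" "?sel \<eta> = Some x"
        from pick_Some[OF p(2)] have x: "-r < x" "x < r" "1 \<le> \<eta> x" by auto
        have "fire_cfg x i \<eta> z = 0" if "z \<notin> {-r..r}" for z
          using p that x by (cases i) (auto simp: mv_def)
        then show "?P (fire_cfg x i \<eta>)" using p x by (subst sum_fire_cfg) auto
      qed
      have settled: "\<eta> x \<le> occ \<sigma> x" if "x \<in> ?D" for x
        using settled_run that unfolding pick_None by (meson not_less)
      have "\<eta> r = 0"
      proof (rule ccontr)
        assume "\<eta> r \<noteq> 0"
        then have "c \<le> (\<Sum>x\<in>{-r..r}. of_int x * real (\<eta> x))"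
          using P settled inv cntR linR assms by (intro aggregate_shape[of \<eta> r n "occ \<sigma>" y c]) auto
        then show False using q by linarith
      qed
      moreover have "\<eta> (-r) = 0"
      proof (rule ccontr)
        assume "\<eta> (-r) \<noteq> 0"
        then have "(\<Sum>x\<in>{-r..r}. of_int x * real (\<eta> x)) \<le> - c"
          using P settled inv cntL linL assms by (intro aggregate_shape_left[of \<eta> r n "occ \<sigma>" y c]) auto
        then show False using q by linarith
      qed
      ultimately have out: "\<eta> x = 0" if "x \<notin> ?D" for x
        using P that by (cases "x = r \<or> x = -r") auto
      have le: "\<eta> x \<le> occ \<sigma> x" for x
        using settled[of x] out[of x] by (cases "x \<in> ?D") auto
      obtain w where w: "stable_odo lam UNIV (advance v \<rho>) \<eta> w" "\<And>x. r + m < \<bar>x\<bar> \<Longrightarrow> w x = 0"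
        using contained_stable[OF G r \<open>0 < m\<close> le out] by blast
      have "net \<rho> ?s v x = int (\<eta> x)" for x
        unfolding v_def \<eta>_def by (rule net_run) (use pick_Some in force)
      then have "stable_odo lam UNIV \<rho> ?s (\<lambda>x. v x + w x)"
        using w(1) by (intro stable_odo_advance) auto
      moreover have "v x = 0" if "r + m < \<bar>x\<bar>" for x
        unfolding v_def by (rule run_odo_outside[where D = ?D]) (use pick_Some that \<open>0 < m\<close> in force)+
      ultimately show False using no w(2) by auto
    qed
  qed
qed

section \<open>A Bernoulli configuration with enough targets, first moment and tame
  odometers\<close>

lemma sum_min_window:
  assumes "0 < y" "y \<le> r"
  shows "(\<Sum>x\<in>{-y<..<r}. min x y) = y * (r - y :: int)"
proof -
  have "(\<Sum>x\<in>{-y<..<y}. x) = (\<Sum>x\<in>{-y<..<y}. - x)" by (rule sum_reflect)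
  then have 0: "(\<Sum>x\<in>{-y<..<y}. x) = 0" by (simp add: sum_negf)
  have split: "{-y<..<r} = {-y<..<y} \<union> {y..<r}" using assms by auto
  have "(\<Sum>x\<in>{-y<..<r}. min x y) = (\<Sum>x\<in>{-y<..<y}. min x y) + (\<Sum>x\<in>{y..<r}. min x y)"
    unfolding split by (rule sum.union_disjoint) auto
  also have "(\<Sum>x\<in>{-y<..<y}. min x y) = (\<Sum>x\<in>{-y<..<y}. x)" by (intro sum.cong) auto
  also have "(\<Sum>x\<in>{y..<r}. min x y) = (\<Sum>x\<in>{y..<r}. y)" by (intro sum.cong) auto
  finally show ?thesis using 0 assms by (simp add: algebra_simps)
qed

lemma bernoulli_lower_tail:
  fixes a :: "int \<Rightarrow> real"
  assumes "finite S" "0 \<le> \<zeta>" "\<zeta> \<le> 1" "0 < t"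
    and "l + t \<le> \<zeta> * sum a S" "(\<Sum>x\<in>S. a x ^ 2) \<le> V"
  shows "\<exists>M\<in>sets (bernoulli_field \<zeta>). {\<sigma>. (\<Sum>x\<in>S. a x * real (occ \<sigma> x)) < l} \<subseteq> M \<and>
    measure (bernoulli_field \<zeta>) M \<le> V / t ^ 2"
proof (intro bexI conjI)
  let ?M = "{\<sigma>. t \<le> \<bar>\<Sum>x\<in>S. a x * (of_bool (\<sigma> x) - \<zeta>)\<bar>}"
  show "?M \<in> sets (bernoulli_field \<zeta>)" using assms by (intro bernoulli_linear_tail)
  have "measure (bernoulli_field \<zeta>) ?M \<le> (\<Sum>x\<in>S. a x ^ 2) / t ^ 2"
    using assms by (intro bernoulli_linear_tail)
  also have "\<dots> \<le> V / t ^ 2" using assms by (intro divide_right_mono) auto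
  finally show "measure (bernoulli_field \<zeta>) ?M \<le> V / t ^ 2" .
  show "{\<sigma>. (\<Sum>x\<in>S. a x * real (occ \<sigma> x)) < l} \<subseteq> ?M"
  proof safe
    fix \<sigma> assume "(\<Sum>x\<in>S. a x * real (occ \<sigma> x)) < l"
    moreover have "(\<Sum>x\<in>S. a x * (of_bool (\<sigma> x) - \<zeta>)) = (\<Sum>x\<in>S. a x * real (occ \<sigma> x)) - \<zeta> * sum a S"
    proof -
      have "a x * (of_bool (\<sigma> x) - \<zeta>) = a x * real (occ \<sigma> x) - \<zeta> * a x" for x
        by (simp add: algebra_simps)
      then show ?thesis by (simp only: sum_subtractf sum_distrib_left)
    qed
    ultimately show "t \<le> \<bar>\<Sum>x\<in>S. a x * (of_bool (\<sigma> x) - \<zeta>)\<bar>" using assms(5) by linarith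
  qed
qed

lemma odo_moment_markov:
  assumes "outer_moment lam \<zeta> < \<infinity>"
  shows "\<exists>M\<in>sets (bernoulli_field \<zeta>).
    {\<sigma>. \<not> odo_moment lam b \<sigma> \<le> ennreal (8 * (enn2real (outer_moment lam \<zeta>) + 1))} \<subseteq> M \<and>
    measure (bernoulli_field \<zeta>) M \<le> 1 / 8"
proof -
  interpret B: prob_space "bernoulli_field \<zeta>" by (rule prob_space_bernoulli)
  define C where "C = enn2real (outer_moment lam \<zeta>)"
  have C: "outer_moment lam \<zeta> = ennreal C" "0 \<le> C" using assms by (auto simp: C_def)
  note [measurable] = odo_moment_measurable[where lam = lam and b = b and \<zeta> = \<zeta>]
  let ?M = "{\<sigma>\<in>space (bernoulli_field \<zeta>). 1 \<le> ennreal (1 / (8 * (C + 1))) * odo_moment lam b \<sigma>}"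
  have m: "?M \<in> sets (bernoulli_field \<zeta>)" by measurable
  have "emeasure (bernoulli_field \<zeta>) ?M \<le> ennreal (1 / (8 * (C + 1))) *
     (\<integral>\<^sup>+\<sigma>. odo_moment lam b \<sigma> * indicator (space (bernoulli_field \<zeta>)) \<sigma> \<partial>bernoulli_field \<zeta>)"
    using sets.top[of "bernoulli_field \<zeta>"] by (intro nn_integral_Markov_inequality) auto
  also have "\<dots> = ennreal (1 / (8 * (C + 1))) * ennreal C"
    using odo_moment_integral[where lam = lam and b = b and \<zeta> = \<zeta>] C by simp
  also have "\<dots> = ennreal (C / (8 * (C + 1)))"
    using C by (simp add: ennreal_mult[symmetric])
  also have "\<dots> \<le> ennreal (1 / 8)" using C by (intro ennreal_leI) (simp add: field_simps)
  finally have "B.prob ?M \<le> 1 / 8" by (simp add: B.emeasure_eq_measure ennreal_le_iff)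
  moreover have "{\<sigma>. \<not> odo_moment lam b \<sigma> \<le> ennreal (8 * (C + 1))} \<subseteq> ?M"
  proof safe
    fix \<sigma> assume "\<not> odo_moment lam b \<sigma> \<le> ennreal (8 * (C + 1))"
    then have "ennreal (1 / (8 * (C + 1))) * ennreal (8 * (C + 1)) \<le> ennreal (1 / (8 * (C + 1))) * odo_moment lam b \<sigma>"
      by (intro mult_left_mono) auto
    moreover have "ennreal (1 / (8 * (C + 1))) * ennreal (8 * (C + 1)) = ennreal (1 / (8 * (C + 1)) * (8 * (C + 1)))"
      by (rule ennreal_mult[symmetric]) (use C in auto)
    moreover have "1 / (8 * (C + 1)) * (8 * (C + 1)) = 1" using C by simp
    ultimately show "1 \<le> ennreal (1 / (8 * (C + 1))) * odo_moment lam b \<sigma>" by (simp only: ennreal_1)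
  qed simp
  ultimately show ?thesis using m unfolding C_def by blast
qed

text \<open>Six requirements on \<sigma>, each violated with probability at most 1/8, leave some
  \<sigma> that satisfies all of them. The factor 8 in the moment bound comes from this
  count.\<close>

lemma choose_targets:
  assumes \<zeta>: "0 < \<zeta>" "\<zeta> < 1" and fin: "outer_moment lam \<zeta> < \<infinity>" and \<epsilon>: "0 < \<epsilon>"
    and a: "a = (1 + \<epsilon>) / (2 * \<zeta>) + 1"
    and r: "r = \<lceil>(1 + \<epsilon>) * real n / (2 * \<zeta>)\<rceil>" and y: "y = \<lceil>real n / (2 * \<zeta>)\<rceil>"
    and n: "n > 0" "real n > 8 * \<zeta> / \<epsilon>" "real n > 256 * a / \<epsilon> ^ 2" "real n > 8 * 512 * a ^ 3 * \<zeta> ^ 2 / \<epsilon> ^ 2"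
  obtains \<sigma> where
    "odo_moment lam r \<sigma> \<le> ennreal (8 * (enn2real (outer_moment lam \<zeta>) + 1))"
    "odo_moment lam (-r) \<sigma> \<le> ennreal (8 * (enn2real (outer_moment lam \<zeta>) + 1))"
    "n \<le> sum (occ \<sigma>) {-y<..<r}"
    "\<epsilon> * real n ^ 2 / (16 * \<zeta>) \<le> (\<Sum>x\<in>{-y<..<r}. of_int (min x y) * real (occ \<sigma> x))"
    "n \<le> sum (occ \<sigma>) {-r<..<y}"
    "\<epsilon> * real n ^ 2 / (16 * \<zeta>) \<le> (\<Sum>x\<in>{-r<..<y}. of_int (min (-x) y) * real (occ \<sigma> x))"
proof -
  interpret B: prob_space "bernoulli_field \<zeta>" by (rule prob_space_bernoulli)
  define N where "N = real n"
  have N: "N \<ge> 1" "N > 8 * \<zeta> / \<epsilon>" "N > 256 * a / \<epsilon> ^ 2" "N > 8 * 512 * a ^ 3 * \<zeta> ^ 2 / \<epsilon> ^ 2"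
    using n by (auto simp: N_def)
  have a0: "a > 0" using \<zeta> \<epsilon> a by (simp add: add_pos_pos)
  have y0: "0 < y" using \<zeta> n y by simp
  have yr: "y \<le> r" unfolding y r using \<zeta> \<epsilon> by (intro ceiling_mono divide_right_mono)
      (use mult_right_mono[of 1 "1 + \<epsilon>" "real n"] in auto)
  have rl: "of_int r \<ge> (1 + \<epsilon>) * N / (2 * \<zeta>)" and ru: "of_int r \<le> (1 + \<epsilon>) * N / (2 * \<zeta>) + 1"
    and yl: "of_int y \<ge> N / (2 * \<zeta>)" and yu: "of_int y \<le> N / (2 * \<zeta>) + 1"
    unfolding r y N_def by linarith+
  have ra: "of_int r \<le> a * N"
    using ru N(1) unfolding a by (simp add: field_simps) 
  have cardS: "real (card {-y<..<r}) \<le> 2 * a * N" "real (card {-y<..<r}) = of_int (y + r - 1)"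
  proof -
    show 1: "real (card {-y<..<r}) = of_int (y + r - 1)" using y0 yr by simp
    have "of_int (y + r - 1) \<le> (2 * of_int r :: real)" using yr by simp
    then show "real (card {-y<..<r}) \<le> 2 * a * N" using ra 1 by linarith
  qed
  have eN: "\<zeta> \<le> \<epsilon> * N / 8" using N(2) \<epsilon> by (simp add: field_simps)
  have cardM: "N + \<epsilon> * N / 4 \<le> \<zeta> * real (card {-y<..<r})"
  proof -
    have "\<zeta> * ((1 + \<epsilon>) * N / (2 * \<zeta>) + N / (2 * \<zeta>) - 1) \<le> \<zeta> * of_int (y + r - 1)"
      using rl yl \<zeta> by (intro mult_left_mono) auto
    moreover have "\<zeta> * ((1 + \<epsilon>) * N / (2 * \<zeta>) + N / (2 * \<zeta>) - 1) = N + \<epsilon> * N / 2 - \<zeta>"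
      using \<zeta> by (simp add: field_simps)
    moreover have "\<zeta> * of_int (y + r - 1) = \<zeta> * real (card {-y<..<r})" using cardS(2) by simp
    ultimately have "N + \<epsilon> * N / 2 - \<zeta> \<le> \<zeta> * real (card {-y<..<r})" by metis
    then show ?thesis using eN \<zeta>(1) by linarith
  qed
  \<comment> \<open>Chebyshev for the number of targets in the window: at most
    \<open>2 * a * N\<close> sites, deviation \<open>\<epsilon> * N / 4\<close>, which is the
    surplus of the mean over \<open>N\<close> from \<open>cardM\<close>.\<close>
  have v1: "2 * a * N / (\<epsilon> * N / 4) ^ 2 < 1 / 8"
  proof -
    have "2 * a * N / (\<epsilon> * N / 4) ^ 2 = 32 * a / (\<epsilon> ^ 2 * N)"
      using N(1) \<epsilon> by (simp add: power2_eq_square field_simps)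
    also have "\<dots> < 1 / 8" using N(1,3) \<epsilon> by (simp add: field_simps)
    finally show ?thesis .
  qed
  let ?c = "\<epsilon> * N ^ 2 / (16 * \<zeta>)"
  have v2: "2 * a ^ 3 * N ^ 3 / ?c ^ 2 < 1 / 8"
  proof -
    have "2 * a ^ 3 * N ^ 3 / ?c ^ 2 = 512 * a ^ 3 * \<zeta> ^ 2 / (\<epsilon> ^ 2 * N)"
      using N(1) \<epsilon> \<zeta> by (simp add: power2_eq_square power3_eq_cube field_simps)
    also have "\<dots> < 1 / 8" using N(1,4) \<epsilon> by (simp add: field_simps)
    finally show ?thesis .
  qed
  \<comment> \<open>The mean of the weighted sum is twice the threshold, so that half of it serves
    as the deviation in Chebyshev's inequality.\<close>
  have meanL: "?c + ?c \<le> \<zeta> * of_int (y * (r - y))"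
  proof -
    have ry: "of_int (r - y) \<ge> \<epsilon> * N / (2 * \<zeta>) - 1"
    proof -
      have "(1 + \<epsilon>) * N / (2 * \<zeta>) = N / (2 * \<zeta>) + \<epsilon> * N / (2 * \<zeta>)"
        by (simp add: add_divide_distrib[symmetric] algebra_simps)
      then show ?thesis using rl yu by simp
    qed
    have "\<epsilon> * N / (4 * \<zeta>) \<le> \<epsilon> * N / (2 * \<zeta>) - 1" using eN \<zeta> by (simp add: field_simps)
    then have "\<epsilon> * N / (4 * \<zeta>) \<le> of_int (r - y)" using ry by linarith
    then have "N / (2 * \<zeta>) * (\<epsilon> * N / (4 * \<zeta>)) \<le> of_int y * of_int (r - y)"
      using yl N(1) \<epsilon> \<zeta> y0 by (intro mult_mono) auto
    then have "\<zeta> * (N / (2 * \<zeta>) * (\<epsilon> * N / (4 * \<zeta>))) \<le> \<zeta> * (of_int y * of_int (r - y))"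
      using \<zeta> by (intro mult_left_mono) auto
    moreover have "\<zeta> * (N / (2 * \<zeta>) * (\<epsilon> * N / (4 * \<zeta>))) = ?c + ?c"
      using \<zeta> by (simp add: field_simps power2_eq_square)
    ultimately show ?thesis by simp
  qed
  have sq: "(\<Sum>x\<in>S. (of_int (f x) :: real) ^ 2) \<le> 2 * a ^ 3 * N ^ 3"
    if S: "real (card S) \<le> 2 * a * N" and f: "\<And>x. x \<in> S \<Longrightarrow> \<bar>f x\<bar> \<le> r" for S :: "int set" and f
  proof -
    have "(\<Sum>x\<in>S. (of_int (f x) :: real) ^ 2) \<le> (\<Sum>x\<in>S. (a * N) ^ 2)"
    proof (rule sum_mono)
      fix x assume "x \<in> S"
      then have "\<bar>of_int (f x) :: real\<bar> \<le> a * N" using f[of x] ra by linarith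
      then show "(of_int (f x) :: real) ^ 2 \<le> (a * N) ^ 2" by (metis abs_ge_zero power2_abs power_mono)
    qed
    also have "\<dots> = real (card S) * (a * N) ^ 2" by simp
    also have "\<dots> \<le> 2 * a * N * (a * N) ^ 2" using S by (intro mult_right_mono) auto
    finally show ?thesis by (simp add: power2_eq_square power3_eq_cube mult_ac)
  qed
  have cardS': "card {-r<..<y} = card {-y<..<r}" by simp
  obtain M1 where M1: "M1 \<in> B.events" "{\<sigma>. \<not> odo_moment lam r \<sigma> \<le> ennreal (8 * (enn2real (outer_moment lam \<zeta>) + 1))} \<subseteq> M1"
    "B.prob M1 \<le> 1 / 8" using odo_moment_markov[OF fin, of r] by blast
  obtain M2 where M2: "M2 \<in> B.events" "{\<sigma>. \<not> odo_moment lam (-r) \<sigma> \<le> ennreal (8 * (enn2real (outer_moment lam \<zeta>) + 1))} \<subseteq> M2"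
    "B.prob M2 \<le> 1 / 8" using odo_moment_markov[OF fin, of "-r"] by blast
  have "\<exists>M\<in>B.events. {\<sigma>. (\<Sum>x\<in>{-y<..<r}. 1 * real (occ \<sigma> x)) < N} \<subseteq> M \<and> B.prob M \<le> 2 * a * N / (\<epsilon> * N / 4) ^ 2"
    using \<zeta> cardM cardS(1) \<epsilon> N(1) by (intro bernoulli_lower_tail) auto
  then obtain M3 where M3: "M3 \<in> B.events" "{\<sigma>. (\<Sum>x\<in>{-y<..<r}. 1 * real (occ \<sigma> x)) < N} \<subseteq> M3" "B.prob M3 < 1 / 8"
    using v1 by (meson order.strict_trans1)
  have "\<exists>M\<in>B.events. {\<sigma>. (\<Sum>x\<in>{-r<..<y}. 1 * real (occ \<sigma> x)) < N} \<subseteq> M \<and> B.prob M \<le> 2 * a * N / (\<epsilon> * N / 4) ^ 2"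
    using \<zeta> cardM cardS(1) \<epsilon> N(1) cardS' by (intro bernoulli_lower_tail) auto
  then obtain M4 where M4: "M4 \<in> B.events" "{\<sigma>. (\<Sum>x\<in>{-r<..<y}. 1 * real (occ \<sigma> x)) < N} \<subseteq> M4" "B.prob M4 < 1 / 8"
    using v1 by (meson order.strict_trans1)
  have "\<exists>M\<in>B.events. {\<sigma>. (\<Sum>x\<in>{-y<..<r}. of_int (min x y) * real (occ \<sigma> x)) < ?c} \<subseteq> M \<and> B.prob M \<le> 2 * a ^ 3 * N ^ 3 / ?c ^ 2"
  proof (rule bernoulli_lower_tail)
    show "?c + ?c \<le> \<zeta> * (\<Sum>x\<in>{-y<..<r}. of_int (min x y))"
      using meanL unfolding of_int_sum[symmetric] sum_min_window[OF y0 yr] .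
    show "(\<Sum>x\<in>{-y<..<r}. (of_int (min x y) :: real) ^ 2) \<le> 2 * a ^ 3 * N ^ 3"
      using yr y0 cardS(1) by (intro sq) auto
  qed (use \<zeta> \<epsilon> N in auto)
  then obtain M5 where M5: "M5 \<in> B.events" "{\<sigma>. (\<Sum>x\<in>{-y<..<r}. of_int (min x y) * real (occ \<sigma> x)) < ?c} \<subseteq> M5" "B.prob M5 < 1 / 8"
    using v2 by (meson order.strict_trans1)
  have "\<exists>M\<in>B.events. {\<sigma>. (\<Sum>x\<in>{-r<..<y}. of_int (min (-x) y) * real (occ \<sigma> x)) < ?c} \<subseteq> M \<and> B.prob M \<le> 2 * a ^ 3 * N ^ 3 / ?c ^ 2"
  proof (rule bernoulli_lower_tail)
    have "(\<Sum>x\<in>{-r<..<y}. min (-x) y) = y * (r - y)"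
      using sum_min_window[OF y0 yr] sum_reflect[of "\<lambda>x. min (-x) y" r y] by simp
    then have "(\<Sum>x\<in>{-r<..<y}. of_int (min (-x) y)) = (of_int (y * (r - y)) :: real)"
      by (metis of_int_sum)
    then show "?c + ?c \<le> \<zeta> * (\<Sum>x\<in>{-r<..<y}. of_int (min (-x) y))" using meanL by simp
    show "(\<Sum>x\<in>{-r<..<y}. (of_int (min (-x) y) :: real) ^ 2) \<le> 2 * a ^ 3 * N ^ 3"
      using yr y0 cardS(1) cardS' by (intro sq) auto
  qed (use \<zeta> \<epsilon> N in auto)
  then obtain M6 where M6: "M6 \<in> B.events" "{\<sigma>. (\<Sum>x\<in>{-r<..<y}. of_int (min (-x) y) * real (occ \<sigma> x)) < ?c} \<subseteq> M6" "B.prob M6 < 1 / 8"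
    using v2 by (meson order.strict_trans1)
  have "B.prob (M1 \<union> M2 \<union> M3 \<union> M4 \<union> M5 \<union> M6) < 1"
    using M1 M2 M3 M4 M5 M6
      measure_Un_le[of M1 "bernoulli_field \<zeta>" M2] measure_Un_le[of "M1 \<union> M2" "bernoulli_field \<zeta>" M3]
      measure_Un_le[of "M1 \<union> M2 \<union> M3" "bernoulli_field \<zeta>" M4]
      measure_Un_le[of "M1 \<union> M2 \<union> M3 \<union> M4" "bernoulli_field \<zeta>" M5]
      measure_Un_le[of "M1 \<union> M2 \<union> M3 \<union> M4 \<union> M5" "bernoulli_field \<zeta>" M6]
    by (simp add: sets.Un)
  then have "M1 \<union> M2 \<union> M3 \<union> M4 \<union> M5 \<union> M6 \<noteq> space (bernoulli_field \<zeta>)"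
    using B.prob_space by auto
  then obtain \<sigma> where \<sigma>: "\<sigma> \<notin> M1" "\<sigma> \<notin> M2" "\<sigma> \<notin> M3" "\<sigma> \<notin> M4" "\<sigma> \<notin> M5" "\<sigma> \<notin> M6" by auto
  have s3: "\<not> (\<Sum>x\<in>{-y<..<r}. 1 * real (occ \<sigma> x)) < N" and s4: "\<not> (\<Sum>x\<in>{-r<..<y}. 1 * real (occ \<sigma> x)) < N"
    using \<sigma> M3 M4 by auto
  have "(\<Sum>x\<in>S. 1 * real (occ \<sigma> x)) = real (sum (occ \<sigma>) S)" for S by (simp add: of_nat_sum)
  with s3 s4 have "real n \<le> real (sum (occ \<sigma>) {-y<..<r})" "real n \<le> real (sum (occ \<sigma>) {-r<..<y})"
    by (simp_all add: N_def not_less)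
  then show ?thesis
    using that[of \<sigma>] M1(2) M2(2) M5(2) M6(2) \<sigma> unfolding of_nat_le_iff N_def by (force simp: not_less)
qed

definition scale :: "nat \<Rightarrow> nat" where "scale k = k ^ 20"

text \<open>The odometer threshold is \<open>k ^ 10\<close>, the square root of
  \<open>n = k ^ 20\<close>: exceeding it costs of order \<open>k ^ (-30)\<close> by the third
  moment, and that many walkers reach a distance proportional to \<open>n\<close> with probability
  of order \<open>k ^ (-10)\<close>. The additive 2 in the radius comes from rounding
  \<open>r\<close> and \<open>m\<close> up.\<close>

lemma outer_scale:
  assumes \<zeta>: "0 < \<zeta>" "\<zeta> < 1" and fin: "outer_moment lam \<zeta> < \<infinity>" and \<epsilon>: "0 < \<epsilon>"
  shows "\<exists>B K. \<forall>k\<ge>K. outer_le lam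
    {\<rho>. \<not> (\<exists>v. stable_odo lam UNIV \<rho> ((\<lambda>_. 0)(0 := scale k)) v \<and>
       (\<forall>x. (1 + 2 * \<epsilon>) * real (scale k) / (2 * \<zeta>) + 2 < \<bar>of_int x\<bar> \<longrightarrow> v x = 0))} (B / real k ^ 2)"
proof -
  define a where "a = (1 + \<epsilon>) / (2 * \<zeta>) + 1"
  define C where "C = 8 * (enn2real (outer_moment lam \<zeta>) + 1)"
  have C: "C \<ge> 0" by (simp add: C_def)
  have a0: "a > 0" using \<zeta> \<epsilon> by (simp add: a_def add_pos_pos)
  define b where "b = \<epsilon> / (16 * \<zeta>)"
  have b: "b > 0" using \<zeta> \<epsilon> by (simp add: b_def)
  define B where "B = a ^ 2 / b ^ 2 + 2 * C + 2 * (2 * \<zeta> / \<epsilon>) + 1"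
  obtain K :: nat where K: "real K > 1 + 8 * \<zeta> / \<epsilon> + 256 * a / \<epsilon> ^ 2 + 8 * 512 * a ^ 3 * \<zeta> ^ 2 / \<epsilon> ^ 2"
    using reals_Archimedean2 by blast
  have "outer_le lam
    {\<rho>. \<not> (\<exists>v. stable_odo lam UNIV \<rho> ((\<lambda>_. 0)(0 := scale k)) v \<and>
       (\<forall>x. (1 + 2 * \<epsilon>) * real (scale k) / (2 * \<zeta>) + 2 < \<bar>of_int x\<bar> \<longrightarrow> v x = 0))} (B / real k ^ 2)"
    if k: "k \<ge> K" for k
  proof -
    define n where "n = scale k"
    have pos: "0 \<le> 8 * \<zeta> / \<epsilon>" "0 \<le> 256 * a / \<epsilon> ^ 2" "0 \<le> 8 * 512 * a ^ 3 * \<zeta> ^ 2 / \<epsilon> ^ 2"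
      using \<zeta> \<epsilon> a0 by simp_all
    have k1: "real k > 1" using K k pos by linarith
    then have k1': "real k \<ge> 1" "k > 0" by auto
    have rn: "real n = real k ^ 20" by (simp add: n_def scale_def)
    have kn: "real k \<le> real n" unfolding rn using power_increasing[of 1 20 "real k"] k1 by simp
    then have n: "n > 0" "real n > 8 * \<zeta> / \<epsilon>" "real n > 256 * a / \<epsilon> ^ 2" "real n > 8 * 512 * a ^ 3 * \<zeta> ^ 2 / \<epsilon> ^ 2"
    proof -
      show "n > 0" using k1 by (simp add: n_def scale_def)
      have "real n > 1 + 8 * \<zeta> / \<epsilon> + 256 * a / \<epsilon> ^ 2 + 8 * 512 * a ^ 3 * \<zeta> ^ 2 / \<epsilon> ^ 2"
        using kn K k by linarith
      then show "real n > 8 * \<zeta> / \<epsilon>" "real n > 256 * a / \<epsilon> ^ 2"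
        "real n > 8 * 512 * a ^ 3 * \<zeta> ^ 2 / \<epsilon> ^ 2"
        using pos by linarith+
    qed
    define r where "r = \<lceil>(1 + \<epsilon>) * real n / (2 * \<zeta>)\<rceil>"
    define y where "y = \<lceil>real n / (2 * \<zeta>)\<rceil>"
    define m where "m = \<lceil>\<epsilon> * real n / (2 * \<zeta>)\<rceil>"
    have m: "of_int m \<ge> \<epsilon> * real n / (2 * \<zeta>)" "0 < m" using \<zeta> \<epsilon> n by (auto simp: m_def)
    have y0: "0 < y" using \<zeta> n by (simp add: y_def)
    have yr: "y \<le> r" unfolding y_def r_def using \<zeta> \<epsilon> by (intro ceiling_mono divide_right_mono)
      (use mult_right_mono[of 1 "1 + \<epsilon>" "real n"] in auto)
    have "of_int r \<le> (1 + \<epsilon>) * real n / (2 * \<zeta>) + 1" unfolding r_def by linarith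
    also have "\<dots> \<le> a * real n" using kn k1 by (simp add: a_def field_simps)
    finally have ra: "of_int r \<le> a * real n" .
    obtain \<sigma> where \<sigma>: "odo_moment lam r \<sigma> \<le> ennreal C" "odo_moment lam (-r) \<sigma> \<le> ennreal C"
      "n \<le> sum (occ \<sigma>) {-y<..<r}"
      "b * real n ^ 2 \<le> (\<Sum>x\<in>{-y<..<r}. of_int (min x y) * real (occ \<sigma> x))"
      "n \<le> sum (occ \<sigma>) {-r<..<y}"
      "b * real n ^ 2 \<le> (\<Sum>x\<in>{-r<..<y}. of_int (min (-x) y) * real (occ \<sigma> x))"
      using choose_targets[OF \<zeta> fin \<epsilon> a_def r_def y_def n] unfolding C_def b_def by auto
    have "outer_le lam {\<rho>. \<not> (\<exists>v. stable_odo lam UNIV \<rho> ((\<lambda>_. 0)(0 := n)) v \<and> (\<forall>x. r + m < \<bar>x\<bar> \<longrightarrow> v x = 0))}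
      (real n * of_int r ^ 2 / (b * real n ^ 2) ^ 2 + 2 * C / real (k ^ 10) ^ 3 + 2 * real (k ^ 10) / of_int m + 1 / real k ^ 2)"
      by (rule outer_stage[OF m(2) _ C y0 yr _ _ \<sigma>]) (use k1' b n in auto)
    then show ?thesis
      unfolding n_def[symmetric]
    proof (rule outer_le_mono)
      show "{\<rho>. \<not> (\<exists>v. stable_odo lam UNIV \<rho> ((\<lambda>_. 0)(0 := n)) v \<and>
          (\<forall>x. (1 + 2 * \<epsilon>) * real n / (2 * \<zeta>) + 2 < \<bar>of_int x\<bar> \<longrightarrow> v x = 0))}
        \<subseteq> {\<rho>. \<not> (\<exists>v. stable_odo lam UNIV \<rho> ((\<lambda>_. 0)(0 := n)) v \<and> (\<forall>x. r + m < \<bar>x\<bar> \<longrightarrow> v x = 0))}"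
      proof -
        have "r + m < \<bar>x\<bar>" if "(1 + 2 * \<epsilon>) * real n / (2 * \<zeta>) + 2 < \<bar>of_int x\<bar>" for x
        proof -
          have "of_int r \<le> (1 + \<epsilon>) * real n / (2 * \<zeta>) + 1" "of_int m \<le> \<epsilon> * real n / (2 * \<zeta>) + 1"
            unfolding r_def m_def by linarith+
          moreover have "(1 + \<epsilon>) * real n / (2 * \<zeta>) + \<epsilon> * real n / (2 * \<zeta>) = (1 + 2 * \<epsilon>) * real n / (2 * \<zeta>)"
            by (simp add: add_divide_distrib[symmetric] algebra_simps)
          ultimately have "of_int (r + m) < (of_int \<bar>x\<bar> :: real)" using that by simp
          then show ?thesis by (simp only: of_int_less_iff)
        qed
        then show ?thesis by blast
      qed
      have 1: "real n * of_int r ^ 2 / (b * real n ^ 2) ^ 2 \<le> (a ^ 2 / b ^ 2) / real k ^ 2"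
      proof -
        have "0 \<le> (of_int r :: real)" using y0 yr by simp
        then have "real n * of_int r ^ 2 / (b * real n ^ 2) ^ 2 \<le> real n * (a * real n) ^ 2 / (b * real n ^ 2) ^ 2"
          using ra by (intro divide_right_mono mult_left_mono power_mono) auto
        also have "\<dots> = (a ^ 2 / b ^ 2) / real n"
          using n(1) b by (simp add: field_simps power2_eq_square)
        also have "\<dots> \<le> (a ^ 2 / b ^ 2) / real k ^ 2"
          unfolding rn using k1 power_increasing[of 2 20 "real k"] by (intro divide_left_mono) auto
        finally show ?thesis .
      qed
      have 2: "2 * C / real (k ^ 10) ^ 3 \<le> 2 * C / real k ^ 2"
        using k1 C power_increasing[of 2 30 "real k"] by (intro divide_left_mono) (auto simp: power_mult[symmetric])
      have 3: "2 * real (k ^ 10) / of_int m \<le> 2 * (2 * \<zeta> / \<epsilon>) / real k ^ 2"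
      proof -
        have "2 * real (k ^ 10) / of_int m \<le> 2 * real (k ^ 10) / (\<epsilon> * real n / (2 * \<zeta>))"
          using m n(1) \<epsilon> \<zeta> by (intro divide_left_mono) auto
        also have "\<dots> = 2 * (2 * \<zeta> / \<epsilon>) * (real k ^ 10 / real k ^ 20)"
          by (simp add: rn field_simps)
        also have "real k ^ 10 / real k ^ 20 = 1 / real k ^ 10"
          using k1' by (simp add: field_simps power_add[symmetric])
        also have "2 * (2 * \<zeta> / \<epsilon>) * (1 / real k ^ 10) \<le> 2 * (2 * \<zeta> / \<epsilon>) * (1 / real k ^ 2)"
          using k1 \<epsilon> \<zeta> power_increasing[of 2 10 "real k"] by (intro mult_left_mono divide_left_mono) auto
        finally show ?thesis by simp
      qed
      show "real n * of_int r ^ 2 / (b * real n ^ 2) ^ 2 + 2 * C / real (k ^ 10) ^ 3 + 2 * real (k ^ 10) / of_int m + 1 / real k ^ 2 \<le> B / real k ^ 2"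
        using 1 2 3 unfolding B_def by (simp add: add_divide_distrib)
    qed
  qed
  then show ?thesis by blast
qed

section \<open>The particle density in an interval\<close>

text \<open>Intersecting the measurable covers obtained for all \<open>T\<close> removes the
  truncation error altogether.\<close>

lemma outer_le_limit:
  assumes "\<And>T :: nat. T > 0 \<Longrightarrow> outer_le lam Q (p + A / real T)"
  shows "outer_le lam Q p"
proof -
  interpret prob_space "stack_measure lam" by (rule prob_space_stack)
  have "\<exists>M. M \<in> events \<and> Q \<subseteq> M \<and> prob M \<le> p + A / real (Suc T)" for T
    using assms[of "Suc T"] unfolding outer_le_def by auto
  then obtain M where M: "\<And>T. M T \<in> events" "\<And>T. Q \<subseteq> M T" "\<And>T. prob (M T) \<le> p + A / real (Suc T)"
    by metis
  have i: "(\<Inter>T. M T) \<in> events" using M(1) by auto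
  have "prob (\<Inter>T. M T) \<le> p + A / real (Suc T)" for T
    using finite_measure_mono[of "\<Inter>T. M T" "M T"] M(1,3)[of T] by (meson INT_lower UNIV_I order_trans)
  moreover have "(\<lambda>T. p + A / real (Suc T)) \<longlonglongrightarrow> p + 0"
    by (intro tendsto_add tendsto_const LIMSEQ_Suc[OF lim_const_over_n])
  ultimately have "prob (\<Inter>T. M T) \<le> p"
    by (intro LIMSEQ_le_const[of "\<lambda>T. p + A / real (Suc T)"]) auto
  then show ?thesis unfolding outer_le_def using i M(2) by blast
qed

section \<open>The mass left in a tile and its independence of what entered\<close>

definition overfull :: "ennreal \<Rightarrow> int set \<Rightarrow> (int \<Rightarrow> nat) \<Rightarrow> real \<Rightarrow> stacks \<Rightarrow> bool" where
  "overfull lam J \<eta> z \<rho> \<longleftrightarrow> (\<exists>u. min_odo lam J \<rho> \<eta> u \<and> z < of_int (\<Sum>x\<in>J. net \<rho> \<eta> u x))"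

lemma min_odo_cong:
  assumes "\<And>x. x \<in> J \<Longrightarrow> \<eta> x = \<eta>' x"
  shows "min_odo lam J \<rho> \<eta> u = min_odo lam J \<rho> \<eta>' u"
proof -
  have "stable_odo lam J \<rho> \<eta> v = stable_odo lam J \<rho> \<eta>' v" for v
    using assms stable_odo_mono[of lam J \<rho> \<eta> v \<eta>'] stable_odo_mono[of lam J \<rho> \<eta>' v \<eta>] by auto
  then show ?thesis by (simp add: min_odo_def)
qed

lemma overfull_cong:
  assumes "\<And>x. x \<in> J \<Longrightarrow> \<eta> x = \<eta>' x"
  shows "overfull lam J \<eta> z \<rho> = overfull lam J \<eta>' z \<rho>"
proof -
  have "(\<Sum>x\<in>J. net \<rho> \<eta> u x) = (\<Sum>x\<in>J. net \<rho> \<eta>' u x)" for u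
    using assms by (intro sum.cong) (auto simp: net_def)
  then show ?thesis using min_odo_cong[of J \<eta> \<eta>' lam \<rho>] assms by (simp add: overfull_def)
qed

text \<open>The final mass is \<open>net\<close> at the least odometer, and
  \<open>min_odo_advance\<close> splits that odometer into \<open>v\<close> and the least odometer
  of the restarted system, with the same \<open>net\<close>.\<close>

lemma overfull_advance:
  assumes over: "overfull lam J \<eta> z \<rho>"
    and net: "\<And>y. net \<rho> \<eta> v y = int (\<eta>' y)" and v: "\<And>x. x \<notin> J \<Longrightarrow> v x = 0"
    and ge1: "\<And>x. x \<in> J \<Longrightarrow> \<eta>' x \<ge> 1" and awake: "\<And>x. x \<in> J \<Longrightarrow> asleep \<rho> v x \<Longrightarrow> \<eta>' x \<ge> 2"
    and le: "\<And>w. stable_odo lam J \<rho> \<eta> w \<Longrightarrow> v \<le> w"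
  shows "overfull lam J \<eta>' z (advance v \<rho>)"
proof -
  obtain u where u: "min_odo lam J \<rho> \<eta> u" "z < of_int (\<Sum>x\<in>J. net \<rho> \<eta> u x)"
    using over by (auto simp: overfull_def)
  have vu: "v \<le> u" using le min_odo_stable[OF u(1)] by blast
  have "min_odo lam J (advance v \<rho>) \<eta>' (\<lambda>x. u x - v x)"
    by (rule min_odo_advance[OF net v ge1 awake u(1) vu])
  moreover have "net (advance v \<rho>) \<eta>' (\<lambda>x. u x - v x) x = net \<rho> \<eta> u x" for x
  proof -
    have "(\<lambda>y. v y + (u y - v y)) = u" using vu by (auto simp: le_fun_def)
    then show ?thesis using net_advance[OF net, of "\<lambda>x. u x - v x" x] by simp
  qed
  ultimately show ?thesis using u(2) by (auto simp: overfull_def)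
qed

lemma finite_int_bounded: "finite (J :: int set) \<Longrightarrow> \<exists>L. J \<subseteq> {-L<..<L}"
proof -
  assume J: "finite J"
  have "J \<subseteq> {-(Max (abs ` insert 0 J) + 1)<..<Max (abs ` insert 0 J) + 1}"
  proof
    fix x assume "x \<in> J"
    then have "\<bar>x\<bar> \<le> Max (abs ` insert 0 J)" using J by (intro Max_ge) auto
    then show "x \<in> {-(Max (abs ` insert 0 J) + 1)<..<Max (abs ` insert 0 J) + 1}" by auto
  qed
  then show ?thesis by blast
qed

lemma run_nonterm_finite:
  assumes "\<And>\<eta> x. sel \<eta> = Some x \<Longrightarrow> x \<in> J \<and> \<eta> x \<ge> 1" "finite J"
  shows "\<exists>A. \<forall>T>0. outer_le lam {\<rho>. sel (run_cfg sel T \<eta> \<rho>) \<noteq> None} (A / real T)"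
proof -
  obtain L where L: "J \<subseteq> {-L<..<L}" using finite_int_bounded[OF assms(2)] by blast
  have "outer_le lam {\<rho>. sel (run_cfg sel T \<eta> \<rho>) \<noteq> None}
    ((\<Sum>x\<in>{-L..L}. (of_int L ^ 2 - of_int x ^ 2) * real (\<eta> x)) / (2 * move_prob lam) / T)" if "T > 0" for T
    using run_nonterm[of sel L T lam \<eta>] assms(1) L that by (auto simp: divide_divide_eq_left) force
  then show ?thesis by blast
qed

abbreviation "ones J \<equiv> (\<lambda>x :: int. if x \<in> J then 1 else (0 :: nat))"

lemma overfull_from_full:
  assumes "finite J" and \<eta>: "\<And>x. x \<in> J \<Longrightarrow> \<eta> x \<ge> 1"
    and p: "outer_le lam {\<rho>. overfull lam J (ones J) z \<rho>} p"
  shows "outer_le lam {\<rho>. overfull lam J \<eta> z \<rho>} p"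
proof -
  define sel where "sel = pick J (\<lambda>\<eta> x. 2 \<le> \<eta> x)"
  have sel: "x \<in> J \<and> 2 \<le> \<xi> x" if "sel \<xi> = Some x" for \<xi> x
    using pick_Some[of J "\<lambda>\<eta> x. 2 \<le> \<eta> x"] that by (auto simp: sel_def)
  let ?Inv = "\<lambda>\<xi> :: int \<Rightarrow> nat. \<forall>x\<in>J. 1 \<le> \<xi> x"
  have inv: "?Inv (fire_cfg x i \<xi>)" if "?Inv \<xi>" "sel \<xi> = Some x" for \<xi> x i
    using that sel[OF that(2)] by (cases i) (auto simp: mv_def)
  have sel1: "x \<in> J \<and> 1 \<le> \<xi> x" if "sel \<xi> = Some x" for \<xi> x
    using sel[OF that] by linarith
  have "\<exists>A. \<forall>T>0. outer_le lam {\<rho>. sel (run_cfg sel T \<eta> \<rho>) \<noteq> None} (A / real T)"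
  proof (rule run_nonterm_finite[where J = J])
    fix \<xi> x assume "sel \<xi> = Some x" then show "x \<in> J \<and> 1 \<le> \<xi> x" by (rule sel1)
  qed (rule assms(1))
  then obtain A where A: "\<And>T. T > 0 \<Longrightarrow> outer_le lam {\<rho>. sel (run_cfg sel T \<eta> \<rho>) \<noteq> None} (A / real T)"
    by blast
  show ?thesis
  proof (rule outer_le_limit)
    fix T :: nat assume T: "T > 0"
    have "outer_le lam {\<rho>. sel (run_cfg sel T \<eta> \<rho>) = None \<and>
      overfull lam J (run_cfg sel T \<eta> \<rho>) z (advance (run_odo sel T \<eta> \<rho>) \<rho>)} p"
    proof (rule run_terminal[where Inv = ?Inv and \<Phi> = "\<lambda>_. p" and B = "\<lambda>\<eta> \<rho>. overfull lam J \<eta> z \<rho>"])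
      fix \<xi> assume "?Inv \<xi>" "sel \<xi> = None"
      then have "\<xi> x = ones J x" if "x \<in> J" for x
        using that by (force simp: sel_def pick_None)
      then show "outer_le lam {\<rho>. overfull lam J \<xi> z \<rho>} p"
        using p overfull_cong[of J \<xi> "ones J" lam z] by simp
    qed (use inv \<eta> outer_le_nonneg[OF p] in auto)
    from outer_le_Un[OF this A[OF T]]
    show "outer_le lam {\<rho>. overfull lam J \<eta> z \<rho>} (p + A / real T)"
    proof (rule outer_le_mono)
      show "{\<rho>. overfull lam J \<eta> z \<rho>} \<subseteq> {\<rho>. sel (run_cfg sel T \<eta> \<rho>) = None \<and>
        overfull lam J (run_cfg sel T \<eta> \<rho>) z (advance (run_odo sel T \<eta> \<rho>) \<rho>)} \<union>
        {\<rho>. sel (run_cfg sel T \<eta> \<rho>) \<noteq> None}"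
      proof
        fix \<rho> assume "\<rho> \<in> {\<rho>. overfull lam J \<eta> z \<rho>}"
        then have o: "overfull lam J \<eta> z \<rho>" by simp
        have full: "?Inv (run_cfg sel T \<eta> \<rho>)"
          by (rule run_inv[where P = ?Inv]) (use inv \<eta> in auto)
        have "overfull lam J (run_cfg sel T \<eta> \<rho>) z (advance (run_odo sel T \<eta> \<rho>) \<rho>)"
        proof (rule overfull_advance[OF o])
          show "net \<rho> \<eta> (run_odo sel T \<eta> \<rho>) y = int (run_cfg sel T \<eta> \<rho> y)" for y
            by (rule net_run) (use sel in force)
          show "run_odo sel T \<eta> \<rho> x = 0" if "x \<notin> J" for x
            by (rule run_odo_outside[where D = J]) (use sel that in blast)+
          show "1 \<le> run_cfg sel T \<eta> \<rho> x" if "x \<in> J" for x using full that by blast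
          show "2 \<le> run_cfg sel T \<eta> \<rho> x" if "asleep \<rho> (run_odo sel T \<eta> \<rho>) x" for x
            by (rule run_asleep[OF _ that]) (use sel in blast)
          show "run_odo sel T \<eta> \<rho> \<le> w" if "stable_odo lam J \<rho> \<eta> w" for w
          proof (rule run_legal[OF _ that])
            fix \<xi> x assume "sel \<xi> = Some x" then show "x \<in> J \<and> 2 \<le> \<xi> x" by (rule sel)
          qed simp
        qed
        then show "\<rho> \<in> {\<rho>. sel (run_cfg sel T \<eta> \<rho>) = None \<and>
          overfull lam J (run_cfg sel T \<eta> \<rho>) z (advance (run_odo sel T \<eta> \<rho>) \<rho>)} \<union>
          {\<rho>. sel (run_cfg sel T \<eta> \<rho>) \<noteq> None}" by auto
      qed
    qed simp
  qed
qed

text \<open>The \<open>K\<close> particles at the end \<open>c\<close> fill the tile except with the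
  probability from \<open>fill_bound\<close>; a full tile has been treated in
  \<open>overfull_from_full\<close>. The event \<open>B\<close> is an implication, so that it holds
  trivially when a site remains empty but the union bound still applies.\<close>

lemma overfull_from_source:
  assumes s: "s = 1 \<or> s = -1" and "m \<ge> 1" "K \<ge> 1" and J: "J = segment s c m" and K: "K \<le> \<eta> c"
    and p: "outer_le lam {\<rho>. overfull lam J (ones J) z \<rho>} p"
  shows "outer_le lam {\<rho>. overfull lam J \<eta> z \<rho>} (p + 2 ^ card J * (1 - 1 / (2 * (real m + 1))) ^ (K - 1))"
proof -
  let ?k = "(\<lambda>_. 0 :: nat)(c := K)"
  define sel where "sel = fill J"
  have sel: "x \<in> J \<and> 2 \<le> \<xi> x" if "sel \<xi> = Some x" for \<xi> x
    using pick_Some[OF that[unfolded sel_def]] by blast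
  \<comment> \<open>All other particles wait during the filling, and legality of the firings is not
    affected by them.\<close>
  define rest where "rest x = \<eta> x - ?k x" for x
  have rest: "\<eta> x = ?k x + rest x" for x using K by (simp add: rest_def)
  define B where "B \<xi> \<rho> \<longleftrightarrow> ((\<forall>x\<in>J. \<xi> x \<ge> 1) \<longrightarrow> overfull lam J (\<lambda>x. \<xi> x + rest x) z \<rho>)"
    for \<xi> :: "int \<Rightarrow> nat" and \<rho>
  have finJ: "finite J" using finite_segment[OF s] J by simp
  have sel1: "x \<in> J \<and> 1 \<le> \<xi> x" if "sel \<xi> = Some x" for \<xi> x
    using sel[OF that] by linarith
  have "\<exists>A. \<forall>T>0. outer_le lam {\<rho>. sel (run_cfg sel T ?k \<rho>) \<noteq> None} (A / real T)"
  proof (rule run_nonterm_finite[where J = J])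
    fix \<xi> x assume "sel \<xi> = Some x" then show "x \<in> J \<and> 1 \<le> \<xi> x" by (rule sel1)
  qed (rule finJ)
  then obtain A where A: "\<And>T. T > 0 \<Longrightarrow> outer_le lam {\<rho>. sel (run_cfg sel T ?k \<rho>) \<noteq> None} (A / real T)"
    by blast
  show ?thesis
  proof (rule outer_le_limit)
    fix T :: nat assume T: "T > 0"
    have full: "outer_le lam {\<rho>. B \<xi> \<rho>} p" if f: "\<And>x. x \<in> J \<Longrightarrow> 1 \<le> \<xi> x" for \<xi>
    proof -
      have "outer_le lam {\<rho>. overfull lam J (\<lambda>x. \<xi> x + rest x) z \<rho>} p"
      proof (rule overfull_from_full[OF finJ _ p])
        fix x assume "x \<in> J" then show "1 \<le> \<xi> x + rest x" using f[of x] by linarith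
      qed
      then show ?thesis by (rule outer_le_mono) (use f in \<open>auto simp only: B_def\<close>)
    qed
    have "outer_le lam {\<rho>. sel (run_cfg sel T ?k \<rho>) = None \<and>
        B (run_cfg sel T ?k \<rho>) (advance (run_odo sel T ?k \<rho>) \<rho>)}
      (p + 2 ^ card J * (1 - 1 / (2 * (real m + 1))) ^ (K - 1))"
      unfolding sel_def
      by (rule fill_bound[where B = B, OF s assms(2,3) outer_le_nonneg[OF p] J full])
    from outer_le_Un[OF this A[OF T]]
    show "outer_le lam {\<rho>. overfull lam J \<eta> z \<rho>}
      (p + 2 ^ card J * (1 - 1 / (2 * (real m + 1))) ^ (K - 1) + A / real T)"
    proof (rule outer_le_mono)
      show "{\<rho>. overfull lam J \<eta> z \<rho>} \<subseteq> {\<rho>. sel (run_cfg sel T ?k \<rho>) = None \<and>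
        B (run_cfg sel T ?k \<rho>) (advance (run_odo sel T ?k \<rho>) \<rho>)} \<union>
        {\<rho>. sel (run_cfg sel T ?k \<rho>) \<noteq> None}"
      proof
        fix \<rho> assume "\<rho> \<in> {\<rho>. overfull lam J \<eta> z \<rho>}"
        then have o: "overfull lam J \<eta> z \<rho>" by simp
        have "B (run_cfg sel T ?k \<rho>) (advance (run_odo sel T ?k \<rho>) \<rho>)"
          unfolding B_def
        proof (intro impI overfull_advance[OF o])
          assume full: "\<forall>x\<in>J. 1 \<le> run_cfg sel T ?k \<rho> x"
          show "net \<rho> \<eta> (run_odo sel T ?k \<rho>) y = int (run_cfg sel T ?k \<rho> y + rest y)" for y
          proof -
            have "net \<rho> ?k (run_odo sel T ?k \<rho>) y = int (run_cfg sel T ?k \<rho> y)"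
              by (rule net_run) (use sel in force)
            then show ?thesis using rest[of y] by (simp add: net_def)
          qed
          show "run_odo sel T ?k \<rho> x = 0" if "x \<notin> J" for x
            by (rule run_odo_outside[where D = J]) (use sel that in blast)+
          show "1 \<le> run_cfg sel T ?k \<rho> x + rest x" if "x \<in> J" for x using full that by (simp add: trans_le_add1)
          show "2 \<le> run_cfg sel T ?k \<rho> x + rest x" if "asleep \<rho> (run_odo sel T ?k \<rho>) x" for x
          proof -
            have "2 \<le> run_cfg sel T ?k \<rho> x" by (rule run_asleep[OF _ that]) (use sel in blast)
            then show ?thesis by simp
          qed
          show "run_odo sel T ?k \<rho> \<le> w" if "stable_odo lam J \<rho> \<eta> w" for w
          proof (rule run_legal[OF _ that])
            fix \<xi> x assume "sel \<xi> = Some x" then show "x \<in> J \<and> 2 \<le> \<xi> x" by (rule sel)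
          qed (use K in auto)
        qed
        then show "\<rho> \<in> {\<rho>. sel (run_cfg sel T ?k \<rho>) = None \<and>
          B (run_cfg sel T ?k \<rho>) (advance (run_odo sel T ?k \<rho>) \<rho>)} \<union>
          {\<rho>. sel (run_cfg sel T ?k \<rho>) \<noteq> None}" by auto
      qed
    qed simp
  qed
qed

section \<open>The inner density\<close>

text \<open>Once all particles have walked out of \<open>J\<close>, the odometer of the walk is
  stable, so a least one exists; the walk fails to end within \<open>T\<close> steps with
  probability at most \<open>A / T\<close>.\<close>

lemma min_odo_exists_outer:
  assumes "finite J"
  shows "outer_le lam {\<rho>. \<not> (\<exists>u. min_odo lam J \<rho> \<eta> u)} 0"
proof -
  have sel1: "x \<in> J \<and> 1 \<le> \<xi> x" if "walk_out J \<xi> = Some x" for \<xi> x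
    using pick_Some[OF that] by simp
  have "\<exists>A. \<forall>T>0. outer_le lam {\<rho>. walk_out J (run_cfg (walk_out J) T \<eta> \<rho>) \<noteq> None} (A / real T)"
  proof (rule run_nonterm_finite[where J = J])
    fix \<xi> x assume "walk_out J \<xi> = Some x" then show "x \<in> J \<and> 1 \<le> \<xi> x" by (rule sel1)
  qed (rule assms)
  then obtain A where A: "\<And>T. T > 0 \<Longrightarrow> outer_le lam {\<rho>. walk_out J (run_cfg (walk_out J) T \<eta> \<rho>) \<noteq> None} (A / real T)"
    by blast
  show ?thesis
  proof (rule outer_le_limit)
    fix T :: nat assume T: "T > 0"
    show "outer_le lam {\<rho>. \<not> (\<exists>u. min_odo lam J \<rho> \<eta> u)} (0 + A / real T)"
    proof (rule outer_le_mono[OF A[OF T]], rule subsetI)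
      fix \<rho> assume "\<rho> \<in> {\<rho>. \<not> (\<exists>u. min_odo lam J \<rho> \<eta> u)}"
      then have "\<not> stable_odo lam J \<rho> \<eta> (run_odo (walk_out J) T \<eta> \<rho>)" using min_odo_exists by blast
      then have "walk_out J (run_cfg (walk_out J) T \<eta> \<rho>) \<noteq> None"
        using stable_odo_walk_out[of J T \<eta> \<rho> J lam] by blast
      then show "\<rho> \<in> {\<rho>. walk_out J (run_cfg (walk_out J) T \<eta> \<rho>) \<noteq> None}" by simp
    qed simp
  qed
qed

lemma net_le_1: "min_odo lam J \<rho> \<eta> u \<Longrightarrow> x \<in> J \<Longrightarrow> net \<rho> \<eta> u x \<le> 1"
  unfolding min_odo_def stable_odo_def act_def by force

text \<open>A stable site holds at most one particle, so density 1 is exceeded only on a null set.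
  Hence the infimum is over a nonempty set and has its intended value.\<close>

lemma zeta_in_interval_bounds:
  fixes lam :: ennreal and I :: "int set"
  assumes "finite I" "I \<noteq> {}"
  defines "X \<equiv> {\<zeta>. 0 < \<zeta> \<and>
       \<P>(\<rho> in stack_measure lam. real (particles_left lam \<rho> I) > \<zeta> * real (card I)) \<le> 1 / real (card I) ^ 20}"
  shows "1 \<in> X" "0 \<le> zeta_in_interval lam I" "zeta_in_interval lam I \<le> 1"
proof -
  interpret prob_space "stack_measure lam" by (rule prob_space_stack)
  obtain M where M: "M \<in> events" "{\<rho>. \<not> (\<exists>u. min_odo lam I \<rho> (ones I) u)} \<subseteq> M" "prob M \<le> 0"
    using min_odo_exists_outer[OF \<open>finite I\<close>, of lam "ones I"] unfolding outer_le_def by blast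
  have "{\<rho>\<in>space (stack_measure lam). real (particles_left lam \<rho> I) > 1 * real (card I)} \<subseteq> M"
  proof
    fix \<rho> assume "\<rho> \<in> {\<rho>\<in>space (stack_measure lam). real (particles_left lam \<rho> I) > 1 * real (card I)}"
    then have g: "card I < particles_left lam \<rho> I" by simp
    have "\<not> (\<exists>u. min_odo lam I \<rho> (ones I) u)"
    proof
      assume "\<exists>u. min_odo lam I \<rho> (ones I) u"
      then obtain u where u: "min_odo lam I \<rho> (ones I) u" by blast
      have "int (particles_left lam \<rho> I) \<le> (\<Sum>x\<in>I. 1)"
        unfolding particles_left_eq[OF u \<open>finite I\<close>] by (intro sum_mono net_le_1[OF u])
      then show False using g by simp
    qed
    then show "\<rho> \<in> M" using M(2) by blast
  qed
  then have "prob {\<rho>\<in>space (stack_measure lam). real (particles_left lam \<rho> I) > 1 * real (card I)} \<le> prob M"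
    using M(1) by (rule finite_measure_mono)
  then show 1: "1 \<in> X" unfolding X_def using M(3) by (auto intro: order_trans[of _ 0])
  have bdd: "bdd_below X" by (auto simp: X_def bdd_below_def intro!: exI[of _ 0] less_imp_le)
  have z: "zeta_in_interval lam I = Inf X" by (simp add: zeta_in_interval_def X_def)
  show "zeta_in_interval lam I \<le> 1" unfolding z by (rule cInf_lower[OF 1 bdd])
  show "0 \<le> zeta_in_interval lam I" unfolding z
  proof (rule cInf_greatest)
    show "X \<noteq> {}" using 1 by blast
  qed (auto simp: X_def)
qed

lemma eventually_large_intervals:
  "eventually P large_intervals \<longleftrightarrow> (\<exists>N. \<forall>a b. a \<le> b \<longrightarrow> N \<le> card {a..b} \<longrightarrow> P {a..b})"
proof
  assume "eventually P large_intervals"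
  then obtain Q R where QR: "eventually Q (filtercomap card at_top)" "\<And>I. I \<in> {{a..b} | a b. a \<le> b} \<Longrightarrow> R I"
    "\<And>I. Q I \<Longrightarrow> R I \<Longrightarrow> P I"
    unfolding large_intervals_def eventually_inf eventually_principal by blast
  then obtain N where "\<And>I. N \<le> card I \<Longrightarrow> Q I"
    unfolding eventually_filtercomap eventually_at_top_linorder by blast
  then show "\<exists>N. \<forall>a b. a \<le> b \<longrightarrow> N \<le> card {a..b} \<longrightarrow> P {a..b}" using QR by blast
next
  assume "\<exists>N. \<forall>a b. a \<le> b \<longrightarrow> N \<le> card {a..b} \<longrightarrow> P {a..b}"
  then obtain N where N: "\<And>a b. a \<le> b \<Longrightarrow> N \<le> card {a..b} \<Longrightarrow> P {a..b}" by blast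
  have "eventually (\<lambda>I. N \<le> card I) (filtercomap card at_top)"
    by (rule eventually_filtercomapI) (rule eventually_ge_at_top)
  then show "eventually P large_intervals"
    unfolding large_intervals_def eventually_inf eventually_principal
    by (intro exI[of _ "\<lambda>I. N \<le> card I"] exI[of _ "\<lambda>I. I \<in> {{a..b} | a b. a \<le> b}"]) (use N in auto)
qed

text \<open>The filter is not trivial and the densities lie in \<open>[0, 1]\<close>, so the upper
  limit is finite and \<open>real_of_ereal\<close> loses nothing.\<close>

lemma zeta_in_Limsup:
  "ereal (zeta_in lam) = Limsup large_intervals (\<lambda>I. ereal (zeta_in_interval lam I))" and zeta_in_nonneg: "0 \<le> zeta_in lam"
proof -
  let ?L = "Limsup large_intervals (\<lambda>I. ereal (zeta_in_interval lam I))"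
  have ne: "large_intervals \<noteq> bot"
  proof
    assume "large_intervals = bot"
    then have "eventually (\<lambda>_. False) large_intervals" by simp
    then obtain N where N: "\<And>a b :: int. a \<le> b \<Longrightarrow> \<not> N \<le> card {a..b}"
      unfolding eventually_large_intervals by blast
    from N[of 0 "int N"] show False by simp
  qed
  have "0 \<le> ?L"
    by (rule le_Limsup[OF ne]) (auto simp: eventually_large_intervals zeta_in_interval_bounds)
  moreover have "?L \<le> 1"
    by (rule Limsup_bounded) (auto simp: eventually_large_intervals zeta_in_interval_bounds)
  ultimately have f: "\<bar>?L\<bar> \<noteq> \<infinity>" by (cases ?L) auto
  then show L: "ereal (zeta_in lam) = ?L" by (simp add: zeta_in_def ereal_real)
  show "0 \<le> zeta_in lam" using \<open>0 \<le> ?L\<close> unfolding L[symmetric] by simp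
qed

lemma zeta_in_overfull:
  assumes "zeta_in lam < \<zeta>"
  shows "\<exists>N. \<forall>a b. a \<le> b \<longrightarrow> N \<le> card {a..b} \<longrightarrow>
    outer_le lam {\<rho>. overfull lam {a..b} (ones {a..b}) (\<zeta> * real (card {a..b})) \<rho>} (1 / real (card {a..b}) ^ 20)"
proof -
  have "Limsup large_intervals (\<lambda>I. ereal (zeta_in_interval lam I)) < ereal \<zeta>"
    using assms unfolding zeta_in_Limsup[symmetric] by simp
  from Limsup_lessD[OF this] obtain N where N: "\<And>a b. a \<le> b \<Longrightarrow> N \<le> card {a..b} \<Longrightarrow> zeta_in_interval lam {a..b} < \<zeta>"
    unfolding eventually_large_intervals by auto
  have "outer_le lam {\<rho>. overfull lam {a..b} (ones {a..b}) (\<zeta> * real (card {a..b})) \<rho>} (1 / real (card {a..b}) ^ 20)"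
    if ab: "a \<le> b" "N \<le> card {a..b}" for a b
  proof -
    let ?I = "{a..b}"
    define X where "X = {\<zeta>. 0 < \<zeta> \<and>
       \<P>(\<rho> in stack_measure lam. real (particles_left lam \<rho> ?I) > \<zeta> * real (card ?I)) \<le> 1 / real (card ?I) ^ 20}"
    have "1 \<in> X" unfolding X_def by (rule zeta_in_interval_bounds) (use ab in auto)
    then have "X \<noteq> {}" by auto
    moreover have "Inf X < \<zeta>" using N[OF ab] by (simp add: zeta_in_interval_def X_def)
    ultimately obtain z where z: "z \<in> X" "z < \<zeta>" using cInf_lessD by blast
    let ?Q = "{\<rho>\<in>space (stack_measure lam). real (particles_left lam \<rho> ?I) > z * real (card ?I)}"
    have z0: "0 \<le> z * real (card ?I)" using z by (simp add: X_def)
    \<comment> \<open>Rounding the threshold down matches the natural-number form in which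
      measurability was shown; this uses that it is nonnegative.\<close>
    have "?Q = {\<rho>. particles_left lam \<rho> ?I > nat \<lfloor>z * real (card ?I)\<rfloor>}"
    proof -
      have "real k > z * real (card ?I) \<longleftrightarrow> k > nat \<lfloor>z * real (card ?I)\<rfloor>" for k
        using z0 by linarith
      then show ?thesis by simp
    qed
    then have "?Q \<in> sets (stack_measure lam)" using particles_left_measurable by simp
    then have "outer_le lam ?Q (1 / real (card ?I) ^ 20)"
      using z by (intro outer_le_meas) (auto simp: X_def)
    then show ?thesis
    proof (rule outer_le_mono)
      show "{\<rho>. overfull lam ?I (ones ?I) (\<zeta> * real (card ?I)) \<rho>} \<subseteq> ?Q"
      proof safe
        fix \<rho> assume "overfull lam ?I (ones ?I) (\<zeta> * real (card ?I)) \<rho>"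
        then obtain u where u: "min_odo lam ?I \<rho> (ones ?I) u"
          "\<zeta> * real (card ?I) < of_int (\<Sum>x\<in>?I. net \<rho> (ones ?I) u x)"
          unfolding overfull_def by blast
        have "z * real (card ?I) \<le> \<zeta> * real (card ?I)" using z by (intro mult_right_mono) auto
        also have "\<dots> < real_of_int (int (particles_left lam \<rho> ?I))"
          using u(2) particles_left_eq[OF u(1)] by simp
        finally show "z * real (card ?I) < real (particles_left lam \<rho> ?I)" by simp
      qed simp
    qed simp
  qed
  then show ?thesis by blast
qed

section \<open>Counting fired sites\<close>

text \<open>Conservation of mass: inside the interval departures and arrivals cancel, and only the
  flow across the two ends remains.\<close>

lemma sum_net_interval:
  assumes "c \<le> d"
  shows "(\<Sum>x\<in>{c..d}. net \<rho> \<eta> u x) = (\<Sum>x\<in>{c..d}. int (\<eta> x))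
    + int (cnt GoRight \<rho> (c - 1) (u (c - 1))) + int (cnt GoLeft \<rho> (d + 1) (u (d + 1)))
    - int (cnt GoLeft \<rho> c (u c)) - int (cnt GoRight \<rho> d (u d))"
  using assms
proof (induction d rule: int_ge_induct)
  case base
  then show ?case by (simp add: net_def)
next
  case (step d)
  have "{c..d + 1} = insert (d + 1) {c..d}" using step by auto
  then show ?case using step by (simp add: net_def)
qed

lemma finite_support:
  fixes u :: "int \<Rightarrow> nat"
  assumes "\<And>x. L < \<bar>x\<bar> \<Longrightarrow> u x = 0"
  shows "finite {x. u x \<noteq> 0}"
proof (rule finite_subset)
  show "{x. u x \<noteq> 0} \<subseteq> {-L..L}"
  proof
    fix x assume "x \<in> {x. u x \<noteq> 0}"
    then have "\<not> L < \<bar>x\<bar>" using assms[of x] by auto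
    then show "x \<in> {-L..L}" by auto
  qed
qed simp

lemma min_odo_net_nonneg:
  assumes "min_odo lam UNIV \<rho> \<eta> u" "finite {x. u x \<noteq> 0}"
  shows "0 \<le> net \<rho> \<eta> u x"
proof -
  obtain xs where xs: "legal lam \<rho> UNIV (num_cfg \<eta>) xs" "count_list xs = u"
    using legal_reaches[OF assms, of \<eta> UNIV] by auto
  have "agrees lam \<rho> UNIV \<eta> (result lam \<rho> UNIV (num_cfg \<eta>) xs, count_list xs)"
    by (rule agrees_result[OF _ xs(1)]) simp
  then show ?thesis using xs(2) by (auto simp: agrees_def)
qed

definition ends :: "int \<Rightarrow> int \<Rightarrow> nat \<Rightarrow> nat \<Rightarrow> int \<Rightarrow> nat" where
  "ends c d i j x = (if x = c then i else 0) + (if x = d then j else 0)"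

text \<open>The tiles of length \<open>m\<close> to the right of the origin are treated from left to right until fewer
  than \<open>K\<close> particles lie ahead. Every earlier tile has been entered at least \<open>K\<close> times through its left
  end, and all of its sites have fired.\<close>

lemma right_mass:
  assumes min: "min_odo lam UNIV \<rho> ((\<lambda>_. 0)(0 := n)) u"
    and supp: "\<And>x. L < \<bar>x\<bar> \<Longrightarrow> u x = 0" and L: "0 \<le> L" and U: "\<And>x. u x \<le> U"
    and m: "1 \<le> m" "m < K" and "0 \<le> \<zeta>"
    and good: "\<And>t i j. 0 \<le> t \<Longrightarrow> t \<le> L \<Longrightarrow> K \<le> i \<Longrightarrow> i \<le> n + U \<Longrightarrow> j \<le> n + U \<Longrightarrow>
      \<not> overfull lam {t * int m..t * int m + int m - 1} (ends (t * int m) (t * int m + int m - 1) i j) (\<zeta> * real m) \<rho>"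
  shows "of_int (\<Sum>x\<in>{0..L+1}. net \<rho> ((\<lambda>_. 0)(0 := n)) u x) \<le> \<zeta> * real (card {x. 0 \<le> x \<and> u x \<noteq> 0}) + real K"
proof -
  let ?\<eta> = "(\<lambda>_. 0)(0 := n)"
  define N where "N x = net \<rho> ?\<eta> u x" for x
  define F where "F c = (\<Sum>x\<in>{c..L+1}. N x)" for c
  have fin: "finite {x. u x \<noteq> 0}" using supp by (rule finite_support)
  have N0: "0 \<le> N x" for x unfolding N_def by (rule min_odo_net_nonneg[OF min fin])
  have N1: "N x \<le> 1" for x unfolding N_def by (rule net_le_1[OF min]) simp
  have tile: "(\<forall>x\<in>{c..c + int m - 1}. u x \<noteq> 0) \<and> of_int (\<Sum>x\<in>{c..c + int m - 1}. N x) \<le> \<zeta> * real m"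
    if c: "c = int t * int m" and K: "int K \<le> F c" for c t
  proof -
    let ?d = "c + int m - 1"
    let ?J = "{c..?d}"
    have c0: "0 \<le> c" using c by simp
    have cL: "c \<le> L + 1" using K m by (cases "c \<le> L + 1") (auto simp: F_def)
    \<comment> \<open>An unfired \<open>x\<close> blocks everything beyond it, so the mass from
      \<open>c\<close> on would sit inside the tile, at most one particle per site; that is at most
      \<open>m < K\<close>.\<close>
    have fired: "u x \<noteq> 0" if x: "x \<in> ?J" for x
    proof
      assume ux: "u x = 0"
      have gap: "u z = 0" if "x \<le> z" for z
        using min_odo_gap(1)[OF min ux, of z] x c0 that ux by (cases "z = x") auto
      have "N z = 0" if "x < z" for z
        using gap[of z] gap[of "z - 1"] gap[of "z + 1"] that x c0 by (simp add: N_def net_def)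
      then have "F c \<le> (\<Sum>z\<in>{c..L+1}. if z \<in> {c..x} then 1 else 0)"
        unfolding F_def using N1 by (intro sum_mono) auto
      also have "\<dots> = (\<Sum>z\<in>{c..L+1} \<inter> {c..x}. 1)" by (rule sum.inter_restrict[symmetric]) simp
      also have "\<dots> \<le> (\<Sum>z\<in>{c..x}. 1)" by (rule sum_mono2) auto
      also have "\<dots> \<le> int m" using x by simp
      finally show False using K m by simp
    qed
    \<comment> \<open>The left entrance number includes the initial particles, for the sake of the
      tile that begins at the origin.\<close>
    define i where "i = ?\<eta> c + cnt GoRight \<rho> (c - 1) (u (c - 1))"
    define j where "j = cnt GoLeft \<rho> (?d + 1) (u (?d + 1))"
    have "F c \<le> int i"
    proof -
      have "(\<Sum>x\<in>{c..L+1}. int (?\<eta> x)) = int (?\<eta> c)"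
      proof -
        have "(\<Sum>x\<in>{c..L+1}. int (?\<eta> x)) = (\<Sum>x\<in>{c}. int (?\<eta> x))"
          using c0 cL by (intro sum.mono_neutral_right) auto
        then show ?thesis by simp
      qed
      moreover have "u (L + 1) = 0" "u (L + 1 + 1) = 0" using supp L by auto
      ultimately show ?thesis
        unfolding F_def N_def sum_net_interval[OF cL] by (simp add: i_def)
    qed
    then have iK: "K \<le> i" using K by simp
    have iU: "i \<le> n + U"
      unfolding i_def by (intro add_mono order_trans[OF cnt_le U]) simp
    have jU: "j \<le> n + U" unfolding j_def using order_trans[OF cnt_le U] by (simp add: trans_le_add2)
    have tL: "int t \<le> L"
    proof -
      have "u c \<noteq> 0" using fired[of c] m by simp
      then have "c \<le> L" using supp[of c] c0 by (cases "c \<le> L") auto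
      moreover have "int t * 1 \<le> c" unfolding c using m by (intro mult_left_mono) auto
      ultimately show ?thesis by simp
    qed
    have eq: "ends c ?d i j x = restr_cfg ?J \<rho> ?\<eta> u x" if x: "x \<in> ?J" for x
    proof -
      have "x - 1 \<in> ?J \<longleftrightarrow> x \<noteq> c" "x + 1 \<in> ?J \<longleftrightarrow> x \<noteq> ?d" using x by auto
      then show ?thesis using x c0 by (auto simp: ends_def restr_cfg_def i_def j_def)
    qed
    have "\<not> overfull lam ?J (ends c ?d i j) (\<zeta> * real m) \<rho>"
      using good[of "int t" i j] tL iK iU jU by (simp add: c)
    then have "\<not> overfull lam ?J (restr_cfg ?J \<rho> ?\<eta> u) (\<zeta> * real m) \<rho>"
      using overfull_cong[of ?J "ends c ?d i j" "restr_cfg ?J \<rho> ?\<eta> u"] eq by blast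
    moreover have "min_odo lam ?J \<rho> (restr_cfg ?J \<rho> ?\<eta> u) (\<lambda>x. if x \<in> ?J then u x else 0)"
      by (rule min_odo_restr[OF min]) simp
    ultimately have "of_int (\<Sum>x\<in>?J. net \<rho> (restr_cfg ?J \<rho> ?\<eta> u) (\<lambda>x. if x \<in> ?J then u x else 0) x) \<le> \<zeta> * real m"
      unfolding overfull_def by (meson not_le)
    also have "(\<Sum>x\<in>?J. net \<rho> (restr_cfg ?J \<rho> ?\<eta> u) (\<lambda>x. if x \<in> ?J then u x else 0) x) = (\<Sum>x\<in>?J. N x)"
    proof (rule sum.cong)
      fix x assume x: "x \<in> ?J"
      have "(\<lambda>y. if y \<in> ?J then if y \<in> ?J then u y else 0 else u y) = u" by auto
      then show "net \<rho> (restr_cfg ?J \<rho> ?\<eta> u) (\<lambda>x. if x \<in> ?J then u x else 0) x = N x"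
        unfolding N_def by (subst net_restr[OF x]) auto
    qed simp
    finally show ?thesis using fired by blast
  qed
  \<comment> \<open>The first light tail; it exists because the sum is empty beyond
    \<open>L + 1\<close>.\<close>
  define t0 where "t0 = (LEAST t. F (int t * int m) < int K)"
  have "F (int (nat (L + 2)) * int m) < int K"
  proof -
    have "L + 1 < (L + 2) * 1" by simp
    also have "\<dots> \<le> (L + 2) * int m" using L m by (intro mult_left_mono) auto
    also have "\<dots> = int (nat (L + 2)) * int m" using L by simp
    finally have "L + 1 < int (nat (L + 2)) * int m" .
    then have "{int (nat (L + 2)) * int m..L + 1} = {}" by (rule atLeastatMost_empty)
    then show ?thesis using m unfolding F_def by simp
  qed
  then have t0: "F (int t0 * int m) < int K" unfolding t0_def by (rule LeastI)
  have heavy: "int K \<le> F (int t * int m)" if "t < t0" for t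
    using not_less_Least[of t "\<lambda>t. F (int t * int m) < int K"] that by (simp add: t0_def)
  have ind: "t \<le> t0 \<Longrightarrow> (\<forall>x\<in>{0..<int t * int m}. u x \<noteq> 0) \<and>
      of_int (\<Sum>x\<in>{0..<int t * int m}. N x) \<le> \<zeta> * real (t * m)" for t
  proof (induction t)
    case (Suc t)
    let ?c = "int t * int m"
    have T: "(\<forall>x\<in>{?c..?c + int m - 1}. u x \<noteq> 0)" "of_int (\<Sum>x\<in>{?c..?c + int m - 1}. N x) \<le> \<zeta> * real m"
      using tile[OF refl heavy[of t]] Suc.prems by auto
    have I: "(\<forall>x\<in>{0..<?c}. u x \<noteq> 0)" "of_int (\<Sum>x\<in>{0..<?c}. N x) \<le> \<zeta> * real (t * m)"
      using Suc by auto
    have split: "{0..<int (Suc t) * int m} = {0..<?c} \<union> {?c..?c + int m - 1}"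
      using m by (auto simp: algebra_simps) (smt (verit) mult_nonneg_nonneg of_nat_0_le_iff)
    have "(\<Sum>x\<in>{0..<int (Suc t) * int m}. N x) = (\<Sum>x\<in>{0..<?c}. N x) + (\<Sum>x\<in>{?c..?c + int m - 1}. N x)"
      unfolding split by (rule sum.union_disjoint) auto
    then have "of_int (\<Sum>x\<in>{0..<int (Suc t) * int m}. N x) \<le> \<zeta> * real (t * m) + \<zeta> * real m"
      using T(2) I(2) by simp
    then show ?case using T(1) I(1) unfolding split by (auto simp: algebra_simps)
  qed simp
  let ?e = "int t0 * int m"
  have fe: "\<forall>x\<in>{0..<?e}. u x \<noteq> 0" and me: "of_int (\<Sum>x\<in>{0..<?e}. N x) \<le> \<zeta> * real (t0 * m)"
    using ind[of t0] by auto
  have eL: "?e \<le> L + 1"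
  proof (rule ccontr)
    assume "\<not> ?e \<le> L + 1"
    then have "u (L + 1) \<noteq> 0" using fe L by auto
    then show False using supp[of "L + 1"] L by auto
  qed
  have e0: "0 \<le> ?e" by simp
  have "{0..b} = {0..<e} \<union> {e..b}" if "0 \<le> e" "e \<le> b" for e b :: int using that by auto
  from this[OF e0 eL] have split: "{0..L+1} = {0..<?e} \<union> {?e..L+1}" .
  have "(\<Sum>x\<in>{0..L+1}. N x) = (\<Sum>x\<in>{0..<?e}. N x) + F ?e"
    unfolding F_def split by (rule sum.union_disjoint) auto
  then have "of_int (\<Sum>x\<in>{0..L+1}. N x) \<le> \<zeta> * real (t0 * m) + real K"
    using me t0 by simp
  moreover have "t0 * m \<le> card {x. 0 \<le> x \<and> u x \<noteq> 0}"
  proof -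
    have "card {0..<?e} \<le> card {x. 0 \<le> x \<and> u x \<noteq> 0}"
      by (rule card_mono) (use fe fin in \<open>auto intro: finite_subset[OF _ fin]\<close>)
    then show ?thesis by (simp add: nat_mult_distrib)
  qed
  then have "\<zeta> * real (t0 * m) \<le> \<zeta> * real (card {x. 0 \<le> x \<and> u x \<noteq> 0})"
    using \<open>0 \<le> \<zeta>\<close> by (intro mult_left_mono) (simp_all only: of_nat_le_iff)
  ultimately show ?thesis unfolding N_def by linarith
qed

subsection \<open>Reflection\<close>

fun flip :: "instr \<Rightarrow> instr" where
  "flip GoLeft = GoRight" | "flip GoRight = GoLeft" | "flip Sleep = Sleep"

text \<open>Reflection is applied to a fixed realisation and only transports deterministic
  statements; the left tiles receive their own probability bounds for the original stacks.\<close>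

definition mirror :: "stacks \<Rightarrow> stacks" where
  "mirror \<rho> = (\<lambda>(x, k). flip (\<rho> (- x, k)))"

lemma flip_eq: "flip i = j \<longleftrightarrow> i = flip j"
  by (cases i; cases j) auto

lemma cnt_mirror: "cnt i (mirror \<rho>) x k = cnt (flip i) \<rho> (- x) k"
  by (simp add: cnt_def mirror_def flip_eq)

lemma net_mirror: "net (mirror \<rho>) (\<lambda>x. \<eta> (- x)) (\<lambda>x. u (- x)) x = net \<rho> \<eta> u (- x)"
  by (simp add: net_def cnt_mirror)

lemma act_mirror: "act lam (mirror \<rho>) (\<lambda>x. \<eta> (- x)) (\<lambda>x. u (- x)) x = act lam \<rho> \<eta> u (- x)"
  by (simp add: act_def net_mirror asleep_def) (simp add: mirror_def flip_eq)

lemma stable_odo_mirror: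
  "stable_odo lam (uminus ` D) (mirror \<rho>) (\<lambda>x. \<eta> (- x)) (\<lambda>x. u (- x)) = stable_odo lam D \<rho> \<eta> u"
proof -
  have "(\<forall>x. x \<notin> uminus ` D \<longrightarrow> u (- x) = 0) = (\<forall>x. x \<notin> D \<longrightarrow> u x = 0)"
    by (metis (no_types, lifting) image_iff minus_minus)
  then show ?thesis by (simp add: stable_odo_def act_mirror)
qed

lemma min_odo_mirror:
  "min_odo lam (uminus ` D) (mirror \<rho>) (\<lambda>x. \<eta> (- x)) (\<lambda>x. u (- x)) = min_odo lam D \<rho> \<eta> u"
proof -
  have "(\<forall>v. stable_odo lam (uminus ` D) (mirror \<rho>) (\<lambda>x. \<eta> (- x)) v \<longrightarrow> (\<lambda>x. u (- x)) \<le> v) =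
    (\<forall>v. stable_odo lam D \<rho> \<eta> v \<longrightarrow> u \<le> v)"
  proof safe
    fix v assume a: "\<forall>v. stable_odo lam (uminus ` D) (mirror \<rho>) (\<lambda>x. \<eta> (- x)) v \<longrightarrow> (\<lambda>x. u (- x)) \<le> v"
      and "stable_odo lam D \<rho> \<eta> v"
    then have "(\<lambda>x. u (- x)) \<le> (\<lambda>x. v (- x))" by (simp add: stable_odo_mirror)
    then show "u \<le> v" unfolding le_fun_def by (metis minus_minus)
  next
    fix v assume a: "\<forall>v. stable_odo lam D \<rho> \<eta> v \<longrightarrow> u \<le> v"
      and "stable_odo lam (uminus ` D) (mirror \<rho>) (\<lambda>x. \<eta> (- x)) v"
    then have "stable_odo lam D \<rho> \<eta> (\<lambda>x. v (- x))"
      using stable_odo_mirror[of lam D \<rho> \<eta> "\<lambda>x. v (- x)"] by simp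
    then have "u \<le> (\<lambda>x. v (- x))" using a by blast
    then show "(\<lambda>x. u (- x)) \<le> v" unfolding le_fun_def by (metis minus_minus)
  qed
  then show ?thesis by (simp add: min_odo_def stable_odo_mirror)
qed

lemma overfull_mirrorD:
  assumes "overfull lam (uminus ` J) (\<lambda>x. \<eta> (- x)) z (mirror \<rho>)"
  shows "overfull lam J \<eta> z \<rho>"
proof -
  obtain u where u: "min_odo lam (uminus ` J) (mirror \<rho>) (\<lambda>x. \<eta> (- x)) u"
    "z < of_int (\<Sum>x\<in>uminus ` J. net (mirror \<rho>) (\<lambda>x. \<eta> (- x)) u x)"
    using assms by (auto simp: overfull_def)
  have "min_odo lam J \<rho> \<eta> (\<lambda>x. u (- x))"
    using u(1) min_odo_mirror[of lam J \<rho> \<eta> "\<lambda>x. u (- x)"] by simp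
  moreover have "(\<Sum>x\<in>uminus ` J. net (mirror \<rho>) (\<lambda>x. \<eta> (- x)) u x) = (\<Sum>x\<in>J. net \<rho> \<eta> (\<lambda>x. u (- x)) x)"
    using net_mirror[of \<rho> \<eta> "\<lambda>x. u (- x)"] by (subst sum.reindex) (auto simp: inj_on_def)
  ultimately show ?thesis using u(2) by (auto simp: overfull_def)
qed

text \<open>All \<open>n\<close> particles end in \<open>[-(L+1), L+1]\<close>, as no site near its
  ends fires. The two halves overlap in the origin, whence the additional 1 in the count.\<close>

lemma fired_count:
  assumes min: "min_odo lam UNIV \<rho> ((\<lambda>_. 0)(0 := n)) u"
    and supp: "\<And>x. L < \<bar>x\<bar> \<Longrightarrow> u x = 0" and L: "0 \<le> L" and U: "\<And>x. u x \<le> U"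
    and m: "1 \<le> m" "m < K" and \<zeta>: "0 \<le> \<zeta>"
    and right: "\<And>t i j. 0 \<le> t \<Longrightarrow> t \<le> L \<Longrightarrow> K \<le> i \<Longrightarrow> i \<le> n + U \<Longrightarrow> j \<le> n + U \<Longrightarrow>
      \<not> overfull lam {t * int m..t * int m + int m - 1} (ends (t * int m) (t * int m + int m - 1) i j) (\<zeta> * real m) \<rho>"
    and left: "\<And>t i j. 0 \<le> t \<Longrightarrow> t \<le> L \<Longrightarrow> K \<le> i \<Longrightarrow> i \<le> n + U \<Longrightarrow> j \<le> n + U \<Longrightarrow>
      \<not> overfull lam {- (t * int m + int m - 1)..- (t * int m)} (ends (- (t * int m)) (- (t * int m + int m - 1)) i j) (\<zeta> * real m) \<rho>"
  shows "real n \<le> \<zeta> * (real (card {x. u x \<noteq> 0}) + 1) + 2 * real K"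
proof -
  let ?\<eta> = "(\<lambda>_. 0)(0 := n)"
  have fin: "finite {x. u x \<noteq> 0}" using supp by (rule finite_support)
  have R: "of_int (\<Sum>x\<in>{0..L+1}. net \<rho> ?\<eta> u x) \<le> \<zeta> * real (card {x. 0 \<le> x \<and> u x \<noteq> 0}) + real K"
    by (rule right_mass[OF min supp L U m \<zeta> right])
  have \<eta>m: "(\<lambda>x :: int. ?\<eta> (- x)) = ?\<eta>" by auto
  have minm: "min_odo lam UNIV (mirror \<rho>) ?\<eta> (\<lambda>x. u (- x))"
    using min_odo_mirror[of lam UNIV \<rho> ?\<eta> u] min \<eta>m by simp
  have "of_int (\<Sum>x\<in>{0..L+1}. net (mirror \<rho>) ?\<eta> (\<lambda>x. u (- x)) x) \<le>
      \<zeta> * real (card {x. 0 \<le> x \<and> u (- x) \<noteq> 0}) + real K"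
  proof (rule right_mass[OF minm _ L _ m \<zeta>])
    fix t i j assume a: "0 \<le> t" "t \<le> L" "K \<le> i" "i \<le> n + U" "j \<le> n + U"
    let ?c = "t * int m" and ?d = "t * int m + int m - 1"
    have e: "(\<lambda>x. ends (- ?c) (- ?d) i j (- x)) = ends ?c ?d i j"
      by (auto simp: ends_def)
    have J: "uminus ` {- ?d..- ?c} = {?c..?d}" by (simp add: image_uminus_atLeastAtMost)
    show "\<not> overfull lam {?c..?d} (ends ?c ?d i j) (\<zeta> * real m) (mirror \<rho>)"
      using left[OF a] overfull_mirrorD[of lam "{- ?d..- ?c}" "ends (- ?c) (- ?d) i j" "\<zeta> * real m" \<rho>]
      unfolding e J by blast
  qed (use supp U in auto)
  also have "(\<Sum>x\<in>{0..L+1}. net (mirror \<rho>) ?\<eta> (\<lambda>x. u (- x)) x) = (\<Sum>x\<in>{-(L+1)..0}. net \<rho> ?\<eta> u x)"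
    using net_mirror[of \<rho> ?\<eta> u] unfolding \<eta>m
    by (intro sum.reindex_bij_witness[of _ uminus uminus]) auto
  also have "card {x. 0 \<le> x \<and> u (- x) \<noteq> 0} = card {x. x \<le> 0 \<and> u x \<noteq> 0}"
    by (rule bij_betw_same_card[of uminus])
       (auto simp: bij_betw_def inj_on_def image_iff intro!: exI[of _ "- _"])
  finally have Lm: "of_int (\<Sum>x\<in>{-(L+1)..0}. net \<rho> ?\<eta> u x) \<le> \<zeta> * real (card {x. x \<le> 0 \<and> u x \<noteq> 0}) + real K" .
  have "(\<Sum>x\<in>{-(L+1)..L+1}. net \<rho> ?\<eta> u x) = int n"
  proof -
    have z: "u (L + 1) = 0" "u (L + 1 + 1) = 0" "u (- (L + 1)) = 0" "u (- (L + 1) - 1) = 0"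
      using supp L by auto
    have "- (L + 1) \<le> L + 1" using L by simp
    from sum_net_interval[OF this, of \<rho> ?\<eta> u] z
    have "(\<Sum>x\<in>{-(L+1)..L+1}. net \<rho> ?\<eta> u x) = (\<Sum>x\<in>{-(L+1)..L+1}. int (?\<eta> x))" by simp
    also have "\<dots> = (\<Sum>x\<in>{0 :: int}. int (?\<eta> x))"
      by (rule sum.mono_neutral_right) (use L in auto)
    finally show ?thesis by simp
  qed
  moreover have "(\<Sum>x\<in>{-(L+1)..L+1}. net \<rho> ?\<eta> u x) \<le> (\<Sum>x\<in>{-(L+1)..0}. net \<rho> ?\<eta> u x) + (\<Sum>x\<in>{0..L+1}. net \<rho> ?\<eta> u x)"
  proof -
    have split: "{-(L+1)..L+1} = {-(L+1)..0} \<union> {1..L+1}" using L by auto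
    have "(\<Sum>x\<in>{-(L+1)..L+1}. net \<rho> ?\<eta> u x) = (\<Sum>x\<in>{-(L+1)..0}. net \<rho> ?\<eta> u x) + (\<Sum>x\<in>{1..L+1}. net \<rho> ?\<eta> u x)"
      unfolding split by (rule sum.union_disjoint) auto
    moreover have "(\<Sum>x\<in>{1..L+1}. net \<rho> ?\<eta> u x) \<le> (\<Sum>x\<in>{0..L+1}. net \<rho> ?\<eta> u x)"
      using min_odo_net_nonneg[OF min fin] by (intro sum_mono2) auto
    ultimately show ?thesis by simp
  qed
  ultimately have "real n \<le> of_int (\<Sum>x\<in>{-(L+1)..0}. net \<rho> ?\<eta> u x) + of_int (\<Sum>x\<in>{0..L+1}. net \<rho> ?\<eta> u x)"
    by linarith
  also have "\<dots> \<le> \<zeta> * real (card {x. x \<le> 0 \<and> u x \<noteq> 0} + card {x. 0 \<le> x \<and> u x \<noteq> 0}) + 2 * real K"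
    using R Lm by (simp add: algebra_simps)
  also have "\<dots> \<le> \<zeta> * real (card {x. u x \<noteq> 0} + 1) + 2 * real K"
  proof -
    let ?A = "{x. x \<le> 0 \<and> u x \<noteq> 0}" and ?B = "{x. 0 \<le> x \<and> u x \<noteq> 0}"
    have f: "finite ?A" "finite ?B" by (auto intro: finite_subset[OF _ fin])
    have "card ?A + card ?B = card (?A \<union> ?B) + card (?A \<inter> ?B)" by (rule card_Un_Int[OF f])
    moreover have "?A \<union> ?B = {x. u x \<noteq> 0}" by auto
    moreover have "card (?A \<inter> ?B) \<le> card {0 :: int}" by (rule card_mono) auto
    ultimately have "card ?A + card ?B \<le> card {x. u x \<noteq> 0} + 1" by simp
    then show ?thesis using \<zeta> by (intro add_right_mono mult_left_mono) (simp_all only: of_nat_le_iff)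
  qed
  finally show ?thesis by (simp add: add.commute)
qed

section \<open>The bounds along a sparse sequence\<close>

text \<open>With \<open>m = k ^ 9\<close> one has \<open>k ^ 19 = m * (m * k)\<close>, so the power
  is at most \<open>exp (- (m * k / 8))\<close>, which beats \<open>2 ^ m\<close> from
  \<open>k = 16\<close> on. The target is \<open>(k ^ 9) ^ 20\<close>, the error allowed in the
  definition of the inner density.\<close>

lemma fill_error_small:
  "\<forall>\<^sub>F k in sequentially. 2 ^ (k ^ 9) * (1 - 1 / (2 * (real (k ^ 9) + 1))) ^ (k ^ 19 - 1) \<le> 1 / real k ^ 180"
proof -
  have "((\<lambda>x :: real. x ^ 180 / exp x) \<longlongrightarrow> 0) at_top" by (rule tendsto_power_div_exp_0)
  then have "\<forall>\<^sub>F x :: real in at_top. x ^ 180 / exp x < 1" by (rule order_tendstoD) simp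
  then have "\<forall>\<^sub>F k in sequentially. real k ^ 180 / exp (real k) < 1"
    by (rule eventually_compose_filterlim) (rule filterlim_real_sequentially)
  then show ?thesis
    using eventually_ge_at_top[of "16 :: nat"]
  proof eventually_elim
    case (elim k)
    define m where "m = real k ^ 9"
    have k: "real k \<ge> 16" using elim by simp
    have m1: "m \<ge> 1" unfolding m_def using k by (intro one_le_power) simp
    have mk: "m \<ge> real k" unfolding m_def using k power_increasing[of 1 9 "real k"] by simp
    have K: "real (k ^ 19 - 1) \<ge> m * (m * real k) / 2"
    proof -
      have e: "real k ^ 19 = m * (m * real k)" unfolding m_def by (simp add: power_add[symmetric] power_Suc2[symmetric])
      have "real k ^ 1 \<le> real k ^ 19" using k by (intro power_increasing) auto
      then have "2 \<le> real k ^ 19" using k unfolding power_one_right by linarith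
      moreover have "real (k ^ 19 - 1) \<ge> real (k ^ 19) - 1" by linarith
      ultimately have "real (k ^ 19 - 1) \<ge> real k ^ 19 / 2" unfolding of_nat_power by linarith
      then show ?thesis by (simp add: e)
    qed
    define x where "x = 1 / (2 * (m + 1))"
    have x: "0 \<le> x" "x \<le> 1" using m1 by (auto simp: x_def)
    have "(1 - x) ^ (k ^ 19 - 1) \<le> exp (- x) ^ (k ^ 19 - 1)"
      using exp_ge_add_one_self[of "- x"] x by (intro power_mono) auto
    also have "\<dots> = exp (- (x * real (k ^ 19 - 1)))" by (simp add: exp_of_nat_mult[symmetric] mult.commute)
    also have "\<dots> \<le> exp (- (m * real k / 8))"
    proof -
      have "m * real k / 8 = 1 / (4 * m) * (m * (m * real k) / 2)" using m1 by (simp add: field_simps)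
      also have "\<dots> \<le> x * real (k ^ 19 - 1)"
      proof (rule mult_mono[OF _ K])
        show "1 / (4 * m) \<le> x" unfolding x_def using m1 by (intro divide_left_mono) auto
      qed (use x m1 in auto)
      finally show ?thesis by simp
    qed
    finally have 1: "(1 - x) ^ (k ^ 19 - 1) \<le> exp (- (m * real k / 8))" .
    have "2 ^ (k ^ 9) = (2 :: real) powr m" by (simp add: m_def powr_realpow[symmetric])
    also have "\<dots> \<le> exp 1 powr m" using exp_ge_add_one_self[of 1] m1 by (intro powr_mono2) auto
    also have "\<dots> = exp m" by (simp add: powr_def)
    finally have 2: "(2 :: real) ^ (k ^ 9) \<le> exp m" .
    have "2 ^ (k ^ 9) * (1 - x) ^ (k ^ 19 - 1) \<le> exp m * exp (- (m * real k / 8))"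
      using 1 2 x by (intro mult_mono) auto
    also have "\<dots> = exp (m - m * real k / 8)" by (simp add: exp_add[symmetric])
    also have "\<dots> \<le> exp (- real k)"
    proof -
      have "m * 16 \<le> m * real k" using k m1 by (intro mult_left_mono) auto
      then show ?thesis using mk by simp
    qed
    also have "\<dots> \<le> 1 / real k ^ 180" using elim k by (simp add: exp_minus field_simps)
    finally show ?case by (simp add: x_def m_def)
  qed
qed

lemma segment_intervals:
  "segment 1 c m = {c..c + int m - 1}" "segment (-1) (-c) m = {-(c + int m - 1)..-c}"
  by (auto simp: segment_def)

text \<open>With \<open>n = k ^ 20\<close>, tiles have length \<open>k ^ 9\<close>, \<open>k ^ 19\<close> entrances fill a tile, and fewer than
  \<open>k ^ 70\<close> firings take place, so that the union bound has at most of order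
  \<open>k ^ 20 * k ^ 70 * k ^ 70\<close> terms, each of order \<open>(k ^ 9) ^ (- 20)\<close>.\<close>

lemma scale_bound:
  assumes \<zeta>o: "0 < \<zeta>o" "\<zeta>o < 1" and fin: "outer_moment lam \<zeta>o < \<infinity>" and \<epsilon>: "0 < \<epsilon>"
    and \<zeta>: "zeta_in lam < \<zeta>"
  shows "\<exists>B K. \<forall>k\<ge>K. outer_le lam {\<rho>. \<not> (\<exists>u. min_odo lam UNIV \<rho> ((\<lambda>_. 0)(0 := scale k)) u \<and>
      (\<forall>x. (1 + 2 * \<epsilon>) * real (scale k) / (2 * \<zeta>o) + 2 < \<bar>of_int x\<bar> \<longrightarrow> u x = 0) \<and>
      real (scale k) \<le> \<zeta> * (real (card {x. u x \<noteq> 0}) + 1) + 2 * real (k ^ 19))} (B / real k ^ 2)"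
proof -
  obtain B0 K0 where out: "\<And>k. k \<ge> K0 \<Longrightarrow> outer_le lam
    {\<rho>. \<not> (\<exists>v. stable_odo lam UNIV \<rho> ((\<lambda>_. 0)(0 := scale k)) v \<and>
       (\<forall>x. (1 + 2 * \<epsilon>) * real (scale k) / (2 * \<zeta>o) + 2 < \<bar>of_int x\<bar> \<longrightarrow> v x = 0))} (B0 / real k ^ 2)"
    using outer_scale[OF \<zeta>o fin \<epsilon>] by blast
  obtain N where dens: "\<And>a b. a \<le> b \<Longrightarrow> N \<le> card {a..b} \<Longrightarrow>
    outer_le lam {\<rho>. overfull lam {a..b} (ones {a..b}) (\<zeta> * real (card {a..b})) \<rho>} (1 / real (card {a..b}) ^ 20)"
    using zeta_in_overfull[OF \<zeta>] by blast
  obtain K1 where small: "\<And>k. k \<ge> K1 \<Longrightarrow>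
    2 ^ (k ^ 9) * (1 - 1 / (2 * (real (k ^ 9) + 1))) ^ (k ^ 19 - 1) \<le> 1 / real k ^ 180"
    using fill_error_small unfolding eventually_sequentially by blast
  \<comment> \<open>The 3 absorbs the additive 2 of the radius and the 1 in \<open>L + 1\<close>,
    because \<open>n\<close> is at least 1.\<close>
  define a where "a = (1 + 2 * \<epsilon>) / (2 * \<zeta>o) + 3"
  have a: "a \<ge> 0" using \<zeta>o \<epsilon> by (simp add: a_def add_nonneg_nonneg)
  define q where "q = move_prob lam"
  have q: "q > 0" unfolding q_def by (rule instr_pmf_values)
  define B where "B = B0 + a ^ 2 / (2 * q) + 36 * a"
  define Kmax where "Kmax = K0 + K1 + N + 2"
  have \<zeta>0: "0 \<le> \<zeta>" using zeta_in_nonneg[of lam] \<zeta> by simp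
  have "outer_le lam {\<rho>. \<not> (\<exists>u. min_odo lam UNIV \<rho> ((\<lambda>_. 0)(0 := scale k)) u \<and>
      (\<forall>x. (1 + 2 * \<epsilon>) * real (scale k) / (2 * \<zeta>o) + 2 < \<bar>of_int x\<bar> \<longrightarrow> u x = 0) \<and>
      real (scale k) \<le> \<zeta> * (real (card {x. u x \<noteq> 0}) + 1) + 2 * real (k ^ 19))} (B / real k ^ 2)"
    if k: "k \<ge> Kmax" for k
  proof -
    define n where "n = scale k"
    define m where "m = k ^ 9"
    define K where "K = k ^ 19"
    define T where "T = k ^ 70"
    define R where "R = (1 + 2 * \<epsilon>) * real n / (2 * \<zeta>o) + 2"
    define L where "L = \<lfloor>R\<rfloor>"
    let ?s = "(\<lambda>_. 0)(0 := n)"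
    let ?W = "{- (L + 1)<..<L + 1}"
    have k2: "k \<ge> 2" "k \<ge> K0" "k \<ge> K1" "k \<ge> N" using k by (auto simp: Kmax_def)
    have kr: "real k \<ge> 1" using k2 by simp
    have rn: "real n = real k ^ 20" by (simp add: n_def scale_def)
    have n1: "real n \<ge> 1" unfolding rn using kr by (rule one_le_power)
    have m1: "1 \<le> m" using k2 by (simp add: m_def)
    have mk: "k \<le> m" unfolding m_def using k2 by (intro self_le_power) auto
    have mK: "m < K" unfolding m_def K_def using k2 by (intro power_strict_increasing) auto
    have K1: "1 \<le> K" using m1 mK by simp
    have T0: "T > 0" using k2 by (simp add: T_def)
    have R0: "0 \<le> R" using \<zeta>o \<epsilon> by (simp add: R_def)
    have L0: "0 \<le> L" using R0 by (simp add: L_def)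
    have La: "of_int (L + 1) \<le> a * real k ^ 20"
    proof -
      have "of_int (L + 1) \<le> R + 1" unfolding L_def by (simp add: of_int_floor_le)
      also have "\<dots> \<le> a * real n" using n1 by (simp add: R_def a_def algebra_simps)
      finally show ?thesis by (simp add: rn)
    qed
    let ?O = "{\<rho>. \<not> (\<exists>v. stable_odo lam UNIV \<rho> ?s v \<and> (\<forall>x. R < \<bar>of_int x\<bar> \<longrightarrow> v x = 0))}"
    let ?N = "{\<rho>. walk_out ?W (run_cfg (walk_out ?W) T ?s \<rho>) \<noteq> None}"
    define J1 where "J1 t = {t * int m..t * int m + int m - 1}" for t
    define J2 where "J2 t = {- (t * int m + int m - 1)..- (t * int m)}" for t
    define I where "I = {0..L} \<times> {K..n + T} \<times> {..n + T}"
    define E1 where "E1 = (\<lambda>(t, i, j). {\<rho>. overfull lam (J1 t) (ends (t * int m) (t * int m + int m - 1) i j) (\<zeta> * real m) \<rho>})"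
    define E2 where "E2 = (\<lambda>(t, i, j). {\<rho>. overfull lam (J2 t) (ends (- (t * int m)) (- (t * int m + int m - 1)) i j) (\<zeta> * real m) \<rho>})"
    define p where "p = 2 / real k ^ 180"
    have O: "outer_le lam ?O (B0 / real k ^ 2)"
      using out[OF k2(2)] unfolding R_def n_def .
    \<comment> \<open>The weight \<open>(L + 1) ^ 2 * n\<close> is of order \<open>k ^ 60\<close>,
      so a cap of \<open>k ^ 70\<close> steps leaves an error of order
      \<open>k ^ (-10)\<close>.\<close>
    have N: "outer_le lam ?N (a ^ 2 / (2 * q) / real k ^ 2)"
    proof (rule outer_le_mono[OF walk_out_nonterm[where L = "L + 1" and T = T and \<eta> = ?s]])
      have "(\<Sum>x\<in>{-(L+1)..L+1}. (of_int (L+1) ^ 2 - of_int x ^ 2) * real (?s x)) =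
          (\<Sum>x\<in>{0 :: int}. (of_int (L+1) ^ 2 - of_int x ^ 2) * real (?s x))"
        by (rule sum.mono_neutral_right) (use L0 in auto)
      also have "\<dots> = of_int (L + 1) ^ 2 * real n" by simp
      also have "\<dots> \<le> (a * real k ^ 20) ^ 2 * real n"
        using La L0 by (intro mult_right_mono power_mono) auto
      also have "\<dots> = a ^ 2 * real k ^ 60" by (simp add: rn power_mult_distrib power_add[symmetric] power_mult[symmetric])
      finally have "(\<Sum>x\<in>{-(L+1)..L+1}. (of_int (L+1) ^ 2 - of_int x ^ 2) * real (?s x)) / (2 * q * T) \<le> a ^ 2 * real k ^ 60 / (2 * q * T)"
        using q by (intro divide_right_mono) auto
      also have "\<dots> = a ^ 2 / (2 * q) * (real k ^ 60 / real k ^ 70)" by (simp add: T_def)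
      also have "real k ^ 60 / real k ^ 70 = 1 / real k ^ 10" using kr by (simp add: field_simps power_add[symmetric])
      also have "a ^ 2 / (2 * q) * (1 / real k ^ 10) \<le> a ^ 2 / (2 * q) * (1 / real k ^ 2)"
        using kr q power_increasing[of 2 10 "real k"] by (intro mult_left_mono divide_left_mono) auto
      finally show "(\<Sum>x\<in>{-(L+1)..L+1}. (of_int (L+1) ^ 2 - of_int x ^ 2) * real (?s x)) / (2 * move_prob lam * T) \<le> a ^ 2 / (2 * q) / real k ^ 2"
        by (simp add: q_def)
    qed (use T0 in auto)
    have cJ: "card (J1 t) = m" "card (J2 t) = m" for t by (simp_all add: J1_def J2_def)
    have err: "1 / real m ^ 20 + 2 ^ m * (1 - 1 / (2 * (real m + 1))) ^ (K - 1) \<le> p"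
    proof -
      have "real m ^ 20 = real k ^ 180" by (simp add: m_def power_mult[symmetric])
      then show ?thesis using small[OF k2(3)] by (simp add: p_def m_def K_def)
    qed
    have E1: "outer_le lam (E1 w) p" if "w \<in> I" for w
    proof -
      obtain t i j where w: "w = (t, i, j)" by (cases w)
      have "K \<le> i" using that by (simp add: I_def w)
      have d: "outer_le lam {\<rho>. overfull lam (J1 t) (ones (J1 t)) (\<zeta> * real m) \<rho>} (1 / real m ^ 20)"
        using dens[of "t * int m" "t * int m + int m - 1"] m1 mk k2(4) cJ(1)[of t] unfolding J1_def by simp
      have "outer_le lam {\<rho>. overfull lam (J1 t) (ends (t * int m) (t * int m + int m - 1) i j) (\<zeta> * real m) \<rho>}
        (1 / real m ^ 20 + 2 ^ card (J1 t) * (1 - 1 / (2 * (real m + 1))) ^ (K - 1))"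
        by (rule overfull_from_source[OF _ m1 K1 _ _ d, of 1 "t * int m"])
           (use \<open>K \<le> i\<close> in \<open>auto simp: segment_intervals J1_def ends_def\<close>)
      then show ?thesis using err by (auto simp: E1_def w cJ intro: outer_le_mono)
    qed
    have E2: "outer_le lam (E2 w) p" if "w \<in> I" for w
    proof -
      obtain t i j where w: "w = (t, i, j)" by (cases w)
      have "K \<le> i" using that by (simp add: I_def w)
      have d: "outer_le lam {\<rho>. overfull lam (J2 t) (ones (J2 t)) (\<zeta> * real m) \<rho>} (1 / real m ^ 20)"
        using dens[of "- (t * int m + int m - 1)" "- (t * int m)"] m1 mk k2(4) cJ(2)[of t] unfolding J2_def by simp
      have "outer_le lam {\<rho>. overfull lam (J2 t) (ends (- (t * int m)) (- (t * int m + int m - 1)) i j) (\<zeta> * real m) \<rho>}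
        (1 / real m ^ 20 + 2 ^ card (J2 t) * (1 - 1 / (2 * (real m + 1))) ^ (K - 1))"
      proof (rule overfull_from_source[OF _ m1 K1 _ _ d, of "-1" "- (t * int m)"])
        show "J2 t = segment (- 1) (- (t * int m)) m" unfolding segment_intervals J2_def ..
      qed (use \<open>K \<le> i\<close> in \<open>auto simp: ends_def\<close>)
      then show ?thesis using err by (auto simp: E2_def w cJ intro: outer_le_mono)
    qed
    have finI: "finite I" by (simp add: I_def)
    \<comment> \<open>The constant is 3 * 3 * 2: each entrance number has at most
      \<open>3 * k ^ 70\<close> values, and \<open>p\<close> contains a factor 2 for density and
      filling error.\<close>
    have cardI: "real (card I) * p \<le> 18 * a / real k ^ 2"
    proof -
      have "card I \<le> nat (L + 1) * ((n + T + 1) * (n + T + 1))"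
        unfolding I_def card_cartesian_product by (intro mult_mono) auto
      then have "real (card I) \<le> real (nat (L + 1) * ((n + T + 1) * (n + T + 1)))" by (simp only: of_nat_le_iff)
      also have "\<dots> = of_int (L + 1) * (real (n + T + 1) * real (n + T + 1))"
      proof -
        have "real (nat (L + 1)) = of_int (L + 1)" using L0 by simp
        then show ?thesis by (simp only: of_nat_mult)
      qed
      also have "\<dots> \<le> (a * real k ^ 20) * ((3 * real k ^ 70) * (3 * real k ^ 70))"
      proof -
        have "real k ^ 20 \<le> real k ^ 70" using kr by (intro power_increasing) auto
        moreover have "1 \<le> real k ^ 70" using kr by (rule one_le_power)
        moreover have "real (n + T + 1) = real k ^ 20 + real k ^ 70 + 1" by (simp add: rn T_def)
        ultimately have "real (n + T + 1) \<le> 3 * real k ^ 70" by linarith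
        then show ?thesis using La L0 a by (intro mult_mono) auto
      qed
      also have "\<dots> = 9 * a * real k ^ 160" by (simp add: power_add[symmetric])
      finally have "real (card I) * p \<le> 9 * a * real k ^ 160 * p"
        by (intro mult_right_mono) (auto simp: p_def)
      also have "\<dots> = 18 * a * (real k ^ 160 / real k ^ 180)" by (simp add: p_def)
      also have "real k ^ 160 / real k ^ 180 = 1 / real k ^ 20" using kr by (simp add: field_simps power_add[symmetric])
      also have "18 * a * (1 / real k ^ 20) \<le> 18 * a * (1 / real k ^ 2)"
        using kr a power_increasing[of 2 20 "real k"] by (intro mult_left_mono divide_left_mono) auto
      finally show ?thesis by simp
    qed
    have "outer_le lam (\<Union>w\<in>I. E1 w) (\<Sum>w\<in>I. p)" "outer_le lam (\<Union>w\<in>I. E2 w) (\<Sum>w\<in>I. p)"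
      by (rule outer_le_UN[OF finI]; use E1 E2 in blast)+
    then have U: "outer_le lam (\<Union>w\<in>I. E1 w) (18 * a / real k ^ 2)" "outer_le lam (\<Union>w\<in>I. E2 w) (18 * a / real k ^ 2)"
      using cardI by (auto intro: outer_le_mono)
    have "outer_le lam (?O \<union> ?N \<union> (\<Union>w\<in>I. E1 w) \<union> (\<Union>w\<in>I. E2 w))
      (B0 / real k ^ 2 + a ^ 2 / (2 * q) / real k ^ 2 + 18 * a / real k ^ 2 + 18 * a / real k ^ 2)"
      by (intro outer_le_Un O N U)
    then show ?thesis
      unfolding n_def[symmetric] K_def[symmetric] R_def[symmetric]
    proof (rule outer_le_mono)
      show "B0 / real k ^ 2 + a ^ 2 / (2 * q) / real k ^ 2 + 18 * a / real k ^ 2 + 18 * a / real k ^ 2 \<le> B / real k ^ 2"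
        by (simp add: B_def add_divide_distrib)
      show "{\<rho>. \<not> (\<exists>u. min_odo lam UNIV \<rho> ?s u \<and> (\<forall>x. R < \<bar>of_int x\<bar> \<longrightarrow> u x = 0) \<and>
          real n \<le> \<zeta> * (real (card {x. u x \<noteq> 0}) + 1) + 2 * real K)}
        \<subseteq> ?O \<union> ?N \<union> (\<Union>w\<in>I. E1 w) \<union> (\<Union>w\<in>I. E2 w)"
      proof (rule subsetI, rule ccontr)
        fix \<rho>
        assume "\<rho> \<in> {\<rho>. \<not> (\<exists>u. min_odo lam UNIV \<rho> ?s u \<and> (\<forall>x. R < \<bar>of_int x\<bar> \<longrightarrow> u x = 0) \<and>
          real n \<le> \<zeta> * (real (card {x. u x \<noteq> 0}) + 1) + 2 * real K)}"
        then have no: "\<not> (\<exists>u. min_odo lam UNIV \<rho> ?s u \<and> (\<forall>x. R < \<bar>of_int x\<bar> \<longrightarrow> u x = 0) \<and>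
          real n \<le> \<zeta> * (real (card {x. u x \<noteq> 0}) + 1) + 2 * real K)" by (rule CollectD)
        assume "\<rho> \<notin> ?O \<union> ?N \<union> (\<Union>w\<in>I. E1 w) \<union> (\<Union>w\<in>I. E2 w)"
        then have g: "\<rho> \<notin> ?O" "\<rho> \<notin> ?N" "\<And>w. w \<in> I \<Longrightarrow> \<rho> \<notin> E1 w" "\<And>w. w \<in> I \<Longrightarrow> \<rho> \<notin> E2 w"
          by (simp_all only: Un_iff UN_iff) blast+
        obtain v where v: "stable_odo lam UNIV \<rho> ?s v" "\<And>x. R < \<bar>of_int x\<bar> \<Longrightarrow> v x = 0" using g(1) by blast
        obtain u where u: "min_odo lam UNIV \<rho> ?s u" using min_odo_exists[OF v(1)] by blast
        have uR: "u x = 0" if "R < \<bar>of_int x\<bar>" for x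
          using min_odo_least[OF u v(1), of x] v(2)[OF that] by simp
        have uL: "u x = 0" if "L < \<bar>x\<bar>" for x
        proof (rule uR)
          have "\<lfloor>R\<rfloor> + 1 \<le> \<bar>x\<bar>" using that by (simp add: L_def)
          then have "of_int (\<lfloor>R\<rfloor> + 1) \<le> (of_int \<bar>x\<bar> :: real)" by (simp only: of_int_le_iff)
          then show "R < \<bar>of_int x\<bar>" by simp linarith
        qed
        define w where "w = run_odo (walk_out ?W) T ?s \<rho>"
        have w: "stable_odo lam ?W \<rho> ?s w"
          unfolding w_def by (rule stable_odo_walk_out) (use g(2) in auto)
        \<comment> \<open>Since \<open>u\<close> vanishes outside \<open>?W\<close>, nothing enters
          \<open>?W\<close>, and \<open>u\<close> is dominated by the odometer of walking out, whose
          total is at most \<open>T\<close>. This makes the range of entrance numbers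
          finite.\<close>
        have uT: "u x \<le> T" for x
        proof (cases "x \<in> ?W")
          case True
          have "u x \<le> w x"
          proof (rule min_odo_le_on[OF u _ w _ True])
            fix y assume y: "y \<in> ?W"
            have "u (y - 1) = 0" if "y - 1 \<notin> ?W" using that y by (intro uL) auto
            moreover have "u (y + 1) = 0" if "y + 1 \<notin> ?W" using that y by (intro uL) auto
            ultimately show "restr_cfg ?W \<rho> ?s u y \<le> ?s y" by (simp add: restr_cfg_def)
          qed simp
          also have "w x \<le> sum w ?W" using True by (intro member_le_sum) auto
          also have "\<dots> \<le> T" unfolding w_def
            by (rule run_odo_sum) (use pick_Some in force)+
          finally show ?thesis .
        next
          case False
          then have "L < \<bar>x\<bar>" by auto
          then show ?thesis using uL by simp
        qed
        have "real n \<le> \<zeta> * (real (card {x. u x \<noteq> 0}) + 1) + 2 * real K"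
        proof (rule fired_count[OF u uL L0 uT m1 mK \<zeta>0])
          fix t i j assume "0 \<le> t" "t \<le> L" "K \<le> i" "i \<le> n + T" "j \<le> n + T"
          then have "(t, i, j) \<in> I" by (simp add: I_def)
          from g(3)[OF this] g(4)[OF this]
          show "\<not> overfull lam {t * int m..t * int m + int m - 1} (ends (t * int m) (t * int m + int m - 1) i j) (\<zeta> * real m) \<rho>"
            and "\<not> overfull lam {- (t * int m + int m - 1)..- (t * int m)} (ends (- (t * int m)) (- (t * int m + int m - 1)) i j) (\<zeta> * real m) \<rho>"
            by (auto simp: E1_def E2_def J1_def J2_def)
        qed
        then show False using no u uR by blast
      qed
    qed
  qed
  then show ?thesis by blast
qed

section \<open>From the sequence to all particle numbers\<close>

text \<open>Consecutive scales have ratio tending to 1, and \<open>k ^ 19\<close> is of lower order,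
  so any factor below 1 pays for both.\<close>

lemma scale_inner_eventually:
  fixes \<theta> \<zeta> :: real
  assumes "\<theta> < 1"
  shows "\<forall>\<^sub>F k in sequentially. \<theta> * real (scale (k + 1)) \<le> real (scale k) - 2 * real (k ^ 19) - \<zeta>"
proof -
  have "(\<lambda>k. (real k ^ 20 - 2 * real k ^ 19 - \<zeta>) / (real k + 1) ^ 20) \<longlonglongrightarrow> 1" by real_asymp
  then have "\<forall>\<^sub>F k in sequentially. \<theta> < (real k ^ 20 - 2 * real k ^ 19 - \<zeta>) / (real k + 1) ^ 20"
    using assms by (rule order_tendstoD)
  then show ?thesis
  proof eventually_elim
    case (elim k)
    have "0 < (real k + 1) ^ 20" by simp
    then show ?case using elim by (simp add: scale_def field_simps)
  qed
qed

lemma scale_outer_eventually: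
  fixes b c d :: real
  assumes "0 < b" "b < c"
  shows "\<forall>\<^sub>F k in sequentially. b * real (scale (k + 1)) + d \<le> c * real (scale k)"
proof -
  have "(\<lambda>k. (b * (real k + 1) ^ 20 + d) / real k ^ 20) \<longlonglongrightarrow> b" by real_asymp
  then have "\<forall>\<^sub>F k in sequentially. (b * (real k + 1) ^ 20 + d) / real k ^ 20 < c"
    using assms(2) by (rule order_tendstoD)
  then show ?thesis using eventually_gt_at_top[of "0 :: nat"]
  proof eventually_elim
    case (elim k)
    then have "0 < real k ^ 20" by simp
    then show ?case using elim by (simp add: scale_def field_simps)
  qed
qed

lemma min_odo_mono:
  assumes "min_odo lam UNIV \<rho> \<eta> u" "min_odo lam UNIV \<rho> \<eta>' u'" "\<And>x. \<eta> x \<le> \<eta>' x"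
  shows "u x \<le> u' x"
  using min_odo_least[OF assms(1) stable_odo_mono[OF min_odo_stable[OF assms(2)]]] assms(3) by blast

theorem theorem1:
  fixes lam :: ennreal and \<epsilon> :: real
  assumes "0 < lam" and "zeta_out lam > 0" and "\<epsilon> > 0"
  shows "\<P>(\<rho> in stack_measure lam. \<forall>\<^sub>F n in sequentially.
           real (card (fired_set lam \<rho> n)) \<ge> real n / (zeta_in lam + \<epsilon>) \<and>
           fired_set lam \<rho> n \<subseteq> lattice_ball (real n / (2 * zeta_out lam) * (1 + \<epsilon>))) = 1"
proof -
  interpret prob_space "stack_measure lam" by (rule prob_space_stack)
  define Q where "Q n A \<longleftrightarrow> real (card A) \<ge> real n / (zeta_in lam + \<epsilon>) \<and>
    A \<subseteq> lattice_ball (real n / (2 * zeta_out lam) * (1 + \<epsilon>))" for n and A :: "int set"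
  define zo where "zo = zeta_out lam"
  define zi where "zi = zeta_in lam"
  have zo: "zo > 0" and zi: "0 \<le> zi" using assms zeta_in_nonneg by (auto simp: zo_def zi_def)
  \<comment> \<open>The radius carries a factor \<open>1 + 2 * \<delta>\<close> from
    \<open>scale_bound\<close> and one below \<open>1 + \<delta>\<close> from taking a density under
    the supremum; as \<delta> is at most 1, the product is below \<open>1 + 5 * \<delta>\<close>,
    within \<open>1 + \<epsilon>\<close>.\<close>
  define \<delta> where "\<delta> = min 1 (\<epsilon> / 8)"
  have \<delta>: "0 < \<delta>" "\<delta> \<le> 1" "8 * \<delta> \<le> \<epsilon>" using assms by (auto simp: \<delta>_def)
  define Z where "Z = {\<zeta>. 0 < \<zeta> \<and> \<zeta> < 1 \<and> outer_moment lam \<zeta> < \<infinity>}"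
  have Z: "Z \<noteq> {}" "zo = Sup Z"
    using zo by (auto simp: zo_def zeta_out_def Let_def Z_def split: if_splits)
  have "zo / (1 + \<delta>) < zo" using zo \<delta> by (simp add: field_simps)
  then obtain \<zeta>o where "\<zeta>o \<in> Z" and \<zeta>lo: "zo / (1 + \<delta>) < \<zeta>o"
    using less_cSupE[of "zo / (1 + \<delta>)" Z] Z by auto
  then have \<zeta>o: "0 < \<zeta>o" "\<zeta>o < 1" "outer_moment lam \<zeta>o < \<infinity>" by (auto simp: Z_def)
  \<comment> \<open>Half of \<epsilon> is held back, so that the ratio of \<zeta> to
    \<open>zi + \<epsilon>\<close> is below 1 and can absorb the gap between consecutive
    scales.\<close>
  define \<zeta> where "\<zeta> = zi + \<epsilon> / 2"
  have \<zeta>: "zeta_in lam < \<zeta>" "0 < \<zeta>" using assms zi by (auto simp: \<zeta>_def zi_def)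
  define R where "R k = (1 + 2 * \<delta>) * real (scale k) / (2 * \<zeta>o) + 2" for k
  define good where "good k \<rho> \<longleftrightarrow> (\<exists>u. min_odo lam UNIV \<rho> ((\<lambda>_. 0)(0 := scale k)) u \<and>
      (\<forall>x. R k < \<bar>of_int x\<bar> \<longrightarrow> u x = 0) \<and>
      real (scale k) \<le> \<zeta> * (real (card {x. u x \<noteq> 0}) + 1) + 2 * real (k ^ 19))" for k \<rho>
  obtain B K where BK: "\<And>k. k \<ge> K \<Longrightarrow> outer_le lam {\<rho>. \<not> good k \<rho>} (B / real k ^ 2)"
    using scale_bound[OF \<zeta>o \<delta>(1) \<zeta>(1)] unfolding good_def R_def by blast
  have "summable (\<lambda>k. B * (1 / real k ^ 2))"
    using inverse_power_summable[of 2] by (intro summable_mult) (simp add: inverse_eq_divide)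
  then have "summable (\<lambda>k. B / real k ^ 2)" by simp
  from outer_le_eventually[OF BK this]
  have "AE \<rho> in stack_measure lam. \<forall>\<^sub>F k in sequentially. good k \<rho>" by simp
  then have "AE \<rho> in stack_measure lam. \<forall>\<^sub>F n in sequentially. Q n (fired_set lam \<rho> n)"
  proof (rule AE_mp, intro AE_I2 impI)
    fix \<rho> assume ev: "\<forall>\<^sub>F k in sequentially. good k \<rho>"
    define b where "b = (1 + 2 * \<delta>) / (2 * \<zeta>o)"
    define c where "c = (1 + \<epsilon>) / (2 * zo)"
    have bc: "0 < b" "b < c"
    proof -
      show "0 < b" using \<zeta>o \<delta> by (simp add: b_def)
      have "(1 + 2 * \<delta>) * zo < (1 + 2 * \<delta>) * (\<zeta>o * (1 + \<delta>))"
        using \<zeta>lo \<delta> zo by (intro mult_strict_left_mono) (auto simp: field_simps)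
      also have "\<dots> = \<zeta>o * (1 + 3 * \<delta> + 2 * (\<delta> * \<delta>))" by (simp add: algebra_simps)
      also have "\<dots> \<le> \<zeta>o * (1 + \<epsilon>)"
      proof -
        have "\<delta> * \<delta> \<le> \<delta> * 1" using \<delta> by (intro mult_left_mono) auto
        then have "1 + 3 * \<delta> + 2 * (\<delta> * \<delta>) \<le> 1 + \<epsilon>" using \<delta> by linarith
        then show ?thesis using \<zeta>o by (intro mult_left_mono) auto
      qed
      finally show "b < c" using \<zeta>o zo by (simp add: b_def c_def field_simps)
    qed
    have \<theta>: "\<zeta> / (zi + \<epsilon>) < 1" using zi assms by (simp add: \<zeta>_def)
    obtain k0 where k0: "\<And>k. k \<ge> k0 \<Longrightarrow> good k \<rho>"
      "\<And>k. k \<ge> k0 \<Longrightarrow> b * real (scale (k + 1)) + 2 \<le> c * real (scale k)"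
      "\<And>k. k \<ge> k0 \<Longrightarrow> \<zeta> / (zi + \<epsilon>) * real (scale (k + 1)) \<le> real (scale k) - 2 * real (k ^ 19) - \<zeta>"
      using eventually_conj[OF ev eventually_conj[OF scale_outer_eventually[OF bc, of 2] scale_inner_eventually[OF \<theta>, of \<zeta>]]]
      unfolding eventually_sequentially by blast
    show "\<forall>\<^sub>F n in sequentially. Q n (fired_set lam \<rho> n)"
      unfolding eventually_sequentially
    proof (intro exI allI impI)
      fix n assume n: "scale k0 \<le> n"
      have mono: "scale i \<le> scale j" if "i \<le> j" for i j unfolding scale_def using that by (rule power_mono) simp
      have "n < scale (Suc n)"
      proof -
        have "Suc n \<le> Suc n ^ 20" by (rule self_le_power) auto
        then show ?thesis by (simp add: scale_def)
      qed
      \<comment> \<open>Sandwich of \<open>n\<close> between \<open>scale k\<close> and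
        \<open>scale (k + 1)\<close>, where \<open>l = k + 1\<close>: the count of fired sites comes
        from the smaller scale, existence of the odometer and containment from the larger
        one.\<close>
      define l where "l = (LEAST j. n < scale j)"
      have l: "n < scale l" unfolding l_def by (rule LeastI) fact
      have "l \<noteq> 0"
      proof
        assume "l = 0"
        then show False using l by (simp add: scale_def)
      qed
      then obtain k where lk: "l = k + 1" by (cases l) auto
      have kn: "scale k \<le> n" using not_less_Least[of k "\<lambda>j. n < scale j"] lk by (simp add: l_def)
      have "k0 \<le> k"
      proof (rule ccontr)
        assume "\<not> k0 \<le> k"
        then have "scale (k + 1) \<le> scale k0" by (intro mono) simp
        then show False using l lk n by simp
      qed
      obtain u where u: "min_odo lam UNIV \<rho> ((\<lambda>_. 0)(0 := scale k)) u" "\<And>x. R k < \<bar>of_int x\<bar> \<Longrightarrow> u x = 0"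
        "real (scale k) \<le> \<zeta> * (real (card {x. u x \<noteq> 0}) + 1) + 2 * real (k ^ 19)"
        using k0(1)[OF \<open>k0 \<le> k\<close>] unfolding good_def by blast
      obtain u' where u': "min_odo lam UNIV \<rho> ((\<lambda>_. 0)(0 := scale (k + 1))) u'" "\<And>x. R (k + 1) < \<bar>of_int x\<bar> \<Longrightarrow> u' x = 0"
        using k0(1)[of "k + 1"] \<open>k0 \<le> k\<close> unfolding good_def by auto
      have "stable_odo lam UNIV \<rho> ((\<lambda>_. 0)(0 := n)) u'"
        by (rule stable_odo_mono[OF min_odo_stable[OF u'(1)]]) (use l lk in auto)
      then obtain w where w: "min_odo lam UNIV \<rho> ((\<lambda>_. 0)(0 := n)) w" using min_odo_exists by blast
      have uw: "u x \<le> w x" for x by (rule min_odo_mono[OF u(1) w]) (use kn in auto)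
      have wu': "w x \<le> u' x" for x by (rule min_odo_mono[OF w u'(1)]) (use l lk in auto)
      have wR: "w x = 0" if "R (k + 1) < \<bar>of_int x\<bar>" for x using wu'[of x] u'(2)[OF that] by simp
      have finw: "finite {x. w x \<noteq> 0}"
      proof (rule finite_support)
        fix x assume "\<lceil>R (k + 1)\<rceil> < \<bar>x\<bar>"
        then have "of_int \<lceil>R (k + 1)\<rceil> < (of_int \<bar>x\<bar> :: real)" by (simp only: of_int_less_iff)
        then have "R (k + 1) < \<bar>of_int x\<bar>"
          using le_of_int_ceiling[of "R (k + 1)"] unfolding of_int_abs by linarith
        then show "w x = 0" by (rule wR)
      qed
      have fs: "fired_set lam \<rho> n = {x. w x \<noteq> 0}" by (rule fired_set_eq[OF w finw])
      have "real n / (zi + \<epsilon>) \<le> real (card {x. w x \<noteq> 0})"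
      proof -
        have "\<zeta> * (real n / (zi + \<epsilon>)) = \<zeta> / (zi + \<epsilon>) * real n" by simp
        also have "\<dots> \<le> \<zeta> / (zi + \<epsilon>) * real (scale (k + 1))"
          using l lk \<zeta> zi assms by (intro mult_left_mono) auto
        also have "\<dots> \<le> \<zeta> * real (card {x. u x \<noteq> 0})"
          using k0(3)[OF \<open>k0 \<le> k\<close>] u(3) by (simp add: algebra_simps)
        also have "\<dots> \<le> \<zeta> * real (card {x. w x \<noteq> 0})"
        proof -
          have "u x \<noteq> 0 \<Longrightarrow> w x \<noteq> 0" for x using uw[of x] by simp
          then have "card {x. u x \<noteq> 0} \<le> card {x. w x \<noteq> 0}" by (intro card_mono finw) auto
          then show ?thesis using \<zeta> by (intro mult_left_mono) auto
        qed
        finally show ?thesis using \<zeta>(2) by (rule mult_left_le_imp_le)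
      qed
      moreover have "{x. w x \<noteq> 0} \<subseteq> lattice_ball (real n / (2 * zo) * (1 + \<epsilon>))"
      proof
        fix x assume "x \<in> {x. w x \<noteq> 0}"
        then have "\<not> R (k + 1) < \<bar>of_int x\<bar>" using wR[of x] by auto
        then have "\<bar>of_int x\<bar> \<le> R (k + 1)" by simp
        also have "\<dots> = b * real (scale (k + 1)) + 2" by (simp add: R_def b_def)
        also have "\<dots> \<le> c * real (scale k)" by (rule k0(2)[OF \<open>k0 \<le> k\<close>])
        also have "\<dots> \<le> c * real n" using kn bc by (intro mult_left_mono) auto
        finally have "\<bar>of_int x\<bar> \<le> real n / (2 * zo) * (1 + \<epsilon>)" by (simp add: c_def mult.commute)
        then show "x \<in> lattice_ball (real n / (2 * zo) * (1 + \<epsilon>))"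
          unfolding lattice_ball_def by (auto simp: abs_le_iff)
      qed
      ultimately show "Q n (fired_set lam \<rho> n)" unfolding Q_def fs zo_def zi_def by blast
    qed
  qed
  \<comment> \<open>The covers give only an almost sure statement; a probability equal to 1 also
    requires the event itself to be measurable.\<close>
  moreover have "Measurable.pred (stack_measure lam) (\<lambda>\<rho>. \<forall>\<^sub>F n in sequentially. Q n (fired_set lam \<rho> n))"
  proof -
    have [measurable]: "Measurable.pred (stack_measure lam) (\<lambda>\<rho>. Q n (fired_set lam \<rho> n))" for n
      by (rule fired_set_pred_measurable)
    show ?thesis unfolding eventually_sequentially by measurable
  qed
  then have "{\<rho> \<in> space (stack_measure lam). \<forall>\<^sub>F n in sequentially. Q n (fired_set lam \<rho> n)} \<in> events"
    by (simp only: pred_def)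
  ultimately have "prob {\<rho> \<in> space (stack_measure lam). \<forall>\<^sub>F n in sequentially. Q n (fired_set lam \<rho> n)} = 1"
    by (simp only: prob_Collect_eq_1)
  then show ?thesis by (simp only: Q_def)
qed

end
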